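(* Let $\delta\in(0,1]$ and $\lambda>0$ be constants and consider the planted cycles model $\mathcal{G}(n,\lambda,\delta)$ conditional on $H^*=h$. If $\lambda<\frac{1}{(\sqrt{2\delta}+\sqrt{1-\delta})^2}$, then the greedy trail algorithm (described in the context) run on input $G$ outputs a set $H$ of edges such that $\mathbb{E}[|H\Delta H^*|]=o(n)$, achieving almost exact recovery. Moreover, the algorithm runs in time $O\left(n^{3+\log(2+\lambda)}\right)$ with high probability.
   Context: Planted cycles model $\mathcal{G}(n,\lambda,\delta)$: generate an Erdős–Rényi graph $G_0\sim\mathcal{G}(n,\lambda/n)$ on vertex set $[n]$; independently choose a uniformly random set $V\subseteq[n]$ of $\lfloor\delta n\rfloor$ vertices; then choose a uniformly random labeled $2$-factor $H^*$ on $V$, i.e. a vertex-disjoint union of cycles spanning all vertices of $V$. Output the simple graph $G=G_0\cup H^*$. Conditional on $H^*=h$, the only randomness is in $G_0$. Graphs are identified with edge sets, $|\cdot|$ counts edges, $\Delta$ is symmetric difference. "With high probability" means with probability $1-o(1)$ as $n\to\infty$. $\log$ is the natural logarithm. Almost exact recovery by $H$ means $\mathbb{E}[|H\Delta H^*|/|H^*|]=o(1)$. A trail is a sequence of distinct edges $(e_1,\dots,e_k)$ with $e_i=(v_i,v_{i+1})$; it is closed if $v_{k+1}=v_1$, and open otherwise; its length is $k$. Greedy trail algorithm. Input: a graph $G$ on $n$ vertices. Initialize $H=\emptyset$. Let $S$ be the set of all trails (closed or open) in $G$ of length less than $\log n$. Repeat the following iteration until an iteration makes no update to $H$, then return $H$: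 (A) For each $P\in S$ in turn: if $|H\Delta P|>|H|$, no vertex has degree greater than $2$ in $H\Delta P$, and $H$ has at least as many degree-$1$ vertices as $H\Delta P$, then replace $H$ by $H\Delta P$. (B) Among the $P\in S$ such that $H\Delta P$ has no vertex of degree greater than $2$, find one maximizing $|H\Delta P|$; if such a $P$ exists and $|H\Delta P|\ge|H|+\sqrt{\log n}$, then replace $H$ by $H\Delta P$. *)

theory Defs
  imports "HOL-Probability.Probability" "HOL-Library.While_Combinator"
    "HOL-Library.Landau_Symbols"
begin

section \<open>Graphs and the planted cycles model\<close>

text \<open>A graph on the vertex set \<open>{1..n}\<close> is identified with its set of edges, an edge being
  a two-element set of vertices.\<close>

type_synonym graph = "nat set set"

definition all_edges_on :: "nat \<Rightarrow> graph" where
  "all_edges_on n = {e. e \<subseteq> {1..n} \<and> card e = 2}"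

abbreviation symdiff :: "'a set \<Rightarrow> 'a set \<Rightarrow> 'a set"  (infixl "\<triangle>" 65) where
  "A \<triangle> B \<equiv> (A - B) \<union> (B - A)"

definition degree :: "graph \<Rightarrow> nat \<Rightarrow> nat" where
  "degree H v = card {e \<in> H. v \<in> e}"

definition cycle_edges :: "nat list \<Rightarrow> graph" where
  "cycle_edges c = {{c ! i, c ! ((i + 1) mod length c)} | i. i < length c}"

text \<open>The 2-factors on \<open>V\<close>: each list in \<open>cs\<close> is the cyclic vertex sequence of one cycle, and
  \<open>distinct (concat cs)\<close> makes the vertices within each cycle distinct and the cycles
  vertex-disjoint.\<close>

definition two_factors :: "nat set \<Rightarrow> graph set" where
  "two_factors V = {\<Union> (cycle_edges ` set cs) | cs.
     (\<forall>c \<in> set cs. 3 \<le> length c) \<and> distinct (concat cs) \<and> set (concat cs) = V}"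

definition planted_vertex_sets :: "nat \<Rightarrow> real \<Rightarrow> nat set set" where
  "planted_vertex_sets n \<delta> = {V. V \<subseteq> {1..n} \<and> card V = nat \<lfloor>\<delta> * real n\<rfloor>}"

definition planted_two_factors :: "nat \<Rightarrow> real \<Rightarrow> graph set" where
  "planted_two_factors n \<delta> = (\<Union>V \<in> planted_vertex_sets n \<delta>. two_factors V)"

definition erdos_renyi :: "nat \<Rightarrow> real \<Rightarrow> graph pmf" where
  "erdos_renyi n p =
     map_pmf (\<lambda>f. {e \<in> all_edges_on n. f e})
       (Pi_pmf (all_edges_on n) False (\<lambda>_. bernoulli_pmf p))"

text \<open>The joint law of \<open>(H\<^sup>*, G)\<close>.  There is no 2-factor on one or two vertices, so the model is
  meaningful only when \<open>\<lfloor>\<delta> n\<rfloor>\<close> is neither 1 nor 2 (and \<open>lam \<le> n\<close>); for fixed \<open>\<delta> > 0\<close>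
  this holds for all large \<open>n\<close>, and everything below is asymptotic in \<open>n\<close>.\<close>

definition planted_cycles :: "nat \<Rightarrow> real \<Rightarrow> real \<Rightarrow> (graph \<times> graph) pmf" where
  "planted_cycles n lam \<delta> =
     bind_pmf (erdos_renyi n (lam / real n)) (\<lambda>G0.
     bind_pmf (pmf_of_set (planted_vertex_sets n \<delta>)) (\<lambda>V.
     bind_pmf (pmf_of_set (two_factors V)) (\<lambda>H.
     return_pmf (H, G0 \<union> H))))"

definition planted_cycles_given :: "nat \<Rightarrow> real \<Rightarrow> real \<Rightarrow> graph \<Rightarrow> (graph \<times> graph) pmf" where
  "planted_cycles_given n lam \<delta> h = cond_pmf (planted_cycles n lam \<delta>) {\<omega>. fst \<omega> = h}"

section \<open>The greedy trail algorithm\<close>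

text \<open>A trail is given by its vertex sequence \<open>[v\<^sub>1, \<dots>, v\<^bsub>k+1\<^esub>]\<close>; its edge sequence is
  \<open>walk_edges\<close>, and its length is the number of edges.\<close>

fun walk_edges :: "nat list \<Rightarrow> nat set list" where
  "walk_edges (u # v # p) = {u, v} # walk_edges (v # p)"
| "walk_edges _ = []"

definition trails :: "graph \<Rightarrow> nat list set" where
  "trails G = {p. walk_edges p \<noteq> [] \<and> distinct (walk_edges p) \<and> set (walk_edges p) \<subseteq> G}"

definition short_trails :: "nat \<Rightarrow> graph \<Rightarrow> nat list set" where
  "short_trails n G = {p \<in> trails G. real (length (walk_edges p)) < ln (real n)}"

definition flip :: "graph \<Rightarrow> nat list \<Rightarrow> graph" where
  "flip H p = H \<triangle> set (walk_edges p)"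

definition deg_le_2 :: "nat \<Rightarrow> graph \<Rightarrow> bool" where
  "deg_le_2 n H \<longleftrightarrow> (\<forall>v \<in> {1..n}. degree H v \<le> 2)"

definition num_deg_1 :: "nat \<Rightarrow> graph \<Rightarrow> nat" where
  "num_deg_1 n H = card {v \<in> {1..n}. degree H v = 1}"

definition step_A :: "nat \<Rightarrow> nat list \<Rightarrow> graph \<Rightarrow> graph" where
  "step_A n p H =
     (if card (flip H p) > card H \<and> deg_le_2 n (flip H p) \<and> num_deg_1 n H \<ge> num_deg_1 n (flip H p)
      then flip H p else H)"

definition step_B :: "nat \<Rightarrow> nat list set \<Rightarrow> graph \<Rightarrow> graph \<Rightarrow> bool" where
  "step_B n S H H' \<longleftrightarrow>
     (let admissible = (\<lambda>p. p \<in> S \<and> deg_le_2 n (flip H p)) in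
      (\<nexists>p. admissible p) \<and> H' = H \<or>
      (\<exists>p. is_arg_max (\<lambda>p. card (flip H p)) admissible p \<and>
           H' = (if real (card (flip H p)) \<ge> real (card H) + sqrt (ln (real n))
                 then flip H p else H)))"

text \<open>The order in which (A) visits the trails and the choice of the maximizer in (B) are left
  open, so an iteration is a relation.  An update strictly increases the number of edges, hence
  an iteration makes no update iff it leaves \<open>H\<close> unchanged.\<close>

definition iteration :: "nat \<Rightarrow> nat list set \<Rightarrow> graph \<Rightarrow> graph \<Rightarrow> bool" where
  "iteration n S H H' \<longleftrightarrow>
     (\<exists>ps. distinct ps \<and> set ps = S \<and> step_B n S (fold (step_A n) ps H) H')"

inductive greedy_loop :: "nat \<Rightarrow> nat list set \<Rightarrow> graph \<Rightarrow> graph \<Rightarrow> bool" for n S where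
  stop: "iteration n S H H \<Longrightarrow> greedy_loop n S H H"
| continue: "iteration n S H H' \<Longrightarrow> H' \<noteq> H \<Longrightarrow> greedy_loop n S H' H'' \<Longrightarrow> greedy_loop n S H H''"

definition greedy_output :: "nat \<Rightarrow> graph \<Rightarrow> graph \<Rightarrow> bool" where
  "greedy_output n G H \<longleftrightarrow> greedy_loop n (short_trails n G) {} H"

text \<open>Each such \<open>alg\<close> is the algorithm with all open choices resolved, possibly depending on \<open>G\<close>.\<close>

definition greedy_algorithm :: "(nat \<Rightarrow> graph \<Rightarrow> graph) \<Rightarrow> bool" where
  "greedy_algorithm alg \<longleftrightarrow> (\<forall>n. \<forall>G \<subseteq> all_edges_on n. greedy_output n G (alg n G))"

section \<open>Running time\<close>

text \<open>The running time is that of the following random access machine implementation.  A timed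
  computation is a pair of a result and a number of steps; one step stands for a block of boundedly
  many primitive operations: reading or writing an array cell, arithmetic and comparisons on
  counters and on \<open>ln n\<close> and \<open>\<surd>(ln n)\<close>, prepending to or taking apart a linked list.
  Arrays are modelled by functions; they are used linearly, so that every update can be done in
  place (in particular, a tentative flip has to be undone by flipping back).\<close>

type_synonym 'a timed = "'a \<times> nat"

definition ret :: "'a \<Rightarrow> 'a timed" where
  "ret x = (x, 1)"

definition bind_timed :: "'a timed \<Rightarrow> ('a \<Rightarrow> 'b timed) \<Rightarrow> 'b timed" where
  "bind_timed m f = (case m of (x, t) \<Rightarrow> (case f x of (y, t') \<Rightarrow> (y, t + t')))"

adhoc_overloading Monad_Syntax.bind == bind_timed

definition charge :: "nat \<Rightarrow> unit timed" where
  "charge t = ((), t)"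

fun for_each :: "'b list \<Rightarrow> ('b \<Rightarrow> 's \<Rightarrow> 's timed) \<Rightarrow> 's \<Rightarrow> 's timed" where
  "for_each [] f s = ret s"
| "for_each (x # xs) f s = do { charge 1; s' \<leftarrow> f x s; for_each xs f s' }"

subsection \<open>Enumeration of the short trails\<close>

text \<open>The input is an adjacency matrix \<open>A\<close>.  A trail is a linked list of vertices, extended at
  its head.\<close>

fun uses_edge :: "nat \<Rightarrow> nat \<Rightarrow> nat list \<Rightarrow> bool timed" where
  "uses_edge u w (a # b # p) =
     (if a = u \<and> b = w \<or> a = w \<and> b = u then ret True
      else do { charge 1; uses_edge u w (b # p) })"
| "uses_edge u w _ = ret False"

definition extend_trail ::
  "nat \<Rightarrow> (nat \<Rightarrow> nat \<Rightarrow> bool) \<Rightarrow> nat list \<Rightarrow> nat list list \<Rightarrow> nat list list timed" where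
  "extend_trail n A p acc =
     for_each [1..<Suc n]
       (\<lambda>w acc. if A (hd p) w
                then do { used \<leftarrow> uses_edge (hd p) w p;
                          ret (if used then acc else (w # p) # acc) }
                else ret acc) acc"

text \<open>\<open>ps\<close> are the trails with the current number of edges, \<open>acc\<close> all trails found so far.\<close>

fun enum_levels ::
  "nat \<Rightarrow> (nat \<Rightarrow> nat \<Rightarrow> bool) \<Rightarrow> nat \<Rightarrow> nat list list \<Rightarrow> nat list list \<Rightarrow> nat list list timed"
where
  "enum_levels n A 0 ps acc = ret acc"
| "enum_levels n A (Suc k) ps acc = do {
     qs \<leftarrow> for_each ps (extend_trail n A) [];
     acc' \<leftarrow> for_each qs (\<lambda>q acc. ret (q # acc)) acc;
     enum_levels n A k qs acc' }"

text \<open>The integers \<open>1 \<le> k < ln n\<close> are those with \<open>1 \<le> k \<le> \<lceil>ln n\<rceil> - 1\<close>.\<close>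

definition enum_short_trails :: "nat \<Rightarrow> (nat \<Rightarrow> nat \<Rightarrow> bool) \<Rightarrow> nat list list timed" where
  "enum_short_trails n A = do {
     ps \<leftarrow> for_each [1..<Suc n] (\<lambda>v acc. ret ([v] # acc)) [];
     enum_levels n A (nat \<lceil>ln (real n)\<rceil> - 1) ps [] }"

subsection \<open>The current edge set and the main loop\<close>

text \<open>The current edge set \<open>H\<close> is kept as an adjacency matrix, together with the array of
  degrees, the number of edges and the number of vertices of degree 1.\<close>

record hstate =
  hmat :: "nat \<Rightarrow> nat \<Rightarrow> bool"
  hdeg :: "nat \<Rightarrow> nat"
  hsize :: nat
  hones :: nat

definition empty_hstate :: hstate where
  "empty_hstate = \<lparr>hmat = (\<lambda>_ _. False), hdeg = (\<lambda>_. 0), hsize = 0, hones = 0\<rparr>"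

definition hedges :: "hstate \<Rightarrow> graph" where
  "hedges s = {{u, v} | u v. hmat s u v}"

definition set_deg :: "nat \<Rightarrow> nat \<Rightarrow> hstate \<Rightarrow> hstate" where
  "set_deg v d s = s\<lparr>hdeg := (hdeg s)(v := d),
     hones := hones s - (if hdeg s v = 1 then 1 else 0) + (if d = 1 then 1 else 0)\<rparr>"

definition flip_edge :: "nat \<Rightarrow> nat \<Rightarrow> hstate \<Rightarrow> hstate" where
  "flip_edge u v s =
     (let b = hmat s u v;
          upd = (\<lambda>k::nat. if b then k - 1 else k + 1);
          s' = s\<lparr>hmat := (\<lambda>x y. if x = u \<and> y = v \<or> x = v \<and> y = u then \<not> b else hmat s x y),
                 hsize := upd (hsize s)\<rparr>
      in set_deg v (upd (hdeg s v)) (set_deg u (upd (hdeg s u)) s'))"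

fun flip_trail :: "nat list \<Rightarrow> hstate \<Rightarrow> hstate timed" where
  "flip_trail (u # v # p) s = do { charge 1; flip_trail (v # p) (flip_edge u v s) }"
| "flip_trail _ s = ret s"

fun degrees_ok :: "nat list \<Rightarrow> hstate \<Rightarrow> bool timed" where
  "degrees_ok [] s = ret True"
| "degrees_ok (v # p) s =
     (if hdeg s v \<le> 2 then do { charge 1; degrees_ok p s } else ret False)"

text \<open>All degrees in \<open>H\<close> are at most 2 throughout, so only the vertices of \<open>p\<close> need checking
  after flipping \<open>p\<close>.\<close>

definition try_A :: "nat list \<Rightarrow> hstate \<Rightarrow> hstate timed" where
  "try_A p s = do {
     s' \<leftarrow> flip_trail p s;
     ok \<leftarrow> degrees_ok p s';
     if ok \<and> hsize s' > hsize s \<and> hones s \<ge> hones s' then ret s' else flip_trail p s' }"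

definition try_B ::
  "nat list \<Rightarrow> hstate \<times> (nat list \<times> nat) option \<Rightarrow> (hstate \<times> (nat list \<times> nat) option) timed"
where
  "try_B p = (\<lambda>(s, best). do {
     s' \<leftarrow> flip_trail p s;
     ok \<leftarrow> degrees_ok p s';
     s'' \<leftarrow> flip_trail p s';
     ret (s'', if ok \<and> (case best of None \<Rightarrow> True | Some (q, m) \<Rightarrow> m < hsize s')
               then Some (p, hsize s') else best) })"

definition timed_iteration :: "nat \<Rightarrow> nat list list \<Rightarrow> hstate \<Rightarrow> hstate timed" where
  "timed_iteration n ps s = do {
     s1 \<leftarrow> for_each ps try_A s;
     (s2, best) \<leftarrow> for_each ps try_B (s1, None);
     (case best of
        None \<Rightarrow> ret s2
      | Some (p, m) \<Rightarrow>
          if real m \<ge> real (hsize s2) + sqrt (ln (real n)) then flip_trail p s2 else ret s2) }"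

text \<open>The loop state consists of the current \<open>H\<close>, a flag telling whether the last iteration made
  an update, and the number of steps so far.  Initializing the arrays and reading off the result
  are charged \<open>n\<^sup>2 + n\<close> and \<open>n\<^sup>2\<close> steps; \<open>None\<close> would mean that the loop does not terminate.\<close>

definition timed_greedy :: "nat \<Rightarrow> graph \<Rightarrow> graph timed option" where
  "timed_greedy n G =
     (let (ps, t0) = enum_short_trails n (\<lambda>u v. {u, v} \<in> G) in
      map_option (\<lambda>(s, _, t). (hedges s, t + n * n))
        (while_option (\<lambda>(s, updated, t). updated)
           (\<lambda>(s, updated, t).
              let (s', t') = timed_iteration n ps s in (s', hsize s' \<noteq> hsize s, t + t' + 1))
           (empty_hstate, True, n * n + n + t0)))"

definition runs_within :: "nat \<Rightarrow> graph \<Rightarrow> real \<Rightarrow> bool" where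
  "runs_within n G T \<longleftrightarrow> (\<exists>H t. timed_greedy n G = Some (H, t) \<and> real t \<le> T)"

end

theory Submission
  imports Defs "HOL-Real_Asymp.Real_Asymp"
begin

text \<open>Call the edges of \<open>h = H\<^sup>*\<close> red and the other edges of \<open>G\<close> blue.  In the output \<open>H\<close>, pair
  up the edges of \<open>H \<triangle> h\<close> at each vertex, a blue edge at a planted vertex always with a red one.
  This decomposes \<open>H \<triangle> h\<close> into closed trails and open trails ending at vertices of degree 1 in
  \<open>H\<close>, and no trail passes through two consecutive blue edges at a planted vertex.  There are only
  \<open>O(n / \<surd>(ln n))\<close> vertices of degree 1, because only (B) creates them.  As neither (A) nor (B)
  applies to \<open>H\<close>, every whole trail shorter than \<open>ln n\<close> has at most as many red as blue edges, and a
  piece of length about \<open>ln n / 2\<close> of a longer trail has a red surplus of at most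
  \<open>\<surd>(ln n) + 2\<close>.  Weighting trails by \<open>z < 1\<close> to the power of the red surplus, a first moment
  computation shows that the expected number of such trails of length \<open>k\<close> in \<open>G\<close> is at most
  \<open>C n \<rho>\<^sup>k\<close> up to a factor \<open>exp (O(\<surd>(ln n)))\<close>, where \<open>\<rho> < 1\<close> by the hypothesis on \<open>lam\<close>;
  closed ones gain a factor \<open>1/n\<close>.  Hence \<open>H \<triangle> h\<close> has \<open>o(n)\<close> edges in expectation.  For the
  running time, the expected number of trails of length \<open>k\<close> is at most \<open>n (2 + lam)\<^sup>k\<close>, since a
  trail is continued by at most two red and on average at most \<open>lam\<close> blue edges.\<close>

section \<open>Trails and the greedy algorithm\<close>

text \<open>The pairing is made so that flips along trails are admissible. At a planted vertex the
  red edges of \<open>H \<triangle> h\<close> outnumber the blue ones by exactly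
  \<open>2 - degree H v\<close>; once each blue edge has a red partner, the remaining red edges fit
  into the free degree of H. Hence only the ends of a trail can violate the degree bound.

  A trail may end within L steps of one of its edges. Looking back from that end over 2L edges, it
  is either long enough behind the edge or known completely. Completely known trails must be shorter
  than ln n, hence L = ln n / 2. For open trails of bounded length t the first moment C n \<rho>^t
  is not o(n), but such trails have ends: those shorter than K = (ln n)^(1/4) carry only O(K n /
  sqrt (ln n)) edges, and from length K on \<rho>^K beats the logarithmic factors. Closed trails
  have no ends, but gain 1/n.

  For the running time, an iteration costs O(ln n) per short trail, and at most n + 1 iterations
  occur. The exponent 3 leaves a spare factor of nearly n, which pays for the logarithms and for
  Markov's inequality.\<close>

lemma finite_all_edges_on: "finite (all_edges_on n)"
  unfolding all_edges_on_def by (rule finite_subset[of _ "Pow {1..n}"]) auto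

lemma pair_in_all_edges_on:
  "{u, v} \<in> all_edges_on n \<longleftrightarrow> u \<noteq> v \<and> u \<in> {1..n} \<and> v \<in> {1..n}"
  by (auto simp: all_edges_on_def card_insert_if)

lemma all_edges_onE:
  assumes "e \<in> all_edges_on n"
  obtains u v where "e = {u, v}" "u \<noteq> v" "u \<in> {1..n}" "v \<in> {1..n}"
proof -
  have "card e = 2" "e \<subseteq> {1..n}" using assms by (auto simp: all_edges_on_def)
  then obtain u v where "e = {u, v}" "u \<noteq> v" by (auto simp: card_2_iff)
  then show ?thesis using that \<open>e \<subseteq> {1..n}\<close> by blast
qed

lemma length_walk_edges [simp]: "length (walk_edges p) = length p - 1"
  by (induction p rule: walk_edges.induct) auto

lemma walk_edges_Cons: "p \<noteq> [] \<Longrightarrow> walk_edges (x # p) = {x, hd p} # walk_edges p"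
  by (cases p) auto

section \<open>Vertex degrees under flipping a trail\<close>

lemma degree_insert:
  assumes "finite E" "e \<notin> E"
  shows "degree (insert e E) v = degree E v + of_bool (v \<in> e)"
proof -
  have "{e' \<in> insert e E. v \<in> e'} = (if v \<in> e then insert e {e' \<in> E. v \<in> e'} else {e' \<in> E. v \<in> e'})"
    by auto
  then show ?thesis using assms by (auto simp: degree_def)
qed

text \<open>Each passage through a vertex consumes two distinct edges, so only the two ends
  contribute oddly, and they cancel when they coincide.\<close>

lemma odd_degree_walk:
  assumes "distinct (walk_edges p)" "set (walk_edges p) \<subseteq> all_edges_on n" "p \<noteq> []"
  shows "odd (degree (set (walk_edges p)) v) \<longleftrightarrow> (v = hd p) \<noteq> (v = last p)"
  using assms
proof (induction p rule: walk_edges.induct)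
  case (1 u w p)
  then have "u \<noteq> w" by (auto simp: pair_in_all_edges_on)
  have "degree (set (walk_edges (u # w # p))) v
      = degree (set (walk_edges (w # p))) v + of_bool (v \<in> {u, w})"
    using degree_insert[of "set (walk_edges (w # p))" "{u, w}" v] 1 by simp
  moreover have "odd (degree (set (walk_edges (w # p))) v) \<longleftrightarrow> (v = w) \<noteq> (v = last (w # p))"
    using 1 by simp
  ultimately show ?case using \<open>u \<noteq> w\<close>
    by (cases "v = u"; cases "v = w") simp_all
qed (auto simp: degree_def)

lemma card_symdiff:
  assumes "finite A" "finite B"
  shows "card (A \<triangle> B) + 2 * card (A \<inter> B) = card A + card B"
proof -
  have "card (A \<triangle> B) = card (A - B) + card (B - A)"
    by (rule card_Un_disjoint) (use assms in auto)
  moreover have "card A = card (A - B) + card (A \<inter> B)"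
    using card_Un_disjoint[of "A - B" "A \<inter> B"] assms by (simp add: Un_Diff_Int Int_commute disjoint_iff)
  moreover have "card B = card (B - A) + card (A \<inter> B)"
    using card_Un_disjoint[of "B - A" "B \<inter> A"] assms by (simp add: Un_Diff_Int Int_commute[of A B] disjoint_iff)
  ultimately show ?thesis by simp
qed

lemma degree_symdiff:
  assumes "finite A" "finite B"
  shows "degree (A \<triangle> B) v + 2 * degree (A \<inter> B) v = degree A v + degree B v"
proof -
  have eq: "{e \<in> A \<triangle> B. v \<in> e} = {e \<in> A. v \<in> e} \<triangle> {e \<in> B. v \<in> e}"
    "{e \<in> A \<inter> B. v \<in> e} = {e \<in> A. v \<in> e} \<inter> {e \<in> B. v \<in> e}" by auto
  show ?thesis
    unfolding degree_def eq by (rule card_symdiff) (use assms in auto)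
qed

lemma odd_degree_symdiff:
  assumes "finite A" "finite B"
  shows "odd (degree (A \<triangle> B) v) \<longleftrightarrow> odd (degree A v) \<noteq> odd (degree B v)"
proof -
  have "odd (degree (A \<triangle> B) v + 2 * degree (A \<inter> B) v) = odd (degree A v + degree B v)"
    unfolding degree_symdiff[OF assms] ..
  then show ?thesis by simp
qed

lemma degree_one_iff_odd: "degree H v \<le> 2 \<Longrightarrow> degree H v = 1 \<longleftrightarrow> odd (degree H v)"
  by presburger

text \<open>As long as all degrees are at most 2, degree 1 means odd degree, and a flip changes
  parities only at the ends of the trail.\<close>

lemma deg_1_flip_subset:
  assumes "finite H" "deg_le_2 n H" "deg_le_2 n (flip H p)"
    and "distinct (walk_edges p)" "set (walk_edges p) \<subseteq> all_edges_on n" "p \<noteq> []"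
  shows "{v \<in> {1..n}. degree (flip H p) v = 1} - {v \<in> {1..n}. degree H v = 1}
      \<subseteq> (if hd p = last p then {} else {hd p, last p})"
proof
  fix v assume "v \<in> {v \<in> {1..n}. degree (flip H p) v = 1} - {v \<in> {1..n}. degree H v = 1}"
  then have v: "v \<in> {1..n}" "degree (flip H p) v = 1" "degree H v \<noteq> 1" by auto
  have "degree H v \<le> 2" using v assms unfolding deg_le_2_def by blast
  then have "even (degree H v)" "odd (degree (flip H p) v)"
    using v degree_one_iff_odd[of H v] by auto
  then have "odd (degree (set (walk_edges p)) v)"
    unfolding flip_def using odd_degree_symdiff[OF assms(1), of "set (walk_edges p)" v] by simp
  then show "v \<in> (if hd p = last p then {} else {hd p, last p})"
    unfolding odd_degree_walk[OF assms(4-6)] by (cases "hd p = last p") simp_all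
qed

lemma num_deg_1_flip_le:
  assumes "finite H" "deg_le_2 n H" "deg_le_2 n (flip H p)"
    and "distinct (walk_edges p)" "set (walk_edges p) \<subseteq> all_edges_on n" "p \<noteq> []"
  shows "num_deg_1 n (flip H p) \<le> num_deg_1 n H + 2"
proof -
  let ?A = "{v \<in> {1..n}. degree (flip H p) v = 1}" and ?B = "{v \<in> {1..n}. degree H v = 1}"
  have "?A \<subseteq> ?B \<union> {hd p, last p}"
    using deg_1_flip_subset[OF assms] by (cases "hd p = last p") (simp_all, blast+)
  then have "card ?A \<le> card (?B \<union> {hd p, last p})" by (intro card_mono) auto
  also have "\<dots> \<le> card ?B + card {hd p, last p}" by (rule card_Un_le)
  also have "card {hd p, last p} \<le> 2" by (simp add: card_insert_if)
  finally show ?thesis unfolding num_deg_1_def by simp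
qed

text \<open>These are the trails whose flip satisfies the third condition of (A): closed ones, and
  those joining two vertices that already have degree 1.\<close>

lemma num_deg_1_flip_whole_le:
  assumes "finite H" "deg_le_2 n H" "deg_le_2 n (flip H p)"
    and "distinct (walk_edges p)" "set (walk_edges p) \<subseteq> all_edges_on n" "p \<noteq> []"
    and "hd p = last p \<or> degree H (hd p) = 1 \<and> degree H (last p) = 1"
  shows "num_deg_1 n (flip H p) \<le> num_deg_1 n H"
proof -
  let ?A = "{v \<in> {1..n}. degree (flip H p) v = 1}" and ?B = "{v \<in> {1..n}. degree H v = 1}"
  have "?A \<subseteq> ?B"
  proof
    fix v assume v: "v \<in> ?A"
    show "v \<in> ?B"
    proof (rule ccontr)
      assume "v \<notin> ?B"
      then have "hd p \<noteq> last p" "v \<in> {hd p, last p}"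
        using v deg_1_flip_subset[OF assms(1-6)] by (auto split: if_split_asm)
      then show False using v \<open>v \<notin> ?B\<close> assms(7) by auto
    qed
  qed
  then show ?thesis unfolding num_deg_1_def by (intro card_mono) auto
qed

lemma sum_degree:
  assumes "H \<subseteq> all_edges_on n"
  shows "(\<Sum>v\<in>{1..n}. degree H v) = 2 * card H"
proof -
  have fin: "finite H" using assms finite_all_edges_on finite_subset by blast
  have "(\<Sum>v\<in>{1..n}. degree H v) = (\<Sum>v\<in>{1..n}. \<Sum>e\<in>H. of_bool (v \<in> e))"
    unfolding degree_def using fin by (intro sum.cong) (auto simp: Int_def)
  also have "\<dots> = (\<Sum>e\<in>H. \<Sum>v\<in>{1..n}. of_bool (v \<in> e))" by (rule sum.swap)
  also have "\<dots> = (\<Sum>e\<in>H. 2)"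
  proof (rule sum.cong)
    fix e assume "e \<in> H"
    then have "e \<subseteq> {1..n}" "card e = 2" using assms by (auto simp: all_edges_on_def)
    then have "{1..n} \<inter> {v. v \<in> e} = e" by auto
    with \<open>card e = 2\<close> show "(\<Sum>v\<in>{1..n}. of_bool (v \<in> e)) = (2::nat)" by simp
  qed simp
  finally show ?thesis by simp
qed

lemma card_le_of_deg_le_2:
  assumes "H \<subseteq> all_edges_on n" "deg_le_2 n H"
  shows "card H \<le> n"
proof -
  have "2 * card H = (\<Sum>v\<in>{1..n}. degree H v)" using sum_degree[OF assms(1)] by simp
  also have "\<dots> \<le> (\<Sum>v\<in>{1..n}. 2)" by (rule sum_mono) (use assms in \<open>auto simp: deg_le_2_def\<close>)
  finally show ?thesis by simp
qed

section \<open>Monotonicity of the two steps and fixpoints of an iteration\<close>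

lemma step_A_cases:
  "step_A n p H = H \<or> step_A n p H = flip H p \<and> card H < card (flip H p) \<and>
     deg_le_2 n (flip H p) \<and> num_deg_1 n (flip H p) \<le> num_deg_1 n H"
  unfolding step_A_def by auto

text \<open>Every accepted flip strictly increases the number of edges, so an unchanged number means
  that each trail was tried on the original \<open>H\<close> and rejected.\<close>

lemma card_fold_step_A:
  "card H \<le> card (fold (step_A n) ps H) \<and>
   (card (fold (step_A n) ps H) = card H \<longrightarrow>
      fold (step_A n) ps H = H \<and> (\<forall>p\<in>set ps. step_A n p H = H))"
proof (induction ps arbitrary: H)
  case (Cons p ps)
  show ?case
  proof (cases "step_A n p H = H")
    case True
    then show ?thesis using Cons.IH[of H] by simp
  next
    case False
    then have "card H < card (step_A n p H)" using step_A_cases[of n p H] by presburger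
    also have "\<dots> \<le> card (fold (step_A n) ps (step_A n p H))" using Cons.IH by blast
    finally show ?thesis by simp
  qed
qed auto

lemma ln_real_nat_ge_0: "0 \<le> ln (real n)"
  by (cases n) auto

lemma short_trailsD:
  assumes "p \<in> short_trails n G" "G \<subseteq> all_edges_on n"
  shows "walk_edges p \<noteq> []" "p \<noteq> []" "distinct (walk_edges p)" "set (walk_edges p) \<subseteq> G"
    "set (walk_edges p) \<subseteq> all_edges_on n" "0 < ln (real n)"
proof -
  show 1: "walk_edges p \<noteq> []" "distinct (walk_edges p)" "set (walk_edges p) \<subseteq> G" "p \<noteq> []"
    and "set (walk_edges p) \<subseteq> all_edges_on n"
    using assms by (auto simp: short_trails_def trails_def)
  have "real (length (walk_edges p)) < ln (real n)" using assms by (auto simp: short_trails_def)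
  then show "0 < ln (real n)" by linarith
qed

lemma flip_neq: "walk_edges p \<noteq> [] \<Longrightarrow> flip H p \<noteq> H"
  unfolding flip_def by (cases "walk_edges p") auto

lemma step_B_cases:
  assumes "step_B n S H H'"
  shows "H' = H \<or> (\<exists>p\<in>S. H' = flip H p \<and> deg_le_2 n (flip H p) \<and>
     real (card H) + sqrt (ln (real n)) \<le> real (card (flip H p)))"
  using assms unfolding step_B_def Let_def is_arg_max_def by (auto split: if_splits)

lemma card_step_B_le:
  assumes "step_B n S H H'"
  shows "card H \<le> card H'"
proof -
  have "0 \<le> sqrt (ln (real n))" using ln_real_nat_ge_0 by simp
  moreover have "card H \<le> card H'"
    if "real (card H) + sqrt (ln (real n)) \<le> real (card H')" using that calculation by linarith
  ultimately show ?thesis using step_B_cases[OF assms] by blast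
qed

text \<open>Neither step ever loses edges, so in an iteration that returns its input both of them
  are idle. In (B) the maximizer then misses the threshold, and with it every admissible
  trail.\<close>

lemma iteration_fixpoint:
  assumes "iteration n S H H" "S \<subseteq> short_trails n G" "G \<subseteq> all_edges_on n" "p \<in> S"
  shows "step_A n p H = H"
    and "deg_le_2 n (flip H p) \<Longrightarrow> real (card (flip H p)) < real (card H) + sqrt (ln (real n))"
proof -
  obtain ps where ps: "set ps = S" "step_B n S (fold (step_A n) ps H) H"
    using assms(1) unfolding iteration_def by blast
  have "card (fold (step_A n) ps H) \<le> card H" using card_step_B_le ps by blast
  then have "card (fold (step_A n) ps H) = card H" using card_fold_step_A[of H n ps] by (simp add: le_antisym)
  then have *: "fold (step_A n) ps H = H" "\<forall>p\<in>S. step_A n p H = H"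
    using card_fold_step_A[of H n ps] ps(1) by blast+
  from *(2) assms(4) show "step_A n p H = H" by blast
  assume deg: "deg_le_2 n (flip H p)"
  have "step_B n S H H" using ps(2) unfolding *(1) .
  then obtain q where q: "is_arg_max (\<lambda>p. card (flip H p)) (\<lambda>p. p \<in> S \<and> deg_le_2 n (flip H p)) q"
     "H = (if real (card (flip H q)) \<ge> real (card H) + sqrt (ln (real n)) then flip H q else H)"
    unfolding step_B_def Let_def
    by (elim disjE) (use deg assms(4) in blast, elim exE conjE, assumption)
  have "q \<in> S" using q(1) by (auto simp: is_arg_max_def)
  \<comment> \<open>This decides the conditional in (B): its result is \<open>H\<close>, so the
    branch returning \<open>flip H q\<close> was not taken.\<close>
  then have "flip H q \<noteq> H"
    using flip_neq[OF short_trailsD(1)[OF _ assms(3)]] assms(2) by blast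
  then have "real (card (flip H q)) < real (card H) + sqrt (ln (real n))"
    using q(2) by (cases "real (card (flip H q)) \<ge> real (card H) + sqrt (ln (real n))") auto
  moreover have "card (flip H p) \<le> card (flip H q)"
    using q(1) deg assms(4) by (auto simp: is_arg_max_def not_less)
  ultimately show "real (card (flip H p)) < real (card H) + sqrt (ln (real n))" by simp
qed

text \<open>Only (B) creates vertices of degree 1, at most two of them while gaining at least
  \<open>\<surd>(ln n)\<close> edges; so there are \<open>o(n)\<close> such vertices in the end.\<close>

definition greedy_inv :: "nat \<Rightarrow> graph \<Rightarrow> graph \<Rightarrow> bool" where
  "greedy_inv n G H \<longleftrightarrow> H \<subseteq> G \<and> deg_le_2 n H \<and>
     real (num_deg_1 n H) * sqrt (ln (real n)) \<le> 2 * real (card H)"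

lemma greedy_inv_step_A:
  assumes "greedy_inv n G H" "p \<in> short_trails n G" "G \<subseteq> all_edges_on n"
  shows "greedy_inv n G (step_A n p H)"
proof (cases "step_A n p H = H")
  case False
  then have *: "step_A n p H = flip H p" "card H < card (flip H p)" "deg_le_2 n (flip H p)"
    "num_deg_1 n (flip H p) \<le> num_deg_1 n H"
    using step_A_cases[of n p H] by (blast)+
  have "flip H p \<subseteq> G" using assms short_trailsD(4)[OF assms(2,3)]
    by (auto simp: flip_def greedy_inv_def)
  moreover have "real (num_deg_1 n (flip H p)) * sqrt (ln (real n))
      \<le> real (num_deg_1 n H) * sqrt (ln (real n))"
    using *(4) ln_real_nat_ge_0 by (intro mult_right_mono) auto
  ultimately show ?thesis using assms(1) * by (simp add: greedy_inv_def)
qed (use assms in simp)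

lemma greedy_inv_fold_step_A:
  assumes "greedy_inv n G H" "set ps \<subseteq> short_trails n G" "G \<subseteq> all_edges_on n"
  shows "greedy_inv n G (fold (step_A n) ps H)"
  using assms by (induction ps arbitrary: H) (auto simp: greedy_inv_step_A)

lemma greedy_inv_step_B:
  assumes "greedy_inv n G H" "step_B n (short_trails n G) H H'" "G \<subseteq> all_edges_on n"
  shows "greedy_inv n G H'"
proof (cases "H' = H")
  case False
  then obtain p where p: "p \<in> short_trails n G" "H' = flip H p" "deg_le_2 n (flip H p)"
     "real (card H) + sqrt (ln (real n)) \<le> real (card (flip H p))"
    using step_B_cases[OF assms(2)] by (elim disjE bexE conjE) (use False in simp, assumption+)
  note D = short_trailsD[OF p(1) assms(3)]
  have "finite H" using assms finite_all_edges_on by (metis finite_subset greedy_inv_def)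
  have "flip H p \<subseteq> G" using assms(1) D by (auto simp: flip_def greedy_inv_def)
  moreover have "num_deg_1 n (flip H p) \<le> num_deg_1 n H + 2"
    using num_deg_1_flip_le[OF \<open>finite H\<close> _ p(3) D(3,5,2)] assms(1) by (simp add: greedy_inv_def)
  then have "real (num_deg_1 n (flip H p)) * sqrt (ln (real n))
     \<le> real (num_deg_1 n H + 2) * sqrt (ln (real n))"
    using ln_real_nat_ge_0 by (intro mult_right_mono) auto
  ultimately show ?thesis using p assms(1) by (simp add: greedy_inv_def algebra_simps)
qed (use assms in simp)

lemma greedy_inv_iteration:
  assumes "greedy_inv n G H" "iteration n (short_trails n G) H H'" "G \<subseteq> all_edges_on n"
  shows "greedy_inv n G H'"
proof -
  obtain ps where "set ps = short_trails n G" "step_B n (short_trails n G) (fold (step_A n) ps H) H'"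
    using assms(2) unfolding iteration_def by auto
  then show ?thesis using greedy_inv_fold_step_A[OF assms(1) _ assms(3), of ps] greedy_inv_step_B assms(3) by blast
qed

lemma greedy_loop_inv:
  assumes "greedy_loop n (short_trails n G) H H'" "greedy_inv n G H" "G \<subseteq> all_edges_on n"
  shows "greedy_inv n G H' \<and> iteration n (short_trails n G) H' H'"
  using assms by (induction rule: greedy_loop.induct) (auto dest: greedy_inv_iteration)

lemma greedy_output_inv:
  assumes "greedy_output n G H" "G \<subseteq> all_edges_on n"
  shows "greedy_inv n G H" "iteration n (short_trails n G) H H"
proof -
  have "greedy_inv n G {}" by (auto simp: greedy_inv_def deg_le_2_def degree_def num_deg_1_def)
  then show "greedy_inv n G H" "iteration n (short_trails n G) H H"
    using greedy_loop_inv assms unfolding greedy_output_def by blast+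
qed


section \<open>Decomposition into trails\<close>

text \<open>A set of edges with a partner for each edge at each of its end vertices, an edge being its
  own partner where a trail is to end.  Following partners, and turning around at the ends, is a
  permutation of the darts (oriented edges); its orbits are the trails of the decomposition.\<close>

locale mated_edges =
  fixes D :: graph and mate :: "nat \<Rightarrow> nat set \<Rightarrow> nat set"
  assumes finite_D: "finite D"
    and card_D: "e \<in> D \<Longrightarrow> card e = 2"
    and mate_in: "e \<in> D \<Longrightarrow> v \<in> e \<Longrightarrow> mate v e \<in> D \<and> v \<in> mate v e"
    and mate_mate: "e \<in> D \<Longrightarrow> v \<in> e \<Longrightarrow> mate v (mate v e) = e"
begin

definition dart_edge :: "nat \<times> nat \<Rightarrow> nat set" where
  "dart_edge d = {fst d, snd d}"

definition darts :: "(nat \<times> nat) set" where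
  "darts = {d. dart_edge d \<in> D}"

definition succ :: "nat \<times> nat \<Rightarrow> nat \<times> nat" where
  "succ d = (snd d, THE w. {snd d, w} = mate (snd d) (dart_edge d))"

abbreviation it :: "nat \<times> nat \<Rightarrow> nat \<Rightarrow> nat \<times> nat" where
  "it d i \<equiv> (succ ^^ i) d"

lemma dart_edge_swap [simp]: "dart_edge (prod.swap d) = dart_edge d"
  by (auto simp: dart_edge_def)

lemma swap_in_darts [simp]: "prod.swap d \<in> darts \<longleftrightarrow> d \<in> darts"
  by (simp add: darts_def)

lemma dart_eqI: "fst a = fst b \<Longrightarrow> dart_edge a = dart_edge b \<Longrightarrow> a = b"
  by (cases a; cases b) (auto simp: dart_edge_def doubleton_eq_iff)

lemma dart_edge_eqD: "dart_edge a = dart_edge b \<Longrightarrow> a = b \<or> a = prod.swap b"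
  by (cases a; cases b) (auto simp: dart_edge_def doubleton_eq_iff)

lemma swap_neq: "d \<in> darts \<Longrightarrow> prod.swap d \<noteq> d"
  using card_D[of "dart_edge d"] by (cases d) (auto simp: darts_def dart_edge_def)

lemma succ_props:
  assumes "d \<in> darts"
  shows "succ d \<in> darts" "fst (succ d) = snd d"
    "dart_edge (succ d) = mate (snd d) (dart_edge d)"
proof -
  let ?m = "mate (snd d) (dart_edge d)"
  have m: "?m \<in> D" "snd d \<in> ?m"
    using mate_in[of "dart_edge d" "snd d"] assms by (auto simp: darts_def dart_edge_def)
  then have "card ?m = 2" using card_D by blast
  then obtain a b where "?m = {a, b}" by (auto simp: card_2_iff)
  then have "\<exists>w. {snd d, w} = ?m" using m(2) by auto
  then obtain w where w: "{snd d, w} = ?m" by blast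
  have "(THE w. {snd d, w} = ?m) = w"
    by (rule the_equality) (use w in \<open>metis doubleton_eq_iff\<close>)+
  then have "succ d = (snd d, w)" by (simp add: succ_def)
  then show "dart_edge (succ d) = ?m" "fst (succ d) = snd d" "succ d \<in> darts"
    using w m by (auto simp: dart_edge_def darts_def)
qed

text \<open>Time reversal: partners are mutual, so the reversed dart of the successor leads back to
  the reversed dart. Injectivity of \<open>succ\<close> and the retracing of a trail after a turn
  both come from this.\<close>

lemma succ_swap_succ:
  assumes "d \<in> darts"
  shows "succ (prod.swap (succ d)) = prod.swap d"
proof -
  let ?e = "prod.swap (succ d)"
  have e: "?e \<in> darts" using succ_props[OF assms] by simp
  have "snd ?e = snd d" using succ_props[OF assms] by simp
  moreover have "mate (snd d) (mate (snd d) (dart_edge d)) = dart_edge d"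
    using mate_mate[of "dart_edge d" "snd d"] assms by (auto simp: darts_def dart_edge_def)
  ultimately show ?thesis
    using succ_props[OF e] succ_props(3)[OF assms] by (intro dart_eqI) simp_all
qed

lemma mate_fst_succ:
  assumes "d \<in> darts"
  shows "mate (fst (succ d)) (dart_edge (succ d)) = dart_edge d"
  using mate_mate[of "dart_edge d" "snd d"] assms succ_props[OF assms]
  by (auto simp: darts_def dart_edge_def)

section \<open>Orbits and their turns\<close>

lemma succ_inj: "a \<in> darts \<Longrightarrow> b \<in> darts \<Longrightarrow> succ a = succ b \<Longrightarrow> a = b"
  using succ_swap_succ[of a] succ_swap_succ[of b] by (metis swap_swap)

lemma it_in_darts: "d \<in> darts \<Longrightarrow> it d i \<in> darts"
  by (induction i) (auto simp: succ_props)

lemma it_it: "it (it d a) i = it d (a + i)"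
  using funpow_add[of i a succ] by (simp add: add.commute[of a i])

lemma it_cancel: "d \<in> darts \<Longrightarrow> it d (i + j) = it d i \<Longrightarrow> it d j = d"
proof (induction i)
  case (Suc i)
  then have "it d (i + j) = it d i"
    using succ_inj[of "it d (i + j)" "it d i"] it_in_darts by simp
  then show ?case using Suc by simp
qed simp

text \<open>The edge with index i is its own partner at its head, so the open trail ends there and
  the orbit starts to run back.\<close>

definition turn :: "nat \<times> nat \<Rightarrow> nat \<Rightarrow> bool" where
  "turn d i \<longleftrightarrow> it d (Suc i) = prod.swap (it d i)"

lemma turn_it: "turn (it d a) i \<longleftrightarrow> turn d (a + i)"
  unfolding turn_def it_it by simp

text \<open>Two passages through the same edge in opposite directions fold up onto a turn halfway
  between them.\<close>

lemma ex_turn: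
  assumes "d \<in> darts" "i < j" "it d j = prod.swap (it d i)"
  shows "\<exists>m. i \<le> m \<and> m < j \<and> turn d m"
  using assms(2,3)
proof (induction "j - i" arbitrary: i j rule: less_induct)
  case less
  show ?case
  proof (cases "j = Suc i")
    case True
    then show ?thesis using less.prems by (auto simp: turn_def)
  next
    case False
    then obtain j' where j: "j = Suc j'" "i < j'" using less.prems by (cases j) auto
    \<comment> \<open>Cancelling \<open>succ\<close> shortens the interval at both ends, from i and
      j to \<open>Suc i\<close> and \<open>j'\<close>; it does not shrink to a point, because no
      dart is its own reversal.\<close>
    have "succ (it d j') = prod.swap (it d i)" using less.prems j by simp
    also have "\<dots> = succ (prod.swap (it d (Suc i)))"
      using succ_swap_succ[OF it_in_darts[OF assms(1)]] by simp
    finally have eq: "it d j' = prod.swap (it d (Suc i))"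
      by (rule succ_inj[rotated 2]) (use it_in_darts[OF assms(1)] succ_props(1) in auto)
    then have "j' \<noteq> Suc i" using swap_neq[OF it_in_darts[OF assms(1), of "Suc i"]] by metis
    then have "\<exists>m. Suc i \<le> m \<and> m < j' \<and> turn d m"
      using less.hyps[of j' "Suc i"] eq j by auto
    then show ?thesis using j by (meson Suc_leD less_SucI)
  qed
qed

text \<open>Exactly what is needed for the first k darts to traverse k different edges. A turn at
  index k - 1 is allowed, since it takes effect only after the last of these edges.\<close>

definition clean :: "nat \<times> nat \<Rightarrow> nat \<Rightarrow> bool" where
  "clean d k \<longleftrightarrow> (\<forall>i. 0 < i \<longrightarrow> i < k \<longrightarrow> it d i \<noteq> d) \<and> (\<forall>i. Suc i < k \<longrightarrow> \<not> turn d i)"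

text \<open>Cutting at the first obstruction leaves a clean stretch of t edges that either closes up
  or runs into an end right after its last edge.\<close>

lemma not_clean_least:
  assumes "\<not> clean d k"
  obtains t where "0 < t" "t < k" "clean d t" "it d t = d \<or> turn d (t - 1)"
proof -
  let ?P = "\<lambda>t. 0 < t \<and> t < k \<and> (it d t = d \<or> turn d (t - 1))"
  have "\<exists>t. ?P t"
  proof (cases "\<exists>i. 0 < i \<and> i < k \<and> it d i = d")
    case False
    then obtain i where "Suc i < k" "turn d i" using assms unfolding clean_def by blast
    then have "?P (Suc i)" by simp
    then show ?thesis by blast
  qed blast
  then have P: "?P (LEAST t. ?P t)" by (rule LeastI_ex)
  define t where "t = (LEAST t. ?P t)"
  have "\<not> ?P i" if "i < t" for i using not_less_Least that unfolding t_def by blast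
  note not_P = this
  have t: "?P t" using P unfolding t_def .
  have "clean d t"
    unfolding clean_def
  proof (intro conjI allI impI)
    fix i assume "0 < i" "i < t"
    then show "it d i \<noteq> d" using not_P[of i] t by auto
  next
    fix i assume "Suc i < t"
    then show "\<not> turn d i" using not_P[of "Suc i"] t by auto
  qed
  then show ?thesis using that t by blast
qed

lemma clean_shift:
  assumes "d \<in> darts" "clean d k" "a + m \<le> k"
  shows "clean (it d a) m"
  unfolding clean_def turn_it it_it
proof (intro conjI allI impI notI)
  fix i assume i: "0 < i" "i < m" "it d (a + i) = it d a"
  then have "it d i = d" using it_cancel assms(1) by blast
  then show False using i assms unfolding clean_def by auto
next
  fix i assume "Suc i < m" "turn d (a + i)"
  then show False using assms unfolding clean_def by auto
qed

text \<open>A repeated edge is traversed either twice in the same direction, which forces an earlier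
  return to d by \<open>it_cancel\<close>, or in opposite directions, which forces a turn in between
  by \<open>ex_turn\<close>.\<close>

lemma inj_on_dart_edge_it:
  assumes "d \<in> darts" "clean d k"
  shows "inj_on (\<lambda>i. dart_edge (it d i)) {..<k}"
proof -
  have "dart_edge (it d i) \<noteq> dart_edge (it d j)" if ij: "i < j" "j < k" for i j
  proof
    assume "dart_edge (it d i) = dart_edge (it d j)"
    then consider "it d j = it d i" | "it d j = prod.swap (it d i)"
      using dart_edge_eqD[of "it d j" "it d i"] by metis
    then show False
    proof cases
      case 1
      have "j = i + (j - i)" using that by simp
      then have "it d (j - i) = d" using it_cancel[OF assms(1), of i "j - i"] 1 by metis
      then show False using assms(2) that unfolding clean_def by auto
    next
      case 2
      then obtain m where "m < j" "turn d m" using ex_turn[OF assms(1) ij(1) 2] by blast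
      then show False using assms(2) that unfolding clean_def by auto
    qed
  qed
  then show ?thesis by (intro linorder_inj_onI') simp
qed

section \<open>Vertex sequences of orbits\<close>

definition run :: "nat \<times> nat \<Rightarrow> nat \<Rightarrow> nat list" where
  "run d k = map (\<lambda>i. fst (it d i)) [0..<Suc k]"

lemma run_0: "run d 0 = [fst d]"
  by (simp add: run_def)

lemma run_Suc: "run d (Suc k) = fst d # run (succ d) k"
proof -
  have "[0..<Suc (Suc k)] = 0 # map Suc [0..<Suc k]"
    by (simp add: upt_conv_Cons map_Suc_upt del: upt_Suc)
  then show ?thesis by (simp add: run_def funpow_swap1 del: upt_Suc)
qed

lemma length_run [simp]: "length (run d k) = Suc k"
  by (simp add: run_def)

lemma run_not_Nil [simp]: "run d k \<noteq> []"
  by (simp add: run_def)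

lemma hd_run [simp]: "hd (run d k) = fst d"
  by (cases k) (simp_all add: run_0 run_Suc)

lemma last_run [simp]: "last (run d k) = fst (it d k)"
  by (simp add: run_def)

lemma walk_edges_run:
  assumes "d \<in> darts"
  shows "walk_edges (run d k) = map (\<lambda>i. dart_edge (it d i)) [0..<k]"
  using assms
proof (induction k arbitrary: d)
  case (Suc k)
  have "[0..<Suc k] = 0 # map Suc [0..<k]"
    by (simp add: upt_conv_Cons map_Suc_upt del: upt_Suc)
  then show ?case using Suc.IH[of "succ d"] succ_props[OF Suc.prems]
    by (simp add: run_Suc walk_edges_Cons dart_edge_def funpow_swap1 del: upt_Suc)
qed (simp add: run_0)

lemma set_walk_edges_run:
  "d \<in> darts \<Longrightarrow> set (walk_edges (run d k)) = (\<lambda>i. dart_edge (it d i)) ` {..<k}"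
  by (simp add: walk_edges_run atLeast0LessThan)

lemma distinct_walk_edges_run:
  "d \<in> darts \<Longrightarrow> clean d k \<Longrightarrow> distinct (walk_edges (run d k))"
  using inj_on_dart_edge_it by (simp add: walk_edges_run distinct_map atLeast0LessThan)

lemma walk_edges_run_subset: "d \<in> darts \<Longrightarrow> set (walk_edges (run d k)) \<subseteq> D"
  using it_in_darts[of d] by (auto simp: set_walk_edges_run) (simp add: darts_def)

text \<open>The first two vertices of a run are the two components of its dart; with k = 0 only one
  of them would be recorded.\<close>

lemma inj_run:
  assumes "0 < k" "a \<in> darts" "b \<in> darts" "run a k = run b k"
  shows "a = b"
proof -
  obtain k' where k: "k = Suc k'" using assms(1) gr0_implies_Suc by blast
  have "fst a = fst b" "run (succ a) k' = run (succ b) k'" using assms(4) by (auto simp: k run_Suc)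
  moreover from this(2) have "snd a = snd b"
    using hd_run[of "succ a" k'] hd_run[of "succ b" k'] succ_props(2) assms by metis
  ultimately show ?thesis by (simp add: prod_eq_iff)
qed

text \<open>The edge is its own partner at \<open>fst d\<close>, so d leaves an end of an open
  trail. It is expressed as a turn of the reversed dart into d.\<close>

definition dart_start :: "nat \<times> nat \<Rightarrow> bool" where
  "dart_start d \<longleftrightarrow> d \<in> darts \<and> succ (prod.swap d) = d"

lemma dart_start_mate:
  assumes "dart_start d"
  shows "mate (fst d) (dart_edge d) = dart_edge d"
  using succ_props(3)[of "prod.swap d"] assms by (simp add: dart_start_def)

lemma turn_dart_start:
  assumes "d \<in> darts" "turn d i"
  shows "dart_start (it d (Suc i))" "mate (snd (it d i)) (dart_edge (it d i)) = dart_edge (it d i)"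
proof -
  have t: "it d (Suc i) = prod.swap (it d i)" using assms by (simp add: turn_def)
  then show s: "dart_start (it d (Suc i))"
    using it_in_darts[OF assms(1), of i] by (simp add: dart_start_def)
  show "mate (snd (it d i)) (dart_edge (it d i)) = dart_edge (it d i)"
    using dart_start_mate[OF s] t by simp
qed

text \<open>By periodicity a turn would occur within one period, and by cleanness only at its last
  index. The last dart would then be the reversal of d, and folding up the stretch in between yields
  another turn before it.\<close>

lemma closed_no_turn:
  assumes "d \<in> darts" "clean d t" "0 < t" "it d t = d"
  shows "\<not> turn d m"
proof
  assume "turn d m"
  have "it d (m mod t) = it d m" by (rule funpow_mod_eq[OF assms(4)])
  then have *: "turn d (m mod t)" using \<open>turn d m\<close> by (simp add: turn_def)
  then have "\<not> Suc (m mod t) < t" using assms(2) by (auto simp: clean_def)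
  then have t: "Suc (m mod t) = t" using mod_less_divisor[OF assms(3), of m] by linarith
  then have sw: "prod.swap (it d (m mod t)) = d" using * assms(4) by (simp add: turn_def)
  then have sw': "it d (m mod t) = prod.swap (it d 0)" by (metis funpow_0 swap_swap)
  have "m mod t \<noteq> 0" using sw' swap_neq[OF assms(1)] by (metis funpow_0)
  then obtain m' where "m' < m mod t" "turn d m'" using ex_turn[OF assms(1) _ sw'] by blast
  then show False using assms(2) t by (auto simp: clean_def)
qed

lemma closed_shift:
  assumes "d \<in> darts" "clean d t" "0 < t" "it d t = d"
  shows "clean (it d i) t" "it (it d i) t = it d i"
proof -
  show "it (it d i) t = it d i" unfolding it_it using assms(4) by (simp add: funpow_add)
  show "clean (it d i) t"
    unfolding clean_def turn_it it_it
  proof (intro conjI allI impI)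
    fix j assume "0 < j" "j < t"
    then have "it d j \<noteq> d" using assms(2) by (simp add: clean_def)
    then show "it d (i + j) \<noteq> it d i" using it_cancel[OF assms(1)] by blast
  qed (rule closed_no_turn[OF assms])
qed

text \<open>An orbit that leaves an end cannot close up before it turns: the predecessor of e is its
  own reversal \<open>prod.swap e\<close>, and to traverse the first edge backwards the orbit must
  have turned already.\<close>

lemma start_turns:
  assumes "dart_start e" "\<not> clean e k"
  obtains t where "0 < t" "t < k" "clean e t" "turn e (t - 1)"
proof -
  have e: "e \<in> darts" "succ (prod.swap e) = e" using assms by (auto simp: dart_start_def)
  obtain t where t: "0 < t" "t < k" "clean e t" "it e t = e \<or> turn e (t - 1)"
    using not_clean_least[OF assms(2)] by blast
  have "it e t \<noteq> e"
  proof
    assume eq: "it e t = e"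
    obtain t' where t': "t = Suc t'" using t(1) gr0_implies_Suc by blast
    have "succ (it e t') = succ (prod.swap e)" using eq e t' by simp
    then have sw: "it e t' = prod.swap (it e 0)"
      using succ_inj it_in_darts e by simp
    then have "t' \<noteq> 0" using swap_neq[OF e(1)] by (metis funpow_0)
    then obtain m where "m < t'" "turn e m" using ex_turn[OF e(1) _ sw] by blast
    then show False using t(3) t' by (auto simp: clean_def)
  qed
  then show ?thesis using that t by blast
qed

text \<open>After the turn the orbit retraces its darts in reverse, by repeated use of
  \<open>succ_swap_succ\<close>.\<close>

lemma it_backwards:
  assumes "d \<in> darts" "turn d t" "j \<le> t"
  shows "it (it d (Suc t)) j = prod.swap (it d (t - j))"
  using assms(3)
proof (induction j)
  case 0
  then show ?case using assms(2) by (simp add: turn_def)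
next
  case (Suc j)
  then have "t - j = Suc (t - Suc j)" by simp
  then have "succ (prod.swap (it d (t - j))) = prod.swap (it d (t - Suc j))"
    using succ_swap_succ[OF it_in_darts[OF assms(1), of "t - Suc j"]] by simp
  then show ?case using Suc by simp
qed

text \<open>Let e leave the end that the trail from d reaches. If the trail from e is clean for 2L
  edges, then at least L of them lie behind d, and the reversed dart is clean. Otherwise the trail
  from e ends in fewer than 2L edges and d lies on it, so d belongs to a short whole trail.\<close>

lemma turning_dart_cases:
  assumes "d \<in> darts" "clean d t" "0 < t" "turn d (t - 1)" "t \<le> L"
  obtains "clean (prod.swap d) L"
  | e t' j where "dart_start e" "0 < t'" "t' < 2 * L" "clean e t'" "turn e (t' - 1)" "j < t'"
      "d = prod.swap (it e j)"
proof -
  define e where "e = it d t"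
  have e: "dart_start e" using turn_dart_start(1)[OF assms(1,4)] assms(3) by (simp add: e_def)
  have bk: "it e j = prod.swap (it d (t - 1 - j))" if "j \<le> t - 1" for j
    using it_backwards[OF assms(1,4) that] assms(3) by (simp add: e_def)
  have d: "d = prod.swap (it e (t - 1))" using bk[of "t - 1"] by simp
  show ?thesis
  proof (cases "clean e (2 * L)")
    case True
    \<comment> \<open>The reversal of d is reached from e after \<open>t - 1\<close> steps, and
      \<open>t - 1 + L\<close> does not exceed \<open>2 * L\<close>.\<close>
    have "clean (it e (t - 1)) L"
      by (rule clean_shift[OF _ True]) (use e assms in \<open>auto simp: dart_start_def\<close>)
    then show ?thesis using that(1) d by (metis swap_swap)
  next
    case False
    then obtain t' where t': "0 < t'" "t' < 2 * L" "clean e t'" "turn e (t' - 1)"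
      using start_turns[OF e] by blast
    \<comment> \<open>Otherwise the trail from e would turn while it still retraces the darts from
      d, so the trail from d would have turned before t.\<close>
    have "t - 1 < t'"
    proof (rule ccontr)
      assume "\<not> t - 1 < t'"
      then have le: "t' \<le> t - 1" by simp
      have "it e t' = prod.swap (it e (t' - 1))" using t' by (simp add: turn_def)
      then have "prod.swap (it d (t - 1 - t')) = it d (t - 1 - (t' - 1))"
        using bk[OF le] bk[of "t' - 1"] le by simp
      moreover have "t - 1 - (t' - 1) = Suc (t - 1 - t')" using le t'(1) by simp
      ultimately have "turn d (t - 1 - t')" by (simp only: turn_def)
      then show False using assms(2) t'(1) le by (auto simp: clean_def)
    qed
    then show ?thesis using that(2) e t' d by blast
  qed
qed

lemma finite_darts: "finite darts"
proof -
  have "darts \<subseteq> \<Union> D \<times> \<Union> D" by (auto simp: darts_def dart_edge_def)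
  moreover have "finite (\<Union> D)" 
    by (intro finite_Union finite_D card_ge_0_finite) (simp add: card_D)
  ultimately show ?thesis by (simp add: finite_subset)
qed

lemma card_D_le_darts: "card D \<le> card darts"
proof -
  have "D \<subseteq> dart_edge ` darts"
  proof
    fix e assume "e \<in> D"
    then have "card e = 2" using card_D by blast
    then obtain u v where "e = {u, v}" by (auto simp: card_2_iff)
    then show "e \<in> dart_edge ` darts"
      using \<open>e \<in> D\<close> by (intro image_eqI[of _ _ "(u, v)"]) (auto simp: darts_def dart_edge_def)
  qed
  then show ?thesis using finite_darts card_mono card_image_le finite_imageI le_trans by metis
qed

end


text \<open>Weaker than strict alternation: consecutive red edges are allowed, and so are
  consecutive blue edges at a vertex outside \<open>V\<close>. Only blue after blue at a planted
  vertex is excluded.\<close>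

fun alternating :: "nat set \<Rightarrow> graph \<Rightarrow> nat list \<Rightarrow> bool" where
  "alternating V h (x # y # z # p) \<longleftrightarrow>
     (y \<in> V \<longrightarrow> {x, y} \<in> h \<or> {y, z} \<in> h) \<and> alternating V h (y # z # p)"
| "alternating V h _ \<longleftrightarrow> True"

definition alternating_trails :: "nat \<Rightarrow> nat set \<Rightarrow> graph \<Rightarrow> graph \<Rightarrow> nat \<Rightarrow> nat list set" where
  "alternating_trails n V h G k = {p. length p = Suc k \<and> set p \<subseteq> {1..n} \<and>
     distinct (walk_edges p) \<and> set (walk_edges p) \<subseteq> G \<and> alternating V h p}"

definition red :: "graph \<Rightarrow> nat list \<Rightarrow> nat" where
  "red h p = card (set (walk_edges p) \<inter> h)"

definition blue :: "graph \<Rightarrow> nat list \<Rightarrow> nat" where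
  "blue h p = card (set (walk_edges p) - h)"

definition light_trails :: "nat \<Rightarrow> nat set \<Rightarrow> graph \<Rightarrow> graph \<Rightarrow> nat \<Rightarrow> real \<Rightarrow> nat list set" where
  "light_trails n V h G k s =
     {p \<in> alternating_trails n V h G k. real (red h p) \<le> real (blue h p) + s}"

text \<open>The closed trail is cut open at a blue edge, so that the edge leading back to the last
  vertex, which involves no free choice of a vertex, is one that has to be paid for with its
  probability.\<close>

definition light_closed_trails :: "nat \<Rightarrow> nat set \<Rightarrow> graph \<Rightarrow> graph \<Rightarrow> nat \<Rightarrow> nat list set" where
  "light_closed_trails n V h G k =
     {p \<in> light_trails n V h G k 0. hd p = last p \<and> {hd p, hd (tl p)} \<notin> h}"

lemma finite_light_trails: "finite (light_trails n V h G k s)"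
proof (rule finite_subset)
  show "light_trails n V h G k s \<subseteq> {p. set p \<subseteq> {1..n} \<and> length p = Suc k}"
    by (auto simp: light_trails_def alternating_trails_def)
qed (rule finite_lists_length_eq, simp)

lemma finite_light_closed_trails: "finite (light_closed_trails n V h G k)"
  by (rule finite_subset[OF _ finite_light_trails]) (auto simp: light_closed_trails_def)

section \<open>Pairing the edges of the difference at a vertex\<close>

lemma ex_involution_le_2:
  assumes "finite X" "card X \<le> 2"
  shows "\<exists>\<mu>. (\<forall>e\<in>X. \<mu> e \<in> X \<and> \<mu> (\<mu> e) = e) \<and> (\<forall>e\<in>X. \<mu> e = e \<longrightarrow> X = {e})"
proof (cases "card X = 2")
  case True
  then obtain a b where "X = {a, b}" "a \<noteq> b" by (auto simp: card_2_iff)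
  then show ?thesis by (intro exI[of _ "\<lambda>e. if e = a then b else a"]) auto
next
  case False
  then have "card X = 0 \<or> card X = 1" using assms(2) by linarith
  then show ?thesis
    using assms(1) by (intro exI[of _ id]) (auto simp: card_1_singleton_iff)
qed

text \<open>\<open>A\<close> and \<open>B\<close> stand for the red and blue edges of the difference
  at a planted vertex. An injection f matches all of \<open>B\<close> into \<open>A\<close>; the set
  \<open>X\<close> of red edges left over has at most two elements, which g pairs with each other, a
  single one with itself.\<close>

lemma ex_mates_in:
  assumes "finite A" "finite B" "A \<inter> B = {}" "card B \<le> card A" "card A \<le> 2"
  shows "\<exists>\<mu>. (\<forall>e\<in>A \<union> B. \<mu> e \<in> A \<union> B \<and> \<mu> (\<mu> e) = e) \<and>
    (\<forall>e\<in>A \<union> B. \<mu> e = e \<longrightarrow> card A = card B + 1) \<and>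
    (\<forall>e\<in>A \<union> B. \<forall>e'\<in>A \<union> B. \<mu> e = e \<longrightarrow> \<mu> e' = e' \<longrightarrow> e = e') \<and>
    (\<forall>e\<in>B. \<mu> e \<in> A) \<and> card {e \<in> A. \<mu> e \<in> A} + card B = card A"
proof -
  obtain f where f: "inj_on f B" "f ` B \<subseteq> A"
    using card_le_inj[OF assms(2,1,4)] by blast
  define X where "X = A - f ` B"
  have cX: "card X + card B = card A"
    using card_Diff_subset[of "f ` B" A] f assms by (simp add: X_def card_image)
  have "finite X" "card X \<le> 2" using cX assms by (simp_all add: X_def)
  from ex_involution_le_2[OF this]
  obtain g where g: "\<forall>e\<in>X. g e \<in> X \<and> g (g e) = e" "\<forall>e\<in>X. g e = e \<longrightarrow> X = {e}"
    by (elim exE conjE)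
  define \<mu> where "\<mu> e = (if e \<in> B then f e else if e \<in> f ` B then inv_into B f e else g e)" for e
  have muB: "\<mu> e = f e" "f e \<in> A" "f e \<in> f ` B" "f e \<notin> B" if "e \<in> B" for e
    using that f assms(3) by (auto simp: \<mu>_def)
  have mufB: "\<mu> (f b) = b" if "b \<in> B" for b
    using that f(1) muB(3,4)[OF that] by (simp add: \<mu>_def)
  have muX: "\<mu> e = g e" "g e \<in> X" "g (g e) = e" "e \<in> A" "e \<notin> B" "e \<notin> f ` B" if "e \<in> X" for e
  proof -
    show "g e \<in> X" "g (g e) = e" using that g(1) by blast+
    show "e \<in> A" "e \<notin> B" "e \<notin> f ` B" using that assms(3) by (auto simp: X_def)
    then show "\<mu> e = g e" by (simp add: \<mu>_def)
  qed
  have cases: "e \<in> B \<or> (\<exists>b\<in>B. e = f b) \<or> e \<in> X" if "e \<in> A \<union> B" for e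
    using that by (auto simp: X_def)
  have 1: "\<mu> e \<in> A \<union> B \<and> \<mu> (\<mu> e) = e" if "e \<in> A \<union> B" for e
    using cases[OF that]
  proof (elim disjE)
    assume "e \<in> B"
    then show ?thesis using muB[of e] mufB[of e] by simp
  next
    assume "\<exists>b\<in>B. e = f b"
    then obtain b where "b \<in> B" "e = f b" by blast
    then show ?thesis using muB[of b] mufB[of b] by simp
  next
    assume "e \<in> X"
    then show ?thesis using muX[of e] muX[of "g e"] by simp
  qed
  have 2: "e \<in> X \<and> X = {e}" if "e \<in> A \<union> B" "\<mu> e = e" for e
    using cases[OF that(1)]
  proof (elim disjE)
    assume "e \<in> B"
    then show ?thesis using muB[of e] that(2) by simp
  next
    assume "\<exists>b\<in>B. e = f b"
    then obtain b where "b \<in> B" "e = f b" by blast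
    then show ?thesis using muB(4)[of b] mufB[of b] that(2) by simp
  next
    assume "e \<in> X"
    then show ?thesis using muX(1)[of e] g(2) that(2) by simp
  qed
  have "{e \<in> A. \<mu> e \<in> A} = X"
  proof
    show "X \<subseteq> {e \<in> A. \<mu> e \<in> A}" 
    proof
      fix e assume "e \<in> X"
      then show "e \<in> {e \<in> A. \<mu> e \<in> A}" using muX[of e] muX[of "g e"] by simp
    qed
    show "{e \<in> A. \<mu> e \<in> A} \<subseteq> X"
    proof
      fix e assume e: "e \<in> {e \<in> A. \<mu> e \<in> A}"
      have "e \<notin> f ` B" using e mufB assms(3) by auto
      then show "e \<in> X" using e by (simp add: X_def)
    qed
  qed
  then have "card {e \<in> A. \<mu> e \<in> A} + card B = card A" using cX by simp
  moreover have "\<forall>e\<in>A \<union> B. \<mu> e \<in> A \<union> B \<and> \<mu> (\<mu> e) = e" by (rule ballI) (rule 1)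
  moreover have "\<forall>e\<in>A \<union> B. \<mu> e = e \<longrightarrow> card A = card B + 1"
  proof (intro ballI impI)
    fix e assume "e \<in> A \<union> B" "\<mu> e = e"
    then have "card X = card {e}" using 2 by simp
    then show "card A = card B + 1" using cX by simp
  qed
  moreover have "\<forall>e\<in>A \<union> B. \<forall>e'\<in>A \<union> B. \<mu> e = e \<longrightarrow> \<mu> e' = e' \<longrightarrow> e = e'"
  proof (intro ballI impI)
    fix e e' assume "e \<in> A \<union> B" "e' \<in> A \<union> B" "\<mu> e = e" "\<mu> e' = e'"
    then have "e \<in> X" "X = {e'}" using 2 by blast+
    then show "e = e'" by simp
  qed
  moreover have "\<forall>e\<in>B. \<mu> e \<in> A" using muB(1,2) by simp
  ultimately show ?thesis by (intro exI[of _ \<mu>] conjI)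
qed

locale planted_recovery =
  fixes n :: nat and V :: "nat set" and h G H :: graph
  assumes G: "G \<subseteq> all_edges_on n" and hG: "h \<subseteq> G" and HG: "H \<subseteq> G"
    and deg_h: "\<And>v. degree h v = (if v \<in> V then 2 else 0)"
    and deg_H: "deg_le_2 n H"
begin

abbreviation D :: graph where "D \<equiv> H \<triangle> h"

lemma fin: "finite G" "finite h" "finite H"
  using G hG HG finite_all_edges_on finite_subset by metis+

lemma edges_n: "e \<in> G \<Longrightarrow> v \<in> e \<Longrightarrow> v \<in> {1..n}"
  using G unfolding all_edges_on_def by blast

text \<open>The last clause is the one that makes flips admissible: the red edges with a red
  partner, which may enter without a blue edge leaving, do not exceed the free degree of
  \<open>H\<close> at v.\<close>

lemma ex_mate_at:
  assumes "v \<in> {1..n}"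
  shows "\<exists>\<mu>. (\<forall>e\<in>{e \<in> D. v \<in> e}. \<mu> e \<in> {e \<in> D. v \<in> e} \<and> \<mu> (\<mu> e) = e) \<and>
    (\<forall>e\<in>{e \<in> D. v \<in> e}. \<mu> e = e \<longrightarrow> degree H v = 1) \<and>
    (\<forall>e\<in>{e \<in> D. v \<in> e}. \<forall>e'\<in>{e \<in> D. v \<in> e}. \<mu> e = e \<longrightarrow> \<mu> e' = e' \<longrightarrow> e = e') \<and>
    (v \<in> V \<longrightarrow> (\<forall>e\<in>{e \<in> D. v \<in> e}. e \<notin> h \<longrightarrow> \<mu> e \<in> h)) \<and>
    degree H v + card {e \<in> D. v \<in> e \<and> e \<in> h \<and> \<mu> e \<in> h} \<le> 2"
proof -
  define A where "A = {e \<in> h - H. v \<in> e}"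
  define B where "B = {e \<in> H - h. v \<in> e}"
  define C where "C = {e \<in> H \<inter> h. v \<in> e}"
  have D: "{e \<in> D. v \<in> e} = A \<union> B" "A \<inter> B = {}" and finAB: "finite A" "finite B" "finite C"
    using fin by (auto simp: A_def B_def C_def)
  have "{e \<in> h. v \<in> e} = A \<union> C" "A \<inter> C = {}" "{e \<in> H. v \<in> e} = B \<union> C" "B \<inter> C = {}"
    by (auto simp: A_def B_def C_def)
  then have cards: "degree h v = card A + card C" "degree H v = card B + card C"
    using finAB by (simp_all add: degree_def card_Un_disjoint)
  have le2: "degree H v \<le> 2" using deg_H assms by (auto simp: deg_le_2_def)
  show ?thesis
  proof (cases "v \<in> V")
    case True
    then have 2: "card A + card C = 2" using cards deg_h[of v] by simp
    then obtain \<mu> where \<mu>: "\<forall>e\<in>A \<union> B. \<mu> e \<in> A \<union> B \<and> \<mu> (\<mu> e) = e"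
       "\<forall>e\<in>A \<union> B. \<mu> e = e \<longrightarrow> card A = card B + 1"
       "\<forall>e\<in>A \<union> B. \<forall>e'\<in>A \<union> B. \<mu> e = e \<longrightarrow> \<mu> e' = e' \<longrightarrow> e = e'"
       "\<forall>e\<in>B. \<mu> e \<in> A" "card {e \<in> A. \<mu> e \<in> A} + card B = card A"
      using ex_mates_in[OF finAB(1,2) D(2)] le2 cards by auto
    \<comment> \<open>From \<open>card A = card B + 1\<close> and \<open>card A + card C = 2\<close>
      it follows that \<open>card B + card C = 1\<close>.\<close>
    have "\<forall>e\<in>A \<union> B. \<mu> e = e \<longrightarrow> degree H v = 1" using \<mu>(2) 2 cards(2) by auto
    moreover have "\<forall>e\<in>A \<union> B. e \<notin> h \<longrightarrow> \<mu> e \<in> h" using \<mu>(4) by (auto simp: A_def B_def)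
    moreover have "{e \<in> D. v \<in> e \<and> e \<in> h \<and> \<mu> e \<in> h} \<subseteq> {e \<in> A. \<mu> e \<in> A}"
    proof
      fix e assume e: "e \<in> {e \<in> D. v \<in> e \<and> e \<in> h \<and> \<mu> e \<in> h}"
      then have "\<mu> e \<in> A \<union> B" "e \<in> A" using \<mu>(1) by (auto simp: A_def)
      then show "e \<in> {e \<in> A. \<mu> e \<in> A}" using e by (auto simp: B_def)
    qed
    then have "card {e \<in> D. v \<in> e \<and> e \<in> h \<and> \<mu> e \<in> h} \<le> card {e \<in> A. \<mu> e \<in> A}"
      using finAB by (intro card_mono) auto
    then have "degree H v + card {e \<in> D. v \<in> e \<and> e \<in> h \<and> \<mu> e \<in> h} \<le> 2"
      using \<mu>(5) 2 cards(2) by linarith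
    ultimately show ?thesis unfolding D using \<mu>(1,3) by (intro exI[of _ \<mu>]) simp
  next
    case False
    \<comment> \<open>No red edge meets v, so the at most two edges of \<open>H\<close> there are
      all blue and can be paired with each other.\<close>
    then have "card A = 0" "card C = 0" using cards deg_h[of v] by auto
    then have AC: "A = {}" "card B = degree H v" using finAB cards by auto
    then obtain \<mu> where \<mu>: "\<forall>e\<in>B. \<mu> e \<in> B \<and> \<mu> (\<mu> e) = e" "\<forall>e\<in>B. \<mu> e = e \<longrightarrow> B = {e}"
      using ex_involution_le_2[OF finAB(2)] le2 by auto
    have "{e \<in> D. v \<in> e \<and> e \<in> h \<and> \<mu> e \<in> h} = {}" using AC(1) by (auto simp: A_def)
    then have "card {e \<in> D. v \<in> e \<and> e \<in> h \<and> \<mu> e \<in> h} = 0" by (simp only: card.empty)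
    moreover have "\<forall>e\<in>B. \<mu> e = e \<longrightarrow> degree H v = 1" using \<mu>(2) AC(2) by force
    moreover have "\<forall>e\<in>B. \<forall>e'\<in>B. \<mu> e = e \<longrightarrow> \<mu> e' = e' \<longrightarrow> e = e'" using \<mu>(2) by blast
    ultimately show ?thesis unfolding D AC(1) using \<mu>(1) False le2 by (intro exI[of _ \<mu>]) simp
  qed
qed

end

locale mated_recovery = planted_recovery +
  fixes mate :: "nat \<Rightarrow> nat set \<Rightarrow> nat set"
  assumes mate:
    "\<And>v e. v \<in> e \<Longrightarrow> e \<in> D \<Longrightarrow> mate v e \<in> D \<and> v \<in> mate v e \<and> mate v (mate v e) = e"
    "\<And>v e. v \<in> e \<Longrightarrow> e \<in> D \<Longrightarrow> mate v e = e \<Longrightarrow> degree H v = 1"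
    "\<And>v e e'. v \<in> e \<Longrightarrow> e \<in> D \<Longrightarrow> v \<in> e' \<Longrightarrow> e' \<in> D \<Longrightarrow> mate v e = e \<Longrightarrow> mate v e' = e' \<Longrightarrow> e = e'"
    "\<And>v e. v \<in> e \<Longrightarrow> e \<in> D \<Longrightarrow> v \<in> V \<Longrightarrow> e \<notin> h \<Longrightarrow> mate v e \<in> h"
    "\<And>v. v \<in> {1..n} \<Longrightarrow> degree H v + card {e \<in> D. v \<in> e \<and> e \<in> h \<and> mate v e \<in> h} \<le> 2"
begin

sublocale mated_edges D mate
proof
  show "finite D" using fin by simp
  show "card e = 2" if "e \<in> D" for e using that G hG HG by (auto simp: all_edges_on_def)
qed (use mate(1) in blast)+

lemma D_G: "D \<subseteq> G" using hG HG by auto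

text \<open>At a vertex v, a red edge whose partner is blue enters only together with the removal of
  that partner, which by assumption lies on p as well. The other red edges fit into the free degree
  provided by the pairing.\<close>

lemma flip_admissible:
  assumes P: "set (walk_edges p) \<subseteq> D"
    and closed: "\<And>v e. e \<in> set (walk_edges p) \<Longrightarrow> v \<in> e \<Longrightarrow> e \<in> h \<Longrightarrow> mate v e \<notin> h \<Longrightarrow>
      mate v e \<in> set (walk_edges p)"
  shows "deg_le_2 n (flip H p)"
  unfolding deg_le_2_def
proof
  fix v assume v: "v \<in> {1..n}"
  define P where "P = set (walk_edges p)"
  have PD: "P \<subseteq> D" using assms by (simp add: P_def)
  let ?Hv = "{e \<in> H. v \<in> e}" and ?B = "{e \<in> P - h. v \<in> e}" and ?R = "{e \<in> P \<inter> h. v \<in> e}"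
  let ?R1 = "{e \<in> ?R. mate v e \<notin> h}" and ?R2 = "{e \<in> D. v \<in> e \<and> e \<in> h \<and> mate v e \<in> h}"
  have finP: "finite P" by (simp add: P_def)
  have "{e \<in> flip H p. v \<in> e} = (?Hv - ?B) \<union> ?R"
    using PD by (auto simp: flip_def P_def)
  then have "degree (flip H p) v \<le> card (?Hv - ?B) + card ?R"
    unfolding degree_def by (simp only: card_Un_le)
  moreover have "?B \<subseteq> ?Hv" using PD by auto
  then have "card (?Hv - ?B) + card ?B = degree H v"
    using fin finP by (simp add: degree_def card_Diff_subset card_mono)
  moreover have "card ?R \<le> card ?R1 + card ?R2"
  proof -
    have "?R \<subseteq> ?R1 \<union> ?R2" using PD by auto
    then have "card ?R \<le> card (?R1 \<union> ?R2)" using fin finP by (intro card_mono) auto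
    then show ?thesis using card_Un_le[of ?R1 ?R2] by linarith
  qed
  moreover have "card ?R1 \<le> card ?B"
  proof (rule card_inj_on_le[where f = "mate v"])
    show "inj_on (mate v) ?R1"
    proof (rule inj_on_inverseI)
      fix e assume "e \<in> ?R1"
      then show "mate v (mate v e) = e" using mate(1)[of v e] PD by blast
    qed
    show "mate v ` ?R1 \<subseteq> ?B"
    proof
      fix e' assume "e' \<in> mate v ` ?R1"
      then obtain e where e: "e \<in> ?R1" "e' = mate v e" by blast
      then have "e' \<in> P" using closed[of e v] unfolding P_def by simp
      moreover have "v \<in> e'" using e mate(1)[of v e] PD by blast
      ultimately show "e' \<in> ?B" using e by simp
    qed
  qed (use finP in simp)
  moreover note mate(5)[OF v]
  ultimately show "degree (flip H p) v \<le> 2" by linarith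
qed

lemma card_flip:
  assumes "set (walk_edges p) \<subseteq> D"
  shows "card (flip H p) + blue h p = card H + red h p"
proof -
  define P where "P = set (walk_edges p)"
  have PD: "P \<subseteq> D" using assms by (simp add: P_def)
  have finP: "finite P" by (simp add: P_def)
  have "flip H p = (H - (P - h)) \<union> (P \<inter> h)" using PD by (auto simp: flip_def P_def)
  then have "card (flip H p) = card (H - (P - h)) + card (P \<inter> h)"
    using fin finP PD by (simp only:) (intro card_Un_disjoint, auto)
  moreover have "card (H - (P - h)) + card (P - h) = card H"
  proof -
    have "P - h \<subseteq> H" using PD by auto
    then show ?thesis
      using fin(3) finP card_mono[of H "P - h"] card_Diff_subset[of "P - h" H] by simp
  qed
  ultimately show ?thesis by (simp add: red_def blue_def P_def)
qed

lemma dart_edge_in_D: "d \<in> darts \<Longrightarrow> dart_edge d \<in> D"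
  by (simp add: darts_def)

text \<open>Consecutive darts carry partners, and the partner of a blue edge at a planted vertex is
  red.\<close>

lemma alternating_run: "d \<in> darts \<Longrightarrow> alternating V h (run d k)"
proof (induction k arbitrary: d)
  case (Suc k)
  have s: "succ d \<in> darts" using Suc succ_props by blast
  show ?case
  proof (cases k)
    case (Suc k')
    let ?d = "succ d"
    have "{fst d, snd d} \<in> h \<or> {snd d, snd ?d} \<in> h" if "snd d \<in> V"
    proof -
      have "mate (snd d) (dart_edge d) \<in> h" if "dart_edge d \<notin> h"
        using mate(4)[of "snd d" "dart_edge d"] dart_edge_in_D[OF Suc.prems] that \<open>snd d \<in> V\<close>
        by (simp add: dart_edge_def)
      then show ?thesis using succ_props[OF Suc.prems] by (auto simp: dart_edge_def)
    qed
    moreover have "run d (Suc k) = fst d # snd d # snd ?d # tl (run (succ ?d) k')"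
      "run ?d k = snd d # snd ?d # tl (run (succ ?d) k')"
      using succ_props[OF Suc.prems] succ_props[OF s] Suc
      by (cases k'; simp add: run_Suc run_0)+
    ultimately show ?thesis using Suc.IH[OF s] by simp
  qed (simp add: run_Suc run_0)
qed (simp add: run_0)

lemma run_alternating_trails:
  assumes "d \<in> darts" "clean d k"
  shows "run d k \<in> alternating_trails n V h G k"
proof -
  have "fst (it d i) \<in> {1..n}" for i
    using dart_edge_in_D[OF it_in_darts[OF assms(1), of i]] edges_n D_G by (auto simp: dart_edge_def)
  then have "set (run d k) \<subseteq> {1..n}" by (auto simp: run_def)
  then show ?thesis
    using alternating_run[OF assms(1)] distinct_walk_edges_run[OF assms]
      walk_edges_run_subset[OF assms(1), of k] D_G
    by (auto simp: alternating_trails_def)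
qed

lemma run_short_trails:
  assumes "d \<in> darts" "clean d k" "0 < k" "real k < ln (real n)"
  shows "run d k \<in> short_trails n G"
  using walk_edges_run[OF assms(1), of k] distinct_walk_edges_run[OF assms(1,2)]
    walk_edges_run_subset[OF assms(1), of k] D_G assms(3,4)
  by (auto simp: short_trails_def trails_def)

lemma start_degree:
  assumes "dart_start d"
  shows "degree H (fst d) = 1"
  using mate(2)[of "fst d" "dart_edge d"] dart_start_mate[OF assms] assms dart_edge_in_D
  by (auto simp: dart_start_def dart_edge_def)

lemma mate_snd_it: "d \<in> darts \<Longrightarrow> mate (snd (it d i)) (dart_edge (it d i)) = dart_edge (it d (Suc i))"
  using succ_props(3) it_in_darts by simp

lemma mate_fst_it: "d \<in> darts \<Longrightarrow> mate (fst (it d (Suc i))) (dart_edge (it d (Suc i))) = dart_edge (it d i)"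
  using mate_fst_succ it_in_darts by simp

end


section \<open>The trails left by the algorithm\<close>

locale stable_recovery = mated_recovery +
  assumes stable: "iteration n (short_trails n G) H H"
begin

text \<open>Otherwise (A) would have flipped p: the flip would gain edges, keep the degrees
  admissible and create no vertex of degree 1.\<close>

lemma step_A_stable:
  assumes "p \<in> short_trails n G" "set (walk_edges p) \<subseteq> D" "deg_le_2 n (flip H p)"
    and "hd p = last p \<or> degree H (hd p) = 1 \<and> degree H (last p) = 1"
  shows "red h p \<le> blue h p"
proof -
  note D = short_trailsD[OF assms(1) G]
  have A: "step_A n p H = H"
    using iteration_fixpoint(1)[OF stable order_refl G assms(1)] .
  have "num_deg_1 n (flip H p) \<le> num_deg_1 n H"
    by (rule num_deg_1_flip_whole_le[OF fin(3) deg_H assms(3) D(3,5,2) assms(4)])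
  then have "\<not> card H < card (flip H p)"
    using A flip_neq[OF D(1), of H] assms(3) by (auto simp: step_A_def split: if_splits)
  then show ?thesis using card_flip[OF assms(2)] by linarith
qed

lemma step_B_stable:
  assumes "p \<in> short_trails n G" "set (walk_edges p) \<subseteq> D" "deg_le_2 n (flip H p)"
  shows "real (red h p) < real (blue h p) + sqrt (ln (real n))"
proof -
  have "real (card (flip H p)) < real (card H) + sqrt (ln (real n))"
    using iteration_fixpoint(2)[OF stable order_refl G assms(1,3)] .
  moreover have "real (card (flip H p)) + real (blue h p) = real (card H) + real (red h p)"
    using card_flip[OF assms(2)] by (metis of_nat_add)
  ultimately show ?thesis by linarith
qed

text \<open>Inside a run the partner of each edge is the preceding or the following edge of the run;
  only the two outer partners can be missing.\<close>

lemma run_admissible: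
  assumes d: "d \<in> darts" and k: "0 < k"
    and start: "dart_edge d \<in> h \<Longrightarrow> mate (fst d) (dart_edge d) \<notin> h \<Longrightarrow>
      mate (fst d) (dart_edge d) \<in> set (walk_edges (run d k))"
    and end_: "\<And>l. l = it d (k - 1) \<Longrightarrow> dart_edge l \<in> h \<Longrightarrow> mate (snd l) (dart_edge l) \<notin> h \<Longrightarrow>
      mate (snd l) (dart_edge l) \<in> set (walk_edges (run d k))"
  shows "deg_le_2 n (flip H (run d k))"
proof (rule flip_admissible[OF walk_edges_run_subset[OF d]])
  let ?P = "set (walk_edges (run d k))"
  have P: "?P = (\<lambda>i. dart_edge (it d i)) ` {..<k}" by (rule set_walk_edges_run[OF d])
  fix v e assume e: "e \<in> ?P" "v \<in> e" "e \<in> h" "mate v e \<notin> h"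
  then obtain i where i: "e = dart_edge (it d i)" "i < k" by (auto simp: P)
  consider "v = snd (it d i)" | "v = fst (it d i)" using e(2) i(1) by (auto simp: dart_edge_def)
  then show "mate v e \<in> ?P"
  proof cases
    case 1
    show ?thesis
    proof (cases "Suc i = k")
      case True
      then show ?thesis using end_[of "it d i"] e i(1) 1 by auto
    next
      case False
      then show ?thesis unfolding P using i mate_snd_it[OF d, of i] 1
        by (intro image_eqI[where x = "Suc i"]) auto
    qed
  next
    case 2
    show ?thesis
    proof (cases i)
      case 0
      then show ?thesis using start e i(1) 2 by simp
    next
      case (Suc i')
      then show ?thesis unfolding P using i mate_fst_it[OF d, of i'] 2
        by (intro image_eqI[where x = i']) auto
    qed
  qed
qed

text \<open>A piece cut out of a longer trail can be flipped once a red edge at either end is dropped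
  whose partner is blue; this costs at most two red edges.\<close>

lemma clean_run_light:
  assumes d: "d \<in> darts" "clean d L" and L: "3 \<le> L" "real L < ln (real n)"
  shows "run d L \<in> light_trails n V h G L (sqrt (ln (real n)) + 2)"
proof -
  define l where "l = it d (L - 1)"
  define a :: nat where "a = (if dart_edge d \<in> h \<and> mate (fst d) (dart_edge d) \<notin> h then 1 else 0)"
  define b where "b = (if dart_edge l \<in> h \<and> mate (snd l) (dart_edge l) \<notin> h then L - 1 else L)"
  \<comment> \<open>With \<open>3 \<le> L\<close> at least one edge survives the dropping of both
    end edges.\<close>
  have ab: "a \<le> 1" "L - 1 \<le> b" "b \<le> L" "a < b" using L by (auto simp: a_def b_def)
  define q where "q = run (it d a) (b - a)"
  have da: "it d a \<in> darts" "clean (it d a) (b - a)"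
    using it_in_darts[OF d(1)] clean_shift[OF d, of a "b - a"] ab by auto
  have set_q: "set (walk_edges q) = (\<lambda>i. dart_edge (it d i)) ` {a..<b}"
  proof -
    have "set (walk_edges q) = (\<lambda>i. dart_edge (it d (a + i))) ` {..<b - a}"
      unfolding q_def set_walk_edges_run[OF da(1)] it_it ..
    also have "\<dots> = (\<lambda>i. dart_edge (it d i)) ` ((+) a ` {0..<b - a})"
      by (simp add: image_image atLeast0LessThan)
    also have "(+) a ` {0..<b - a} = {a..<b}" using ab(4) by (subst image_add_atLeastLessThan) simp
    finally show ?thesis .
  qed
  have qD: "set (walk_edges q) \<subseteq> D" using walk_edges_run_subset[OF da(1)] by (simp add: q_def)
  have "deg_le_2 n (flip H q)"
    unfolding q_def
  proof (rule run_admissible[OF da(1)])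
    assume start: "dart_edge (it d a) \<in> h" "mate (fst (it d a)) (dart_edge (it d a)) \<notin> h"
    have False
    proof (cases "a = 0")
      case False
      \<comment> \<open>The first kept edge has the dropped edge as its partner, and that edge is
        red, so the shortened run meets the condition at its start.\<close>
      then have "a = Suc 0" "dart_edge d \<in> h" by (auto simp: a_def split: if_splits)
      then show False using mate_fst_it[OF d(1), of 0] start(2) by simp
    qed (use start in \<open>simp add: a_def split: if_splits\<close>)
    then show "mate (fst (it d a)) (dart_edge (it d a)) \<in> set (walk_edges (run (it d a) (b - a)))" ..
  next
    fix l' assume l': "l' = it (it d a) (b - a - 1)" "dart_edge l' \<in> h" "mate (snd l') (dart_edge l') \<notin> h"
    have l'_eq: "l' = it d (b - 1)" using l'(1) ab(4) unfolding it_it by simp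
    have False
    proof (cases "b = L")
      case True
      then have "l' = l" using l'_eq by (simp add: l_def)
      then show False using l'(2,3) True L(1) by (simp add: b_def split: if_splits)
    next
      case False
      then have b: "b = L - 1" "dart_edge l \<in> h" by (auto simp: b_def split: if_splits)
      then have "Suc (b - 1) = L - 1" using L by simp
      then show False using mate_snd_it[OF d(1), of "b - 1"] l'(3) l'_eq b(2) by (simp add: l_def)
    qed
    then show "mate (snd l') (dart_edge l') \<in> set (walk_edges (run (it d a) (b - a)))" ..
  qed (use ab in simp)
  moreover have "q \<in> short_trails n G"
    unfolding q_def by (rule run_short_trails[OF da]) (use ab L in auto)
  ultimately have q: "real (red h q) < real (blue h q) + sqrt (ln (real n))"
    using step_B_stable qD by blast
  let ?P = "set (walk_edges (run d L))" and ?Q = "set (walk_edges q)"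
  have P: "?P = (\<lambda>i. dart_edge (it d i)) ` {..<L}" by (rule set_walk_edges_run[OF d(1)])
  have PQ: "?P \<subseteq> ?Q \<union> {dart_edge d, dart_edge l}"
  proof
    fix e assume "e \<in> ?P"
    then obtain i where i: "i < L" "e = dart_edge (it d i)" unfolding P by auto
    consider "i = 0" | "i = L - 1" | "a \<le> i" "i < b" using i(1) ab by linarith
    then show "e \<in> ?Q \<union> {dart_edge d, dart_edge l}"
      by cases (use i in \<open>auto simp: l_def set_q\<close>)
  qed
  have "?P \<inter> h \<subseteq> (?Q \<inter> h) \<union> {dart_edge d, dart_edge l}" using PQ by auto
  then have "card (?P \<inter> h) \<le> card ((?Q \<inter> h) \<union> {dart_edge d, dart_edge l})"
    by (intro card_mono) auto
  also have "\<dots> \<le> card (?Q \<inter> h) + card {dart_edge d, dart_edge l}" by (rule card_Un_le)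
  also have "card {dart_edge d, dart_edge l} \<le> 2" by (simp add: card_insert_if)
  finally have "red h (run d L) \<le> red h q + 2" by (simp add: red_def)
  moreover have "?Q \<subseteq> ?P" unfolding P set_q using ab by auto
  then have "blue h q \<le> blue h (run d L)" unfolding blue_def by (intro card_mono) auto
  ultimately show ?thesis
    using q run_alternating_trails[OF d] by (simp add: light_trails_def)
qed

text \<open>The first and the last edge of the period are partners of each other, so no edge has to
  be dropped and (A) applies without any slack.\<close>

lemma closed_run_light:
  assumes d: "d \<in> darts" "clean d t" and t: "0 < t" "real t < ln (real n)" "it d t = d"
  shows "run d t \<in> light_trails n V h G t 0"
proof -
  have P: "set (walk_edges (run d t)) = (\<lambda>i. dart_edge (it d i)) ` {..<t}"
    by (rule set_walk_edges_run[OF d(1)])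
  have st: "it d (Suc (t - 1)) = d" using t by (simp del: funpow.simps)
  have "deg_le_2 n (flip H (run d t))"
  proof (rule run_admissible[OF d(1) t(1)])
    have "mate (fst d) (dart_edge d) = dart_edge (it d (t - 1))"
      using mate_fst_it[OF d(1), of "t - 1"] unfolding st .
    then show "mate (fst d) (dart_edge d) \<in> set (walk_edges (run d t))" unfolding P using t(1) by auto
  next
    fix l assume "l = it d (t - 1)"
    then have "mate (snd l) (dart_edge l) = dart_edge (it d 0)"
      using mate_snd_it[OF d(1), of "t - 1"] unfolding st by simp
    then show "mate (snd l) (dart_edge l) \<in> set (walk_edges (run d t))" unfolding P using t(1) by blast
  qed
  then have "red h (run d t) \<le> blue h (run d t)"
    using run_short_trails[OF d t(1,2)] walk_edges_run_subset[OF d(1)] t(3)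
    by (intro step_A_stable) auto
  then show ?thesis using run_alternating_trails[OF d] by (simp add: light_trails_def)
qed

text \<open>Both outer edges are their own partners and both ends have degree 1 in \<open>H\<close>;
  so (A) applies to the run as it is.\<close>

lemma whole_run_light:
  assumes d: "dart_start d" "clean d t" and t: "0 < t" "real t < ln (real n)" "turn d (t - 1)"
  shows "run d t \<in> light_trails n V h G t 0"
proof -
  have dd: "d \<in> darts" using d by (simp add: dart_start_def)
  have P: "set (walk_edges (run d t)) = (\<lambda>i. dart_edge (it d i)) ` {..<t}"
    by (rule set_walk_edges_run[OF dd])
  have "deg_le_2 n (flip H (run d t))"
  proof (rule run_admissible[OF dd t(1)])
    show "mate (fst d) (dart_edge d) \<in> set (walk_edges (run d t))"
      unfolding P dart_start_mate[OF d(1)] using t(1) by (intro image_eqI[where x = 0]) auto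
  next
    fix l assume "l = it d (t - 1)"
    then show "mate (snd l) (dart_edge l) \<in> set (walk_edges (run d t))"
      unfolding P using turn_dart_start(2)[OF dd t(3)] t(1) by auto
  qed
  moreover have "degree H (fst (it d t)) = 1"
    using start_degree[OF turn_dart_start(1)[OF dd t(3)]] t(1) by simp
  ultimately have "red h (run d t) \<le> blue h (run d t)"
    using run_short_trails[OF dd d(2) t(1,2)] walk_edges_run_subset[OF dd] start_degree[OF d(1)]
    by (intro step_A_stable) auto
  then show ?thesis using run_alternating_trails[OF dd d(2)] by (simp add: light_trails_def)
qed

section \<open>Counting darts by the type of their trail\<close>

lemma card_starts: "card {d. dart_start d} \<le> num_deg_1 n H"
  unfolding num_deg_1_def
proof (rule card_inj_on_le[where f = fst])
  show "inj_on fst {d. dart_start d}"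
  proof (rule inj_onI)
    fix a b assume ab: "a \<in> {d. dart_start d}" "b \<in> {d. dart_start d}" "fst a = fst b"
    then have "dart_edge a \<in> D" "dart_edge b \<in> D" "fst a \<in> dart_edge a" "fst a \<in> dart_edge b"
      by (auto simp: dart_start_def darts_def dart_edge_def)
    moreover have "mate (fst a) (dart_edge a) = dart_edge a" "mate (fst a) (dart_edge b) = dart_edge b"
      using ab dart_start_mate[of a] dart_start_mate[of b] by simp_all
    \<comment> \<open>At most one edge at a vertex is its own partner, so a vertex is the end of at
      most one open trail.\<close>
    ultimately have "dart_edge a = dart_edge b" using mate(3) by blast
    then show "a = b" using ab(3) by (rule dart_eqI[rotated])
  qed
  show "fst ` {d. dart_start d} \<subseteq> {v \<in> {1..n}. degree H v = 1}"
  proof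
    fix v assume "v \<in> fst ` {d. dart_start d}"
    then obtain d where d: "dart_start d" "v = fst d" by blast
    then have "dart_edge d \<in> D" using dart_edge_in_D by (simp add: dart_start_def)
    then have "dart_edge d \<in> G" "v \<in> dart_edge d" using D_G d(2) by (auto simp: dart_edge_def)
    then show "v \<in> {v \<in> {1..n}. degree H v = 1}" using edges_n start_degree[OF d(1)] d(2) by auto
  qed
qed simp

lemma card_clean_darts:
  assumes "3 \<le> L" "real L < ln (real n)"
  shows "card {d \<in> darts. clean d L} \<le> card (light_trails n V h G L (sqrt (ln (real n)) + 2))"
proof (rule card_inj_on_le[where f = "\<lambda>d. run d L"])
  show "inj_on (\<lambda>d. run d L) {d \<in> darts. clean d L}"
    using inj_run[of L] assms(1) by (intro inj_onI) auto
qed (use clean_run_light assms finite_light_trails in auto)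

definition closed_darts :: "nat \<Rightarrow> (nat \<times> nat) set" where
  "closed_darts t = {d \<in> darts. it d t = d \<and> clean d t}"

lemma card_closed_darts:
  assumes "0 < t" "real t < ln (real n)"
  shows "card {d \<in> closed_darts t. dart_edge d \<notin> h} \<le> card (light_closed_trails n V h G t)"
proof (rule card_inj_on_le[where f = "\<lambda>d. run d t"])
  show "inj_on (\<lambda>d. run d t) {d \<in> closed_darts t. dart_edge d \<notin> h}"
    using inj_run[OF assms(1)] by (intro inj_onI) (auto simp: closed_darts_def)
  show "(\<lambda>d. run d t) ` {d \<in> closed_darts t. dart_edge d \<notin> h} \<subseteq> light_closed_trails n V h G t"
  proof
    fix p assume "p \<in> (\<lambda>d. run d t) ` {d \<in> closed_darts t. dart_edge d \<notin> h}"
    then obtain d where d: "p = run d t" "d \<in> darts" "it d t = d" "clean d t" "dart_edge d \<notin> h"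
      by (auto simp: closed_darts_def)
    obtain t' where t': "t = Suc t'" using assms(1) gr0_implies_Suc by blast
    have "hd (tl (run d t)) = snd d" using succ_props(2)[OF d(2)] by (simp add: t' run_Suc)
    then have "{hd p, hd (tl p)} = dart_edge d" by (simp add: d(1) dart_edge_def)
    then show "p \<in> light_closed_trails n V h G t"
      using closed_run_light[OF d(2,4) assms d(3)] d by (simp add: light_closed_trails_def)
  qed
qed (rule finite_light_closed_trails)

text \<open>An entirely red closed trail would have more red than blue edges. So there is a blue
  edge on it, and starting the period there reaches d in at most t steps.\<close>

lemma closed_darts_blue:
  assumes "d \<in> closed_darts t" "0 < t" "t < L" "real t < ln (real n)"
  shows "\<exists>b\<in>closed_darts t. dart_edge b \<notin> h \<and> (\<exists>j<L. d = it b j)"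
proof -
  have d: "d \<in> darts" "it d t = d" "clean d t" using assms by (auto simp: closed_darts_def)
  have "\<exists>i<t. dart_edge (it d i) \<notin> h"
  proof (rule ccontr)
    assume no: "\<not> (\<exists>i<t. dart_edge (it d i) \<notin> h)"
    let ?P = "set (walk_edges (run d t))"
    have P: "?P = (\<lambda>i. dart_edge (it d i)) ` {..<t}" by (rule set_walk_edges_run[OF d(1)])
    have "?P \<subseteq> h" using no P by auto
    then have "blue h (run d t) = 0" "red h (run d t) = card ?P"
      by (auto simp: blue_def red_def Int_absorb2 Diff_eq_empty_iff[THEN iffD2])
    moreover have "card ?P > 0" using P assms(2) by (auto simp: card_gt_0_iff)
    ultimately show False
      using closed_run_light[OF d(1,3) assms(2,4) d(2)] by (simp add: light_trails_def)
  qed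
  then obtain i where i: "i < t" "dart_edge (it d i) \<notin> h" by blast
  have "it d i \<in> closed_darts t"
    using closed_shift[OF d(1,3) assms(2) d(2)] it_in_darts[OF d(1)] by (simp add: closed_darts_def)
  moreover have "it (it d i) (t - i) = d" unfolding it_it using i d(2) by simp
  moreover have "t - i < L" using assms(3) by simp
  ultimately show ?thesis using i(2) by metis
qed

text \<open>Every dart on a short closed trail lies fewer than L steps after one on a blue edge of
  the same trail; this costs the factor L.\<close>

lemma card_short_closed_darts:
  assumes "real L < ln (real n)"
  shows "card (\<Union>t\<in>{1..<L}. closed_darts t) \<le> L * (\<Sum>t\<in>{1..<L}. card (light_closed_trails n V h G t))"
proof -
  define B where "B = (\<Union>t\<in>{1..<L}. {d \<in> closed_darts t. dart_edge d \<notin> h})"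
  have finB: "finite B" unfolding B_def closed_darts_def using finite_darts by auto
  have "(\<Union>t\<in>{1..<L}. closed_darts t) \<subseteq> (\<lambda>(b, j). it b j) ` (B \<times> {..<L})"
  proof
    fix d assume "d \<in> (\<Union>t\<in>{1..<L}. closed_darts t)"
    then obtain t where "t \<in> {1..<L}" and t3: "d \<in> closed_darts t" by blast
    then have t: "0 < t" "t < L" "d \<in> closed_darts t" by auto
    then obtain b j where bj: "b \<in> closed_darts t" "dart_edge b \<notin> h" "j < L" "d = it b j"
      using closed_darts_blue[OF t(3,1,2)] assms by auto
    then have "(b, j) \<in> B \<times> {..<L}" unfolding B_def using t by auto
    then show "d \<in> (\<lambda>(b, j). it b j) ` (B \<times> {..<L})" using bj(4) by (intro image_eqI) auto
  qed
  then have "card (\<Union>t\<in>{1..<L}. closed_darts t) \<le> card ((\<lambda>(b, j). it b j) ` (B \<times> {..<L}))"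
    using finB by (intro card_mono) auto
  also have "\<dots> \<le> card (B \<times> {..<L})" using finB by (intro card_image_le) auto
  also have "\<dots> = L * card B" by (simp add: card_cartesian_product)
  also have "card B \<le> (\<Sum>t\<in>{1..<L}. card {d \<in> closed_darts t. dart_edge d \<notin> h})"
    unfolding B_def by (rule card_UN_le) simp
  also have "\<dots> \<le> (\<Sum>t\<in>{1..<L}. card (light_closed_trails n V h G t))"
    by (intro sum_mono card_closed_darts) (use assms in auto)
  finally show ?thesis by simp
qed

definition whole_starts :: "nat \<Rightarrow> (nat \<times> nat) set" where
  "whole_starts t = {d. dart_start d \<and> clean d t \<and> turn d (t - 1)}"

lemma card_whole_starts:
  assumes "0 < t" "real t < ln (real n)"
  shows "card (whole_starts t) \<le> card (light_trails n V h G t 0)"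
proof (rule card_inj_on_le[where f = "\<lambda>d. run d t"])
  show "inj_on (\<lambda>d. run d t) (whole_starts t)"
    using inj_run[OF assms(1)] by (intro inj_onI) (auto simp: whole_starts_def dart_start_def)
  show "(\<lambda>d. run d t) ` whole_starts t \<subseteq> light_trails n V h G t 0"
    using whole_run_light assms by (auto simp: whole_starts_def)
qed (rule finite_light_trails)

text \<open>The darts are reversed because \<open>turning_dart_cases\<close> describes d as running
  towards the end from which e departs.\<close>

definition whole_darts :: "nat \<Rightarrow> (nat \<times> nat) set" where
  "whole_darts t = (\<Union>e\<in>whole_starts t. (\<lambda>j. prod.swap (it e j)) ` {..<t})"

text \<open>Trails of length up to K are counted through their starting vertices, each of which
  accounts for at most K darts; the longer ones are light trails. The threshold K is left free for
  the later optimisation.\<close>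

lemma card_whole_darts_UN:
  assumes "real (2 * L) \<le> ln (real n)"
  shows "card (\<Union>t\<in>{1..<2 * L}. whole_darts t)
    \<le> num_deg_1 n H * K + 2 * L * (\<Sum>t\<in>{K..<2 * L}. card (light_trails n V h G t 0))"
proof -
  define A where "A = (\<lambda>(e, j). prod.swap (it e j)) ` ({d. dart_start d} \<times> {..<K})"
  define B where "B = (\<Union>t\<in>{K..<2 * L} - {0}. (\<lambda>(e, j). prod.swap (it e j)) ` (whole_starts t \<times> {..<2 * L}))"
  have fin1: "finite {d. dart_start d}"
    by (rule finite_subset[OF _ finite_darts]) (auto simp: dart_start_def)
  have fin2: "finite (whole_starts t)" for t
    by (rule finite_subset[OF _ fin1]) (auto simp: whole_starts_def)
  have "(\<Union>t\<in>{1..<2 * L}. whole_darts t) \<subseteq> A \<union> B"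
  proof
    fix d assume "d \<in> (\<Union>t\<in>{1..<2 * L}. whole_darts t)"
    then obtain t e j where d: "0 < t" "t < 2 * L" "e \<in> whole_starts t" "j < t" "d = prod.swap (it e j)"
      by (auto simp: whole_darts_def)
    show "d \<in> A \<union> B"
    proof (cases "t \<le> K")
      case True
      then have "(e, j) \<in> {d. dart_start d} \<times> {..<K}" using d by (auto simp: whole_starts_def)
      then have "d \<in> A" unfolding A_def by (intro image_eqI) (use d(5) in auto)
      then show ?thesis by simp
    next
      case False
      have "(e, j) \<in> whole_starts t \<times> {..<2 * L}" using d by auto
      then have "d \<in> (\<lambda>(e, j). prod.swap (it e j)) ` (whole_starts t \<times> {..<2 * L})"
        by (intro image_eqI) (use d(5) in auto)
      then have "d \<in> B" unfolding B_def using False d by (intro UN_I) auto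
      then show ?thesis by simp
    qed
  qed
  then have "card (\<Union>t\<in>{1..<2 * L}. whole_darts t) \<le> card (A \<union> B)"
    using fin1 fin2 by (intro card_mono) (auto simp: A_def B_def)
  also have "\<dots> \<le> card A + card B" by (rule card_Un_le)
  also have "card A \<le> card ({d. dart_start d} \<times> {..<K})"
    unfolding A_def using fin1 by (intro card_image_le) auto
  also have "\<dots> \<le> num_deg_1 n H * K" using card_starts by (simp add: card_cartesian_product)
  also have "card B \<le> (\<Sum>t\<in>{K..<2 * L} - {0}.
      card ((\<lambda>(e, j). prod.swap (it e j)) ` (whole_starts t \<times> {..<2 * L})))"
    unfolding B_def by (rule card_UN_le) simp
  also have "\<dots> \<le> (\<Sum>t\<in>{K..<2 * L} - {0}. 2 * L * card (light_trails n V h G t 0))"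
  proof (rule sum_mono)
    fix t assume t: "t \<in> {K..<2 * L} - {0}"
    have "card ((\<lambda>(e, j). prod.swap (it e j)) ` (whole_starts t \<times> {..<2 * L}))
        \<le> card (whole_starts t \<times> {..<2 * L})" using fin2 by (intro card_image_le) auto
    also have "\<dots> = 2 * L * card (whole_starts t)" by (simp add: card_cartesian_product)
    also have "card (whole_starts t) \<le> card (light_trails n V h G t 0)"
      by (rule card_whole_starts) (use t assms in auto)
    finally show "card ((\<lambda>(e, j). prod.swap (it e j)) ` (whole_starts t \<times> {..<2 * L}))
        \<le> 2 * L * card (light_trails n V h G t 0)" by simp
  qed
  also have "\<dots> \<le> (\<Sum>t\<in>{K..<2 * L}. 2 * L * card (light_trails n V h G t 0))"
    by (intro sum_mono2) auto
  also have "\<dots> = 2 * L * (\<Sum>t\<in>{K..<2 * L}. card (light_trails n V h G t 0))"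
    by (simp add: sum_distrib_left)
  finally show ?thesis by simp
qed

text \<open>At its first obstruction before L steps a dart closes up or turns; the turning case is
  split further by \<open>turning_dart_cases\<close>.\<close>

lemma darts_cover:
  "darts \<subseteq> {d \<in> darts. clean d L} \<union> prod.swap ` {d \<in> darts. clean d L} \<union>
     (\<Union>t\<in>{1..<L}. closed_darts t) \<union> (\<Union>t\<in>{1..<2 * L}. whole_darts t)"
proof
  fix d assume d: "d \<in> darts"
  show "d \<in> {d \<in> darts. clean d L} \<union> prod.swap ` {d \<in> darts. clean d L} \<union>
     (\<Union>t\<in>{1..<L}. closed_darts t) \<union> (\<Union>t\<in>{1..<2 * L}. whole_darts t)"
  proof (cases "clean d L")
    case False
    then obtain t where t: "0 < t" "t < L" "clean d t" "it d t = d \<or> turn d (t - 1)"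
      using not_clean_least by blast
    from t(4) show ?thesis
    proof
      assume "it d t = d"
      then have "d \<in> closed_darts t" using d t by (simp add: closed_darts_def)
      moreover have "t \<in> {1..<L}" using t by simp
      ultimately show ?thesis by blast
    next
      assume "turn d (t - 1)"
      then show ?thesis
      proof (rule turning_dart_cases[OF d t(3,1) _ less_imp_le[OF t(2)]])
        assume "clean (prod.swap d) L"
        then have "prod.swap (prod.swap d) \<in> prod.swap ` {d \<in> darts. clean d L}"
          using d by (intro imageI) simp
        then show ?thesis by simp
      next
        fix e t' j
        assume "dart_start e" "0 < t'" "t' < 2 * L" "clean e t'" "turn e (t' - 1)" "j < t'"
          "d = prod.swap (it e j)"
        then have "e \<in> whole_starts t'" "d \<in> (\<lambda>j. prod.swap (it e j)) ` {..<t'}" "t' \<in> {1..<2 * L}"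
          by (auto simp: whole_starts_def)
        then have "d \<in> whole_darts t'" "t' \<in> {1..<2 * L}" unfolding whole_darts_def by blast+
        then show ?thesis by blast
      qed
    qed
  qed (use d in blast)
qed

lemma card_D_le:
  assumes "3 \<le> L" "real (2 * L) \<le> ln (real n)"
  shows "card D \<le> 2 * card (light_trails n V h G L (sqrt (ln (real n)) + 2))
    + L * (\<Sum>t\<in>{1..<L}. card (light_closed_trails n V h G t))
    + num_deg_1 n H * K + 2 * L * (\<Sum>t\<in>{K..<2 * L}. card (light_trails n V h G t 0))"
proof -
  let ?A = "{d \<in> darts. clean d L}"
  let ?C = "\<Union>t\<in>{1..<L}. closed_darts t" and ?W = "\<Union>t\<in>{1..<2 * L}. whole_darts t"
  have L: "real L < ln (real n)" using assms by linarith
  have fin: "finite ?A" "finite ?C" using finite_darts by (auto simp: closed_darts_def)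
  have finS: "finite {d. dart_start d}"
    by (rule finite_subset[OF _ finite_darts]) (auto simp: dart_start_def)
  have finW: "finite ?W" unfolding whole_darts_def
    by (intro finite_UN_I finite_imageI finite_subset[OF _ finS]) (auto simp: whole_starts_def)
  have "card D \<le> card darts" by (rule card_D_le_darts)
  also have "\<dots> \<le> card (?A \<union> prod.swap ` ?A \<union> ?C \<union> ?W)"
    by (rule card_mono[OF _ darts_cover]) (use fin finW in auto)
  also have "\<dots> \<le> card ?A + card (prod.swap ` ?A) + card ?C + card ?W"
    by (meson add_mono card_Un_le le_trans order_refl)
  also have "card (prod.swap ` ?A) \<le> card ?A" by (rule card_image_le[OF fin(1)])
  finally have "card D \<le> 2 * card ?A + card ?C + card ?W" by linarith
  then show ?thesis
    using card_clean_darts[OF assms(1) L] card_short_closed_darts[OF L]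
      card_whole_darts_UN[OF assms(2), of K] by linarith
qed

end

lemma (in planted_recovery) ex_mate:
  "\<exists>mate. mated_recovery n V h G H mate"
proof -
  let ?P = "\<lambda>v \<mu>. (\<forall>e\<in>{e \<in> D. v \<in> e}. \<mu> e \<in> {e \<in> D. v \<in> e} \<and> \<mu> (\<mu> e) = e) \<and>
    (\<forall>e\<in>{e \<in> D. v \<in> e}. \<mu> e = e \<longrightarrow> degree H v = 1) \<and>
    (\<forall>e\<in>{e \<in> D. v \<in> e}. \<forall>e'\<in>{e \<in> D. v \<in> e}. \<mu> e = e \<longrightarrow> \<mu> e' = e' \<longrightarrow> e = e') \<and>
    (v \<in> V \<longrightarrow> (\<forall>e\<in>{e \<in> D. v \<in> e}. e \<notin> h \<longrightarrow> \<mu> e \<in> h)) \<and>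
    degree H v + card {e \<in> D. v \<in> e \<and> e \<in> h \<and> \<mu> e \<in> h} \<le> 2"
  have "\<forall>v\<in>{1..n}. \<exists>\<mu>. ?P v \<mu>" by (intro ballI ex_mate_at)
  from bchoice[OF this] obtain mate where "\<forall>v\<in>{1..n}. ?P v (mate v)" by (elim exE)
  note mate = bspec[OF this]
  have v: "v \<in> {1..n}" if "v \<in> e" "e \<in> D" for v e
    using that edges_n hG HG by blast
  have "mated_recovery n V h G H mate"
  proof unfold_locales
    fix v e assume ve: "v \<in> e" "e \<in> D"
    note m = mate[OF v[OF ve]]
    have e: "e \<in> {e \<in> D. v \<in> e}" using ve by blast
    show "mate v e \<in> D \<and> v \<in> mate v e \<and> mate v (mate v e) = e"
      using m[THEN conjunct1, THEN bspec, OF e] by simp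
    show "degree H v = 1" if "mate v e = e"
      using m[THEN conjunct2, THEN conjunct1, THEN bspec, OF e] that by (rule mp)
    show "mate v e \<in> h" if "v \<in> V" "e \<notin> h"
      using m[THEN conjunct2, THEN conjunct2, THEN conjunct2, THEN conjunct1, rule_format, OF that(1) e that(2)] .
    fix e' assume "v \<in> e'" "e' \<in> D"
    then have e': "e' \<in> {e \<in> D. v \<in> e}" by blast
    show "e = e'" if "mate v e = e" "mate v e' = e'"
      using m[THEN conjunct2, THEN conjunct2, THEN conjunct1, THEN bspec, OF e, THEN bspec, OF e', rule_format, OF that] .
  next
    fix v assume "v \<in> {1..n}"
    from mate[OF this] show "degree H v + card {e \<in> D. v \<in> e \<and> e \<in> h \<and> mate v e \<in> h} \<le> 2"
      by (elim conjE)
  qed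
  then show ?thesis by blast
qed

text \<open>A deterministic bound, valid for every graph and every run of the algorithm, in which
  only trail counts remain random. The summand with K bounds the degree-1 vertices by
  \<open>greedy_inv\<close> and \<open>card H \<le> n\<close>.\<close>

lemma card_recovery_error_le:
  assumes G: "G \<subseteq> all_edges_on n" and out: "greedy_output n G H"
    and h: "h \<subseteq> G" "\<And>v. degree h v = (if v \<in> V then 2 else 0)"
    and L: "3 \<le> L" "real (2 * L) \<le> ln (real n)"
  shows "real (card (H \<triangle> h)) \<le> 2 * real (card (light_trails n V h G L (sqrt (ln (real n)) + 2)))
    + real L * (\<Sum>t\<in>{1..<L}. real (card (light_closed_trails n V h G t)))
    + real K * (2 * real n / sqrt (ln (real n)))
    + 2 * real L * (\<Sum>t\<in>{K..<2 * L}. real (card (light_trails n V h G t 0)))"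
proof -
  note inv = greedy_output_inv[OF out G]
  have H: "H \<subseteq> G" "deg_le_2 n H" "real (num_deg_1 n H) * sqrt (ln (real n)) \<le> 2 * real (card H)"
    using inv(1) by (auto simp: greedy_inv_def)
  interpret planted_recovery n V h G H by unfold_locales (use G h H in auto)
  obtain mate where "mated_recovery n V h G H mate" using ex_mate by blast
  then interpret mated_recovery n V h G H mate .
  interpret stable_recovery n V h G H mate by unfold_locales (rule inv(2))
  have "card H \<le> n" by (rule card_le_of_deg_le_2) (use H G in auto)
  moreover have "0 < sqrt (ln (real n))" using L by simp
  ultimately have "real (num_deg_1 n H) \<le> 2 * real n / sqrt (ln (real n))"
    using H(3) by (simp add: field_simps)
  then have "real K * real (num_deg_1 n H) \<le> real K * (2 * real n / sqrt (ln (real n)))"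
    by (rule mult_left_mono) simp
  moreover have "real (card D) \<le> real (2 * card (light_trails n V h G L (sqrt (ln (real n)) + 2))
    + L * (\<Sum>t\<in>{1..<L}. card (light_closed_trails n V h G t))
    + num_deg_1 n H * K + 2 * L * (\<Sum>t\<in>{K..<2 * L}. card (light_trails n V h G t 0)))"
    using card_D_le[OF L, of K] by (rule of_nat_mono)
  ultimately show ?thesis by (simp add: mult.commute)
qed


section \<open>The planted model\<close>

text \<open>Length at least 3 makes the two cyclic neighbours of a position different from it and
  from each other. The predecessor is written \<open>(i + ?l - 1) mod ?l\<close> because subtraction
  on naturals truncates at i = 0.\<close>

lemma cycle_edges_at:
  assumes "distinct c" "3 \<le> length c" "i < length c"
  shows "card {e \<in> cycle_edges c. c ! i \<in> e} = 2"
proof -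
  let ?l = "length c"
  let ?p = "(i + ?l - 1) mod ?l" and ?s = "(i + 1) mod ?l"
  have eq: "{e \<in> cycle_edges c. c ! i \<in> e} = {{c ! i, c ! ?s}, {c ! ?p, c ! i}}"
  proof (intro equalityI subsetI)
    fix e assume "e \<in> {e \<in> cycle_edges c. c ! i \<in> e}"
    then obtain j where j: "j < ?l" "e = {c ! j, c ! ((j + 1) mod ?l)}" "c ! i \<in> e"
      by (auto simp: cycle_edges_def)
    have l: "(j + 1) mod ?l < ?l" using assms by (intro mod_less_divisor) linarith
    then have "i = j \<or> i = (j + 1) mod ?l"
      using j assms nth_eq_iff_index_eq[OF assms(1)] by auto
    then show "e \<in> {{c ! i, c ! ?s}, {c ! ?p, c ! i}}"
    proof
      assume i: "i = (j + 1) mod ?l"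
      have "?p = j"
      proof (cases "j + 1 = ?l")
        case True
        then show ?thesis using i by simp
      next
        case False
        then have "i = j + 1" using i j(1) by simp
        then show ?thesis using j(1) by simp
      qed
      then show ?thesis using j(2) i by simp
    qed (use j(2) in simp)
  next
    fix e assume e: "e \<in> {{c ! i, c ! ?s}, {c ! ?p, c ! i}}"
    have pl: "?p < ?l" using assms by (intro mod_less_divisor) linarith
    have "(?p + 1) mod ?l = i"
    proof (cases i)
      case (Suc i')
      then have "i + ?l - 1 = i' + ?l" by simp
      then show ?thesis using Suc assms(3) by simp
    qed (use assms in simp)
    then have "{c ! ?p, c ! i} \<in> cycle_edges c" unfolding cycle_edges_def using pl by force
    moreover have "{c ! i, c ! ?s} \<in> cycle_edges c" unfolding cycle_edges_def using assms(3) by auto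
    ultimately show "e \<in> {e \<in> cycle_edges c. c ! i \<in> e}" using e by auto
  qed
  have "?p < ?l" "?s < ?l" using assms by (auto intro!: mod_less_divisor)
  moreover have "?p \<noteq> i" "?s \<noteq> i" "?p \<noteq> ?s"
  proof -
    have s: "?s = (if i + 1 = ?l then 0 else i + 1)" using assms(3) by auto
    have p: "?p = (if i = 0 then ?l - 1 else i - 1)"
    proof (cases i)
      case (Suc i')
      then have "i + ?l - 1 = i' + ?l" by simp
      then show ?thesis using Suc assms(3) by simp
    qed (use assms in simp)
    show "?p \<noteq> i" "?s \<noteq> i" "?p \<noteq> ?s" unfolding s p using assms by auto
  qed
  ultimately have "c ! ?p \<noteq> c ! i" "c ! ?s \<noteq> c ! i" "c ! ?p \<noteq> c ! ?s"
    using assms by (simp_all add: nth_eq_iff_index_eq)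
  then have "{c ! i, c ! ?s} \<noteq> {c ! ?p, c ! i}" by (auto simp: doubleton_eq_iff)
  then show ?thesis unfolding eq by simp
qed

lemma cycle_edges_subset: "e \<in> cycle_edges c \<Longrightarrow> e \<subseteq> set c"
  unfolding cycle_edges_def by (auto intro!: nth_mem mod_less_divisor)

lemma card_cycle_edge:
  assumes "distinct c" "3 \<le> length c" "e \<in> cycle_edges c"
  shows "card e = 2"
proof -
  obtain i where i: "i < length c" "e = {c ! i, c ! ((i + 1) mod length c)}"
    using assms(3) by (auto simp: cycle_edges_def)
  have "(i + 1) mod length c \<noteq> i"
  proof (cases "i + 1 = length c")
    case False
    then show ?thesis using i(1) by simp
  qed (use assms in auto)
  moreover have "(i + 1) mod length c < length c" using assms by (intro mod_less_divisor) linarith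
  ultimately have "c ! i \<noteq> c ! ((i + 1) mod length c)"
    using assms(1) i(1) by (simp add: nth_eq_iff_index_eq)
  then show ?thesis using i(2) by simp
qed

lemma two_factors_props:
  assumes "h \<in> two_factors V" "V \<subseteq> {1..n}"
  shows "h \<subseteq> all_edges_on n" "degree h v = (if v \<in> V then 2 else 0)" "card h = card V"
proof -
  obtain cs where cs: "h = \<Union> (cycle_edges ` set cs)" "\<forall>c\<in>set cs. 3 \<le> length c"
     "distinct (concat cs)" "set (concat cs) = V" using assms(1) by (auto simp: two_factors_def)
  have dist: "distinct c" if "c \<in> set cs" for c using cs(3) that by (auto simp: distinct_concat_iff)
  have sub: "e \<subseteq> V" if "e \<in> h" for e
    using that cs(1,4) cycle_edges_subset by fastforce
  show he: "h \<subseteq> all_edges_on n"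
  proof
    fix e assume "e \<in> h"
    then have "card e = 2" using cs(1,2) dist card_cycle_edge by blast
    then show "e \<in> all_edges_on n" using sub[OF \<open>e \<in> h\<close>] assms(2) by (auto simp: all_edges_on_def)
  qed
  show deg: "degree h v = (if v \<in> V then 2 else 0)" for v
  proof (cases "v \<in> V")
    case True
    then obtain c where c: "c \<in> set cs" "v \<in> set c" using cs(4) by auto
    then obtain i where i: "i < length c" "v = c ! i" by (auto simp: in_set_conv_nth)
    have "{e \<in> h. v \<in> e} = {e \<in> cycle_edges c. v \<in> e}"
    proof (intro equalityI subsetI)
      fix e assume e: "e \<in> {e \<in> h. v \<in> e}"
      then obtain c' where c': "c' \<in> set cs" "e \<in> cycle_edges c'" using cs(1) by auto
      then have "v \<in> set c'" using e cycle_edges_subset by blast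
      have "c' = c"
      proof (rule ccontr)
        assume "c' \<noteq> c"
        then have "set c' \<inter> set c = {}" using cs(3) c'(1) c(1) by (simp add: distinct_concat_iff)
        then show False using \<open>v \<in> set c'\<close> c(2) by blast
      qed
      then show "e \<in> {e \<in> cycle_edges c. v \<in> e}" using c' e by blast
    qed (use cs(1) c in blast)
    then have "degree h v = card {e \<in> cycle_edges c. c ! i \<in> e}" by (simp add: degree_def i(2))
    then show ?thesis using cycle_edges_at[OF dist[OF c(1)] _ i(1)] cs(2) c(1) True by simp
  next
    case False
    then have "{e \<in> h. v \<in> e} = {}" using sub by blast
    then have "degree h v = 0" unfolding degree_def by (simp only: card.empty)
    then show ?thesis using False by simp
  qed
  \<comment> \<open>Handshaking: a graph that is 2-regular on V has as many edges as V has
    vertices.\<close>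
  have "2 * card h = (\<Sum>v\<in>{1..n}. if v \<in> V then 2 else 0)" using sum_degree[OF he] deg by simp
  also have "\<dots> = 2 * card V" using assms(2) by (simp add: sum.If_cases Int_absorb1)
  finally show "card h = card V" by simp
qed

lemma planted_two_factorsE:
  assumes "h \<in> planted_two_factors n \<delta>"
  obtains V where "V \<subseteq> {1..n}" "card V = nat \<lfloor>\<delta> * real n\<rfloor>" "h \<in> two_factors V"
  using assms by (auto simp: planted_two_factors_def planted_vertex_sets_def)

lemma finite_planted_vertex_sets: "finite (planted_vertex_sets n \<delta>)"
  by (rule finite_subset[of _ "Pow {1..n}"]) (auto simp: planted_vertex_sets_def)

lemma finite_two_factors: "finite V \<Longrightarrow> finite (two_factors V)"
proof (rule finite_subset)
  show "two_factors V \<subseteq> Pow (Pow V)"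
    using cycle_edges_subset by (fastforce simp: two_factors_def)
qed simp

lemma two_factors_nonempty:
  assumes "finite V" "3 \<le> card V"
  shows "two_factors V \<noteq> {}"
proof -
  obtain c where c: "set c = V" "distinct c" using finite_distinct_list[OF assms(1)] by blast
  then have "length c = card V" using distinct_card by metis
  then have "\<Union> (cycle_edges ` set [c]) \<in> two_factors V"
    unfolding two_factors_def using c assms by (intro CollectI exI[of _ "[c]"]) auto
  then show ?thesis by blast
qed

section \<open>Conditioning on the planted 2-factor\<close>

definition planted_law :: "nat \<Rightarrow> real \<Rightarrow> graph pmf" where
  "planted_law n \<delta> =
     bind_pmf (pmf_of_set (planted_vertex_sets n \<delta>)) (\<lambda>V. pmf_of_set (two_factors V))"

definition with_planted :: "nat \<Rightarrow> real \<Rightarrow> graph \<Rightarrow> (graph \<times> graph) pmf" where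
  "with_planted n lam h = map_pmf (\<lambda>G0. (h, G0 \<union> h)) (erdos_renyi n (lam / real n))"

lemma planted_cycles_conv: "planted_cycles n lam \<delta> = bind_pmf (planted_law n \<delta>) (with_planted n lam)"
proof -
  have "planted_cycles n lam \<delta> = bind_pmf (erdos_renyi n (lam / real n)) (\<lambda>G0.
     bind_pmf (planted_law n \<delta>) (\<lambda>H. return_pmf (H, G0 \<union> H)))"
    by (simp add: planted_cycles_def planted_law_def bind_assoc_pmf)
  also have "\<dots> = bind_pmf (planted_law n \<delta>) (\<lambda>H.
      bind_pmf (erdos_renyi n (lam / real n)) (\<lambda>G0. return_pmf (H, G0 \<union> H)))"
    by (rule bind_commute_pmf)
  finally show ?thesis by (simp add: with_planted_def[abs_def] map_pmf_def)
qed

lemma set_planted_law: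
  assumes "h \<in> planted_two_factors n \<delta>"
  shows "h \<in> set_pmf (planted_law n \<delta>)"
proof -
  obtain V where V: "V \<in> planted_vertex_sets n \<delta>" "h \<in> two_factors V"
    using assms by (auto simp: planted_two_factors_def)
  have "finite V" using V(1) by (auto simp: planted_vertex_sets_def intro: finite_subset)
  then have "h \<in> set_pmf (pmf_of_set (two_factors V))"
    using V finite_two_factors[of V] by (subst set_pmf_of_set) auto
  moreover have "V \<in> set_pmf (pmf_of_set (planted_vertex_sets n \<delta>))"
    using V finite_planted_vertex_sets by (subst set_pmf_of_set) auto
  ultimately show ?thesis by (auto simp: planted_law_def)
qed

text \<open>Each \<open>M y\<close> carries y as a tag, so the conditioning event has mass
  \<open>pmf Q x\<close> and receives contributions from the fibre over x alone.\<close>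

lemma cond_pmf_bind_tagged:
  assumes "x \<in> set_pmf Q" "\<And>y. set_pmf (M y) \<subseteq> {\<omega>. fst \<omega> = y}"
  shows "cond_pmf (bind_pmf Q M) {\<omega>. fst \<omega> = x} = M x"
proof -
  let ?p = "bind_pmf Q M"
  have "map_pmf fst (M y) = map_pmf (\<lambda>_. y) (M y)" for y
    by (rule map_pmf_cong) (use assms(2) in auto)
  then have "map_pmf fst ?p = Q" by (simp add: map_bind_pmf bind_return_pmf')
  then have prob: "measure_pmf.prob ?p {\<omega>. fst \<omega> = x} = pmf Q x"
    using measure_map_pmf[of fst ?p "{x}"] by (simp add: vimage_def measure_pmf_single)
  have pos: "pmf Q x > 0" using assms(1) by (simp add: pmf_positive)
  have ne: "set_pmf ?p \<inter> {\<omega>. fst \<omega> = x} \<noteq> {}"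
  proof -
    obtain w where "w \<in> set_pmf (M x)" using set_pmf_not_empty[of "M x"] by auto
    then show ?thesis using assms by (auto simp: set_bind_pmf)
  qed
  show ?thesis
  proof (rule pmf_eqI)
    fix w
    show "pmf (cond_pmf ?p {\<omega>. fst \<omega> = x}) w = pmf (M x) w"
    proof (cases "fst w = x")
      case True
      have M: "pmf (M y) w = indicator {x} y * pmf (M x) w" for y
        using assms(2)[of y] True by (cases "y = x") (auto simp: indicator_def pmf_eq_0_set_pmf)
      have "pmf ?p w = (\<integral>y. indicator {x} y * pmf (M x) w \<partial>measure_pmf Q)"
        unfolding pmf_bind by (intro Bochner_Integration.integral_cong refl M)
      also have "\<dots> = pmf Q x * pmf (M x) w" by (simp add: measure_pmf_single)
      finally show ?thesis using True pos by (subst pmf_cond[OF ne]) (simp add: prob)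
    next
      case False
      then have "w \<notin> set_pmf (M x)" using assms(2) by auto
      then show ?thesis using False by (subst pmf_cond[OF ne]) (simp add: pmf_eq_0_set_pmf)
    qed
  qed
qed

lemma planted_cycles_given_conv:
  assumes "h \<in> planted_two_factors n \<delta>"
  shows "planted_cycles_given n lam \<delta> h = with_planted n lam h"
  unfolding planted_cycles_given_def planted_cycles_conv
  by (rule cond_pmf_bind_tagged[OF set_planted_law[OF assms]]) (auto simp: with_planted_def)

section \<open>First moments in the random graph\<close>

lemma set_erdos_renyi: "set_pmf (erdos_renyi n p) \<subseteq> {G. G \<subseteq> all_edges_on n}"
  by (auto simp: erdos_renyi_def)

lemma finite_set_erdos_renyi: "finite (set_pmf (erdos_renyi n p))"
  by (rule finite_subset[OF set_erdos_renyi]) (use finite_all_edges_on in \<open>simp add: Pow_def[symmetric]\<close>)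

text \<open>Independence gives equality for sets of possible edges; any other B is never contained
  in the graph, which is why only an inequality is claimed.\<close>

lemma prob_erdos_renyi_superset_le:
  assumes "0 \<le> p" "p \<le> 1" "finite B"
  shows "measure_pmf.prob (erdos_renyi n p) {G. B \<subseteq> G} \<le> p ^ card B"
proof (cases "B \<subseteq> all_edges_on n")
  case True
  let ?A = "all_edges_on n" and ?S = "\<lambda>e. if e \<in> B then {True} else UNIV"
  have "measure_pmf.prob (erdos_renyi n p) {G. B \<subseteq> G}
      = measure_pmf.prob (Pi_pmf ?A False (\<lambda>_. bernoulli_pmf p)) {f. B \<subseteq> {e \<in> ?A. f e}}"
    by (simp add: erdos_renyi_def vimage_def)
  also have "{f. B \<subseteq> {e \<in> ?A. f e}} = Pi ?A ?S" using True by (auto simp: Pi_def)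
  also have "measure_pmf.prob (Pi_pmf ?A False (\<lambda>_. bernoulli_pmf p)) (Pi ?A ?S)
      = (\<Prod>e\<in>?A. measure_pmf.prob (bernoulli_pmf p) (?S e))"
    by (rule measure_Pi_pmf_Pi) (rule finite_all_edges_on)
  also have "\<dots> = (\<Prod>e\<in>?A. if e \<in> B then p else 1)"
    using assms by (intro prod.cong) (auto simp: measure_pmf_single)
  also have "\<dots> = p ^ card B"
    using True finite_all_edges_on[of n] by (simp add: prod.If_cases Int_absorb1)
  finally show ?thesis by simp
next
  case False
  then have "{G. B \<subseteq> G} \<inter> set_pmf (erdos_renyi n p) = {}" using set_erdos_renyi by blast
  then have "measure_pmf.prob (erdos_renyi n p) {G. B \<subseteq> G} = 0"
    by (simp add: measure_pmf_zero_iff Int_commute)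
  then show ?thesis using assms by simp
qed

text \<open>Red edges are present for certain, so a trail pays the probability c for its blue edges
  only.\<close>

lemma expected_card_walks_le:
  assumes "0 \<le> c" "c \<le> 1" "finite P"
  shows "measure_pmf.expectation (erdos_renyi n c)
      (\<lambda>G0. real (card {p \<in> P. set (walk_edges p) \<subseteq> G0 \<union> h})) \<le> (\<Sum>p\<in>P. c ^ blue h p)"
proof -
  have "real (card {p \<in> P. set (walk_edges p) \<subseteq> G0 \<union> h})
      = (\<Sum>p\<in>P. indicator {G0. set (walk_edges p) - h \<subseteq> G0} G0)" for G0
  proof -
    have "(\<Sum>p\<in>P. indicator {G0. set (walk_edges p) - h \<subseteq> G0} G0)
        = (\<Sum>p\<in>P. if set (walk_edges p) \<subseteq> G0 \<union> h then 1 else 0::real)"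
      by (intro sum.cong) (auto simp: indicator_def)
    then show ?thesis using assms(3) by (simp add: sum.If_cases Int_def)
  qed
  then have "measure_pmf.expectation (erdos_renyi n c)
      (\<lambda>G0. real (card {p \<in> P. set (walk_edges p) \<subseteq> G0 \<union> h}))
    = (\<Sum>p\<in>P. measure_pmf.prob (erdos_renyi n c) {G0. set (walk_edges p) - h \<subseteq> G0})"
    by (simp add: Bochner_Integration.integral_sum measure_pmf.emeasure_eq_measure)
  also have "\<dots> \<le> (\<Sum>p\<in>P. c ^ blue h p)"
    unfolding blue_def by (intro sum_mono prob_erdos_renyi_superset_le assms) simp
  finally show ?thesis .
qed


section \<open>Counting light trails\<close>

definition walk_weight :: "graph \<Rightarrow> real \<Rightarrow> real \<Rightarrow> nat list \<Rightarrow> real" where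
  "walk_weight h r b p = (\<Prod>e\<leftarrow>walk_edges p. if e \<in> h then r else b)"

lemma walk_weight_Cons:
  "p \<noteq> [] \<Longrightarrow> walk_weight h r b (x # p) = (if {x, hd p} \<in> h then r else b) * walk_weight h r b p"
  by (simp add: walk_weight_def walk_edges_Cons)

lemma walk_weight_singleton: "walk_weight h r b [x] = 1"
  by (simp add: walk_weight_def)

lemma walk_weight_nonneg: "0 \<le> r \<Longrightarrow> 0 \<le> b \<Longrightarrow> 0 \<le> walk_weight h r b p"
  by (auto simp: walk_weight_def intro!: prod_list_nonneg)

lemma walk_weight_eq:
  assumes "distinct (walk_edges p)"
  shows "walk_weight h r b p = r ^ red h p * b ^ blue h p"
proof -
  have "walk_weight h r b p = (\<Prod>e\<in>set (walk_edges p). if e \<in> h then r else b)"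
    unfolding walk_weight_def using assms by (simp add: prod.distinct_set_conv_list)
  also have "\<dots> = (\<Prod>e\<in>set (walk_edges p) \<inter> h. r) * (\<Prod>e\<in>set (walk_edges p) - h. b)"
    by (subst prod.If_cases) (simp_all add: Diff_eq)
  finally show ?thesis by (simp add: red_def blue_def)
qed

lemma sum_Cons_le:
  fixes f :: "'a list \<Rightarrow> real"
  assumes "finite A" "\<And>p. finite (X p)" "B \<subseteq> {x # p |x p. p \<in> A \<and> x \<in> X p}" "\<And>p. 0 \<le> f p"
  shows "(\<Sum>p\<in>B. f p) \<le> (\<Sum>p\<in>A. \<Sum>x\<in>X p. f (x # p))"
proof -
  have fin: "finite (SIGMA p:A. X p)" using assms by auto
  have "B \<subseteq> (\<lambda>(p, x). x # p) ` (SIGMA p:A. X p)" using assms(3) by force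
  then have "(\<Sum>p\<in>B. f p) \<le> (\<Sum>p\<in>(\<lambda>(p, x). x # p) ` (SIGMA p:A. X p). f p)"
    using fin assms(4) by (intro sum_mono2) auto
  also have "\<dots> = (\<Sum>(p, x)\<in>(SIGMA p:A. X p). f (x # p))"
    by (subst sum.reindex) (auto simp: inj_on_def case_prod_beta)
  also have "\<dots> = (\<Sum>p\<in>A. \<Sum>x\<in>X p. f (x # p))" using assms by (subst sum.Sigma) auto
  finally show ?thesis .
qed

text \<open>The common form of both first moment estimates: for the running time f is a bare weight
  and \<rho> is 2 + lam, for the light trails f is a weight times a potential and \<rho> is below
  1.\<close>

lemma sum_walks_le:
  fixes f :: "'a list \<Rightarrow> real"
  assumes "\<And>k. finite (A k)" "\<And>p. finite (X p)"
    and "\<And>k. A (Suc k) \<subseteq> {x # p |x p. p \<in> A k \<and> x \<in> X p}"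
    and "\<And>p. 0 \<le> f p" "0 \<le> \<rho>"
    and "\<And>k p. p \<in> A k \<Longrightarrow> (\<Sum>x\<in>X p. f (x # p)) \<le> \<rho> * f p"
  shows "(\<Sum>p\<in>A k. f p) \<le> \<rho> ^ k * (\<Sum>p\<in>A 0. f p)"
proof (induction k)
  case (Suc k)
  have "(\<Sum>p\<in>A (Suc k). f p) \<le> (\<Sum>p\<in>A k. \<Sum>x\<in>X p. f (x # p))"
    by (rule sum_Cons_le) (use assms in auto)
  also have "\<dots> \<le> (\<Sum>p\<in>A k. \<rho> * f p)" by (rule sum_mono) (rule assms(6))
  also have "\<dots> = \<rho> * (\<Sum>p\<in>A k. f p)" by (simp add: sum_distrib_left)
  also have "\<dots> \<le> \<rho> * (\<rho> ^ k * (\<Sum>p\<in>A 0. f p))" by (rule mult_left_mono[OF Suc assms(5)])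
  finally show ?case by simp
qed simp

text \<open>Candidates chosen without reference to the random graph, as a first moment requires.
  Degenerate steps \<open>{x, x}\<close> are not excluded; they only enlarge the sums.\<close>

definition walks :: "nat \<Rightarrow> nat \<Rightarrow> nat list set" where
  "walks n k = {p. length p = Suc k \<and> set p \<subseteq> {1..n} \<and> distinct (walk_edges p)}"

lemma finite_walks: "finite (walks n k)"
  by (rule finite_subset[OF _ finite_lists_length_eq[of "{1..n}" "Suc k"]]) (auto simp: walks_def)

lemma walks_0: "walks n 0 = (\<lambda>v. [v]) ` {1..n}"
  by (auto simp: walks_def length_Suc_conv)

lemma walks_SucE:
  assumes "p \<in> walks n (Suc k)"
  obtains x q where "p = x # q" "x \<in> {1..n}" "q \<in> walks n k" "q \<noteq> []" "{x, hd q} \<notin> set (walk_edges q)"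
proof -
  from assms obtain x q where p: "p = x # q" by (cases p) (auto simp: walks_def)
  with assms have "q \<noteq> []" by (auto simp: walks_def)
  then show ?thesis using that[OF p] assms by (auto simp: walks_def p walk_edges_Cons)
qed

lemma card_nbrs_le:
  assumes "finite h"
  shows "card {x. {x, y} \<in> h} \<le> degree h y"
  unfolding degree_def
  by (rule card_inj_on_le[where f = "\<lambda>x. {x, y}"])
    (use assms in \<open>auto simp: inj_on_def doubleton_eq_iff\<close>)

lemma finite_nbrs: "finite h \<Longrightarrow> finite {x. {x, y} \<in> h}"
  using finite_vimageI[of h "\<lambda>x. {x, y}"] by (simp add: vimage_def inj_on_def doubleton_eq_iff)

lemma card_other_nbrs_le:
  assumes "finite h" "e \<in> h" "y \<in> e"
  shows "card {x. {x, y} \<in> h \<and> {x, y} \<noteq> e} \<le> degree h y - 1"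
proof -
  have "card {x. {x, y} \<in> h \<and> {x, y} \<noteq> e} \<le> card ({e' \<in> h. y \<in> e'} - {e})"
    by (rule card_inj_on_le[where f = "\<lambda>x. {x, y}"])
      (use assms in \<open>auto simp: inj_on_def doubleton_eq_iff\<close>)
  also have "\<dots> = degree h y - 1"
    unfolding degree_def using assms by (subst card_Diff_singleton) auto
  finally show ?thesis .
qed

lemma sum_walks_weight_le:
  assumes "finite h" "\<And>v. degree h v \<le> 2" "0 \<le> c"
  shows "(\<Sum>p\<in>walks n k. c ^ blue h p) \<le> real n * (2 + real n * c) ^ k"
proof -
  let ?f = "walk_weight h 1 c"
  have "(\<Sum>p\<in>walks n k. c ^ blue h p) = (\<Sum>p\<in>walks n k. ?f p)"
    by (intro sum.cong) (auto simp: walk_weight_eq walks_def)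
  also have "\<dots> \<le> (2 + real n * c) ^ k * (\<Sum>p\<in>walks n 0. ?f p)"
  proof (rule sum_walks_le[where X = "\<lambda>_. {1..n}"])
    show "walks n (Suc k) \<subseteq> {x # p |x p. p \<in> walks n k \<and> x \<in> {1..n}}" for k
      by (auto elim!: walks_SucE)
    show "0 \<le> ?f p" for p using assms by (simp add: walk_weight_nonneg)
    fix k p assume "p \<in> walks n k"
    then have p: "p \<noteq> []" by (auto simp: walks_def)
    have "(\<Sum>x\<in>{1..n}. ?f (x # p)) = (\<Sum>x\<in>{1..n}. if {x, hd p} \<in> h then 1 else c) * ?f p"
      by (simp add: walk_weight_Cons[OF p] sum_distrib_right)
    also have "(\<Sum>x\<in>{1..n}. if {x, hd p} \<in> h then 1 else c)
        \<le> (\<Sum>x\<in>{1..n}. (if {x, hd p} \<in> h then 1 else 0) + c)"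
      using assms by (intro sum_mono) auto
    also have "\<dots> = real (card ({1..n} \<inter> {x. {x, hd p} \<in> h})) + real n * c"
      by (simp add: sum.distrib sum.If_cases)
    also have "card ({1..n} \<inter> {x. {x, hd p} \<in> h}) \<le> card {x. {x, hd p} \<in> h}"
      by (intro card_mono finite_nbrs assms) auto
    also have "\<dots> \<le> 2" using card_nbrs_le[OF assms(1)] assms(2) le_trans by blast
    finally show "(\<Sum>x\<in>{1..n}. ?f (x # p)) \<le> (2 + real n * c) * ?f p"
      using assms by (simp add: mult_right_mono walk_weight_nonneg)
  qed (use assms finite_walks in auto)
  also have "(\<Sum>p\<in>walks n 0. ?f p) = real n"
    unfolding walks_0 by (subst sum.reindex) (auto simp: inj_on_def walk_weight_singleton)
  finally show ?thesis by (simp add: mult.commute)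
qed

text \<open>A trail with \<open>r\<close> red and \<open>b\<close> blue edges gets the weight \<open>z\<^sup>r (c/z)\<^sup>b\<close>, so
  that the light trails are those of weight about \<open>c\<^sup>b\<close> or more.  The potential is the
  positive eigenvector of the transfer matrix on the three possible ends of a trail: a red edge, a
  blue edge at a planted vertex (to be followed by one of two red edges), and a blue edge at a
  vertex off the planted cycles.  Its eigenvalue is below 1 for a suitable \<open>z\<close> since
  \<open>(\<surd>a + \<surd>b)\<^sup>2\<close> is the minimum of \<open>a / (1 - z) + b / z\<close>.\<close>

locale alternating_weights =
  fixes n :: nat and V :: "nat set" and h :: graph and c z \<rho> :: real
  assumes h: "finite h" and deg_h: "\<And>v. degree h v = (if v \<in> V then 2 else 0)"
    and V: "V \<subseteq> {1..n}" and c: "0 \<le> c" and z: "0 < z" "z < \<rho>" and \<rho>: "\<rho> < 1"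
    and growth: "c / z * (real (card V) * (2 * z / (\<rho> * (\<rho> - z))) + real (n - card V) / \<rho>) \<le> 1"
begin

text \<open>The normalisation makes all blue extensions together contribute at most 1, which is
  \<open>growth\<close>. The values then solve one equation each: z\<alpha> + 1 = \<rho>\<alpha>
  after a red edge, 2z\<alpha> = \<rho>\<beta> after a blue edge at a planted vertex, 1 =
  \<rho>\<gamma> after a blue edge elsewhere, and 2z\<alpha> + 1 for a single vertex.\<close>

definition \<alpha> :: real where "\<alpha> = 1 / (\<rho> - z)"
definition \<beta> :: real where "\<beta> = 2 * z / (\<rho> * (\<rho> - z))"
definition \<gamma> :: real where "\<gamma> = 1 / \<rho>"
definition \<phi>\<^sub>0 :: real where "\<phi>\<^sub>0 = (2 * z * \<alpha> + 1) / \<rho>"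

fun potential :: "nat list \<Rightarrow> real" where
  "potential (x # y # p) = (if {x, y} \<in> h then \<alpha> else if x \<in> V then \<beta> else \<gamma>)"
| "potential _ = \<phi>\<^sub>0"

abbreviation weight :: "nat list \<Rightarrow> real" where
  "weight \<equiv> walk_weight h z (c / z)"

lemma pos: "0 < \<rho>" "0 < \<rho> - z" "0 < \<alpha>" "0 < \<beta>" "0 < \<gamma>" "0 < \<phi>\<^sub>0" "0 \<le> c / z"
  using z c by (auto simp: \<alpha>_def \<beta>_def \<gamma>_def \<phi>\<^sub>0_def intro!: divide_pos_pos add_nonneg_pos)

lemma eigen: "z * \<alpha> + 1 = \<rho> * \<alpha>" "2 * z * \<alpha> = \<rho> * \<beta>" "1 = \<rho> * \<gamma>" "2 * z * \<alpha> + 1 = \<rho> * \<phi>\<^sub>0"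
  using pos by (auto simp: \<alpha>_def \<beta>_def \<gamma>_def \<phi>\<^sub>0_def field_simps)

text \<open>Only backtracking over the most recent edge is excluded. Distinctness from the older
  edges is given up, so that the number of extensions is governed by the most recent edge
  alone.\<close>

definition exts :: "nat list \<Rightarrow> nat set" where
  "exts p = {x \<in> {1..n}. \<forall>y q. p = hd p # y # q \<longrightarrow>
     {x, hd p} \<noteq> {hd p, y} \<and> (hd p \<in> V \<longrightarrow> {x, hd p} \<in> h \<or> {hd p, y} \<in> h)}"

definition alt_walks :: "nat \<Rightarrow> nat list set" where
  "alt_walks k = {p \<in> walks n k. alternating V h p}"

lemma alt_walks_Suc: "alt_walks (Suc k) \<subseteq> {x # p |x p. p \<in> alt_walks k \<and> x \<in> exts p}"
proof
  fix p assume p: "p \<in> alt_walks (Suc k)"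
  then have "p \<in> walks n (Suc k)" by (simp add: alt_walks_def)
  then obtain x q where q: "p = x # q" "x \<in> {1..n}" "q \<in> walks n k" "q \<noteq> []"
    "{x, hd q} \<notin> set (walk_edges q)" by (rule walks_SucE)
  have "alternating V h q \<and> x \<in> exts q"
  proof (cases q)
    case (Cons y q')
    then show ?thesis using p q by (cases q') (auto simp: alt_walks_def exts_def)
  qed (use q in simp)
  then show "p \<in> {x # p |x p. p \<in> alt_walks k \<and> x \<in> exts p}"
    using q by (auto simp: alt_walks_def)
qed

lemma sum_blue_le:
  assumes "X \<subseteq> {1..n}"
  shows "(\<Sum>x\<in>X. c / z * (if x \<in> V then \<beta> else \<gamma>)) \<le> 1"
proof -
  have "(\<Sum>x\<in>X. c / z * (if x \<in> V then \<beta> else \<gamma>)) \<le> (\<Sum>x\<in>{1..n}. c / z * (if x \<in> V then \<beta> else \<gamma>))"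
    using assms pos by (intro sum_mono2 mult_nonneg_nonneg) auto
  also have "\<dots> = c / z * (\<Sum>x\<in>{1..n}. if x \<in> V then \<beta> else \<gamma>)" by (rule sum_distrib_left[symmetric])
  also have "(\<Sum>x\<in>{1..n}. if x \<in> V then \<beta> else \<gamma>) = real (card V) * \<beta> + real (n - card V) * \<gamma>"
  proof -
    have "{1..n} \<inter> {x. x \<in> V} = V" "{1..n} \<inter> - {x. x \<in> V} = {1..n} - V" using V by auto
    moreover have "card ({1..n} - V) = n - card V"
      using V by (subst card_Diff_subset) (auto intro: finite_subset)
    ultimately show ?thesis by (simp add: sum.If_cases)
  qed
  finally show ?thesis using growth by (simp add: \<beta>_def \<gamma>_def)
qed

lemma sum_exts_le:
  assumes "p \<noteq> []" "X \<subseteq> {1..n}" "card {x \<in> X. {x, hd p} \<in> h} \<le> r"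
  shows "(\<Sum>x\<in>X. weight (x # p) * potential (x # p)) \<le> (real r * z * \<alpha> + 1) * weight p"
proof -
  have fin: "finite X" using assms(2) finite_subset by blast
  let ?g = "\<lambda>x. if {x, hd p} \<in> h then z * \<alpha> else c / z * (if x \<in> V then \<beta> else \<gamma>)"
  have pot: "potential (x # p) = (if {x, hd p} \<in> h then \<alpha> else if x \<in> V then \<beta> else \<gamma>)" for x
    using assms(1) by (cases p) auto
  have "(\<Sum>x\<in>X. weight (x # p) * potential (x # p)) = (\<Sum>x\<in>X. ?g x) * weight p"
    unfolding sum_distrib_right
    by (intro sum.cong) (auto simp: walk_weight_Cons[OF assms(1)] pot)
  also have "(\<Sum>x\<in>X. ?g x) = (\<Sum>x\<in>{x \<in> X. {x, hd p} \<in> h}. z * \<alpha>)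
      + (\<Sum>x\<in>{x \<in> X. {x, hd p} \<notin> h}. c / z * (if x \<in> V then \<beta> else \<gamma>))"
    using fin by (subst sum.If_cases) (auto simp: Int_def)
  also have "\<dots> \<le> real r * (z * \<alpha>) + 1"
    using sum_blue_le[of "{x \<in> X. {x, hd p} \<notin> h}"] assms pos z
    by (intro add_mono) (auto intro!: mult_right_mono)
  finally show ?thesis
    using pos z walk_weight_nonneg[of z "c / z" h p] by (simp add: mult_right_mono mult.assoc)
qed

text \<open>The situation after a blue edge at a planted vertex: all extensions are red, and the
  blue contribution 1 is saved.\<close>

lemma sum_blue_exts_le:
  assumes "p \<noteq> []" "X \<subseteq> {1..n}" "\<And>x. x \<in> X \<Longrightarrow> {x, hd p} \<in> h" "card X \<le> r"
  shows "(\<Sum>x\<in>X. weight (x # p) * potential (x # p)) \<le> real r * z * \<alpha> * weight p"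
proof -
  have "(\<Sum>x\<in>X. weight (x # p) * potential (x # p)) = (\<Sum>x\<in>X. z * \<alpha> * weight p)"
    using assms(1,3) by (intro sum.cong) (cases p; auto simp: walk_weight_Cons)+
  also have "\<dots> = real (card X) * (z * \<alpha> * weight p)" by simp
  also have "\<dots> \<le> real r * (z * \<alpha> * weight p)"
    using assms(4) pos z walk_weight_nonneg[of z "c / z" h p] by (intro mult_right_mono) auto
  finally show ?thesis by (simp add: mult.assoc)
qed

text \<open>The cases are the rows of the transfer matrix: a single vertex, a red edge, a blue edge
  at a planted vertex, and a blue edge at another vertex.\<close>

lemma sum_ext_le:
  assumes "p \<in> alt_walks k"
  shows "(\<Sum>x\<in>exts p. weight (x # p) * potential (x # p)) \<le> \<rho> * (weight p * potential p)"
proof -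
  obtain y q where p: "p = y # q" using assms by (cases p) (auto simp: alt_walks_def walks_def)
  have X: "exts p \<subseteq> {1..n}" by (auto simp: exts_def)
  have hd: "hd p = y" "p \<noteq> []" by (simp_all add: p)
  let ?S = "\<lambda>X. \<Sum>x\<in>X. weight (x # p) * potential (x # p)"
  have deg: "card {x \<in> X. {x, hd p} \<in> h} \<le> degree h y" for X
  proof -
    have "card {x \<in> X. {x, hd p} \<in> h} \<le> card {x. {x, y} \<in> h}"
      unfolding hd by (rule card_mono[OF finite_nbrs[OF h]]) auto
    then show ?thesis using card_nbrs_le[OF h, of y] by linarith
  qed
  show ?thesis
  proof (cases q)
    case Nil
    then have "exts p = {1..n}" by (auto simp: exts_def p)
    moreover have "degree h y \<le> 2" using deg_h[of y] by simp
    then have "?S {1..n} \<le> (real 2 * z * \<alpha> + 1) * weight p"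
      by (intro sum_exts_le order_refl hd order_trans[OF deg])
    moreover have "potential p = \<phi>\<^sub>0" by (simp add: p Nil)
    ultimately show ?thesis using eigen(4) by (simp add: mult_ac)
  next
    case (Cons y' q')
    have ex: "exts p = {x \<in> {1..n}. {x, y} \<noteq> {y, y'} \<and> (y \<in> V \<longrightarrow> {x, y} \<in> h \<or> {y, y'} \<in> h)}"
      by (auto simp: exts_def p Cons)
    have pot: "potential p = (if {y, y'} \<in> h then \<alpha> else if y \<in> V then \<beta> else \<gamma>)"
      by (simp add: p Cons)
    show ?thesis
    proof (cases "{y, y'} \<in> h")
      case True
      \<comment> \<open>One of the two red edges at y is the edge just used, so a single red
        extension is left.\<close>
      have "card {x \<in> exts p. {x, hd p} \<in> h} \<le> card {x. {x, y} \<in> h \<and> {x, y} \<noteq> {y, y'}}"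
      proof (rule card_mono)
        show "finite {x. {x, y} \<in> h \<and> {x, y} \<noteq> {y, y'}}"
          by (rule finite_subset[OF _ finite_nbrs[OF h, of y]]) auto
      qed (unfold ex hd, blast)
      also have "\<dots> \<le> 1"
        using card_other_nbrs_le[OF h True, of y] deg_h[of y] by (auto split: if_splits)
      finally have "?S (exts p) \<le> (real 1 * z * \<alpha> + 1) * weight p" by (intro sum_exts_le X hd)
      then show ?thesis using eigen(1) True by (simp add: pot mult_ac)
    next
      case False
      show ?thesis
      proof (cases "y \<in> V")
        case True
        have all: "{x, hd p} \<in> h" if "x \<in> exts p" for x
          using that True False unfolding ex hd by blast
        then have "{x \<in> exts p. {x, hd p} \<in> h} = exts p" by blast
        then have "card (exts p) \<le> 2" using deg[of "exts p"] deg_h[of y] True by simp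
        then have "?S (exts p) \<le> real 2 * z * \<alpha> * weight p" by (intro sum_blue_exts_le X hd all)
        then show ?thesis using True False by (simp add: pot eigen(2)) (simp add: mult_ac)
      next
        case no: False
        have "card {x \<in> exts p. {x, hd p} \<in> h} \<le> 0" using deg[of "exts p"] deg_h[of y] no by simp
        then have "?S (exts p) \<le> (real 0 * z * \<alpha> + 1) * weight p" by (intro sum_exts_le X hd)
        also have "\<dots> = \<rho> * \<gamma> * weight p" using eigen(3) by simp
        finally show ?thesis using no False by (simp add: pot mult_ac)
      qed
    qed
  qed
qed

lemma finite_alt_walks: "finite (alt_walks k)"
  unfolding alt_walks_def using finite_walks by simp

definition walk_const :: real where "walk_const = \<phi>\<^sub>0 / min 1 \<beta>"

lemma walk_const_nonneg: "0 \<le> walk_const"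
  using pos by (simp add: walk_const_def)

text \<open>Since \<rho> is below 1, all values except possibly \<beta> are at least 1.\<close>

lemma potential_ge: "min 1 \<beta> \<le> potential p"
proof -
  have "1 \<le> \<alpha>" "1 \<le> \<gamma>" using pos z \<rho> by (auto simp: \<alpha>_def \<gamma>_def)
  moreover have "1 \<le> \<phi>\<^sub>0"
  proof -
    have "\<rho> \<le> 2 * z * \<alpha> + 1" using \<rho> pos z by (simp add: add_increasing)
    then show ?thesis using pos by (simp add: \<phi>\<^sub>0_def)
  qed
  ultimately show ?thesis by (cases p rule: potential.cases) auto
qed

lemma sum_alt_walks_le: "(\<Sum>p\<in>alt_walks k. weight p) \<le> walk_const * real n * \<rho> ^ k"
proof -
  let ?m = "min 1 \<beta>"
  have m: "0 < ?m" using pos by simp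
  have w: "0 \<le> weight p" for p using pos z by (intro walk_weight_nonneg) auto
  have "?m * (\<Sum>p\<in>alt_walks k. weight p) \<le> (\<Sum>p\<in>alt_walks k. weight p * potential p)"
    unfolding sum_distrib_left
    by (intro sum_mono) (use w potential_ge in \<open>metis mult.commute mult_left_mono\<close>)
  also have "\<dots> \<le> \<rho> ^ k * (\<Sum>p\<in>alt_walks 0. weight p * potential p)"
  proof (rule sum_walks_le[where X = exts])
    show "alt_walks (Suc k) \<subseteq> {x # p |x p. p \<in> alt_walks k \<and> x \<in> exts p}" for k by (rule alt_walks_Suc)
    show "0 \<le> weight p * potential p" for p
      using w potential_ge[of p] m by (intro mult_nonneg_nonneg) auto
  qed (use finite_alt_walks pos sum_ext_le in \<open>auto simp: exts_def\<close>)
  also have "alt_walks 0 = (\<lambda>v. [v]) ` {1..n}" by (auto simp: alt_walks_def walks_0)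
  also have "(\<Sum>p\<in>(\<lambda>v. [v]) ` {1..n}. weight p * potential p) = real n * \<phi>\<^sub>0"
    by (subst sum.reindex) (auto simp: inj_on_def walk_weight_singleton)
  finally show ?thesis using m by (simp add: walk_const_def field_simps)
qed

text \<open>An exponential moment estimate: the weight is c^blue times z^(red - blue), and since z <
  1 a red surplus of at most s costs no more than the factor z^s.\<close>

lemma light_weight:
  assumes "distinct (walk_edges p)" "real (red h p) \<le> real (blue h p) + s"
  shows "c ^ blue h p \<le> z powr (- s) * weight p"
proof -
  have z1: "0 < z" "z < 1" using z \<rho> by auto
  have "1 = z powr 0" using z1 by simp
  also have "\<dots> \<le> z powr (- s + (real (red h p) - real (blue h p)))"
    using z1 assms(2) by (intro powr_mono') auto
  also have "\<dots> = z powr (- s) * (z ^ red h p / z ^ blue h p)"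
    unfolding powr_add powr_diff using z1 by (simp add: powr_realpow)
  finally have "c ^ blue h p * 1 \<le> c ^ blue h p * (z powr (- s) * (z ^ red h p / z ^ blue h p))"
    using c by (intro mult_left_mono) auto
  then show ?thesis by (simp add: walk_weight_eq[OF assms(1)] power_divide mult_ac)
qed

lemma expected_light_trails:
  assumes "c \<le> 1"
  shows "measure_pmf.expectation (erdos_renyi n c)
      (\<lambda>G0. real (card (light_trails n V h (G0 \<union> h) k s))) \<le> z powr (- s) * (walk_const * real n * \<rho> ^ k)"
proof -
  define P where "P = {p \<in> alt_walks k. real (red h p) \<le> real (blue h p) + s}"
  have finP: "finite P" using finite_alt_walks by (simp add: P_def)
  have "light_trails n V h (G0 \<union> h) k s = {p \<in> P. set (walk_edges p) \<subseteq> G0 \<union> h}" for G0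
    by (auto simp: light_trails_def alternating_trails_def P_def alt_walks_def walks_def)
  then have "measure_pmf.expectation (erdos_renyi n c)
      (\<lambda>G0. real (card (light_trails n V h (G0 \<union> h) k s))) \<le> (\<Sum>p\<in>P. c ^ blue h p)"
    using expected_card_walks_le[OF c assms finP] by simp
  also have "\<dots> \<le> (\<Sum>p\<in>P. z powr (- s) * weight p)"
    by (intro sum_mono light_weight) (auto simp: P_def alt_walks_def walks_def)
  also have "\<dots> = z powr (- s) * (\<Sum>p\<in>P. weight p)" by (simp add: sum_distrib_left)
  also have "(\<Sum>p\<in>P. weight p) \<le> (\<Sum>p\<in>alt_walks k. weight p)"
    using pos z by (intro sum_mono2 finite_alt_walks walk_weight_nonneg) (auto simp: P_def)
  also note sum_alt_walks_le
  finally show ?thesis by (simp add: mult_left_mono)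
qed

text \<open>Removing the first vertex loses no information, as it equals the last one. The removed
  blue edge contributes c/z without a sum over its end vertex, and as \<open>c * real n\<close> is a
  constant the bound does not grow with n.\<close>

lemma expected_light_closed_trails:
  assumes "c \<le> 1" "0 < k"
  shows "measure_pmf.expectation (erdos_renyi n c)
      (\<lambda>G0. real (card (light_closed_trails n V h (G0 \<union> h) k)))
    \<le> c * real n / z * walk_const * \<rho> ^ (k - 1)"
proof -
  define P where "P = {p \<in> alt_walks k. red h p \<le> blue h p \<and> hd p = last p \<and> {hd p, hd (tl p)} \<notin> h}"
  obtain k' where k: "k = Suc k'" using assms(2) gr0_implies_Suc by blast
  have finP: "finite P" using finite_alt_walks by (simp add: P_def)
  have "light_closed_trails n V h (G0 \<union> h) k = {p \<in> P. set (walk_edges p) \<subseteq> G0 \<union> h}" for G0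
    by (auto simp: light_closed_trails_def light_trails_def alternating_trails_def P_def alt_walks_def
        walks_def)
  then have "measure_pmf.expectation (erdos_renyi n c)
      (\<lambda>G0. real (card (light_closed_trails n V h (G0 \<union> h) k))) \<le> (\<Sum>p\<in>P. c ^ blue h p)"
    using expected_card_walks_le[OF c assms(1) finP] by simp
  also have "\<dots> \<le> (\<Sum>p\<in>P. weight p)"
  proof (rule sum_mono)
    fix p assume "p \<in> P"
    then have "c ^ blue h p \<le> z powr (- 0) * weight p"
      by (intro light_weight) (auto simp: P_def alt_walks_def walks_def)
    then show "c ^ blue h p \<le> weight p" using z by simp
  qed
  also have "\<dots> \<le> (\<Sum>q\<in>alt_walks k'. c / z * weight q)"
  proof -
    have inv: "\<exists>q. p = last q # q \<and> q \<in> alt_walks k' \<and> {last q, hd q} \<notin> h" if "p \<in> P" for p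
    proof -
      have "p \<in> alt_walks (Suc k')" using that k by (simp add: P_def)
      then obtain x q where q: "p = x # q" "q \<in> alt_walks k'" using alt_walks_Suc[of k'] by blast
      have "q \<noteq> []" using q(2) by (auto simp: alt_walks_def walks_def)
      then show ?thesis using that q by (auto simp: P_def)
    qed
    have "inj_on tl P" by (rule inj_onI) (use inv in \<open>metis list.sel(3)\<close>)
    moreover have "weight p = c / z * weight (tl p)" if p: "p \<in> P" for p
    proof -
      obtain q where q: "p = last q # q" "q \<in> alt_walks k'" "{last q, hd q} \<notin> h" using inv[OF p] by blast
      have "q \<noteq> []" using q(2) by (auto simp: alt_walks_def walks_def)
      then have "weight (last q # q) = c / z * weight q" using q(3) by (simp add: walk_weight_Cons)
      then show ?thesis using q(1) by (metis list.sel(3))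
    qed
    ultimately have "(\<Sum>p\<in>P. weight p) = (\<Sum>q\<in>tl ` P. c / z * weight q)"
      by (subst sum.reindex) simp_all
    also have "\<dots> \<le> (\<Sum>q\<in>alt_walks k'. c / z * weight q)"
    proof (rule sum_mono2[OF finite_alt_walks])
      show "tl ` P \<subseteq> alt_walks k'" using inv by (metis image_subsetI list.sel(3))
      show "0 \<le> c / z * weight q" for q
        using pos z by (intro mult_nonneg_nonneg walk_weight_nonneg) auto
    qed
    finally show ?thesis .
  qed
  also have "\<dots> = c / z * (\<Sum>q\<in>alt_walks k'. weight q)" by (simp add: sum_distrib_left)
  also have "\<dots> \<le> c / z * (walk_const * real n * \<rho> ^ k')"
    by (rule mult_left_mono[OF sum_alt_walks_le pos(7)])
  finally show ?thesis by (simp add: k mult_ac)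
qed

end


section \<open>The expected error\<close>

text \<open>The inequality is settled for \<rho> = 1 first; being strict, it survives a slight
  decrease of \<rho> by continuity.\<close>

lemma ex_weight_parameters:
  fixes \<delta> lam :: real
  assumes "0 < \<delta>" "\<delta> \<le> 1" "0 < lam" "lam < 1 / (sqrt (2 * \<delta>) + sqrt (1 - \<delta>))\<^sup>2"
  obtains z \<rho> where "0 < z" "z < \<rho>" "\<rho> < 1" "lam / \<rho> * (2 * \<delta> / (\<rho> - z) + (1 - \<delta>) / z) < 1"
proof -
  define a b where "a = sqrt (2 * \<delta>)" and "b = sqrt (1 - \<delta>)"
  have a: "0 < a" "a\<^sup>2 = 2 * \<delta>" and b: "0 \<le> b" "b\<^sup>2 = 1 - \<delta>" using assms by (auto simp: a_def b_def)
  have lam: "lam * (a + b)\<^sup>2 < 1" using assms(4) a(1) b(1) unfolding a_def[symmetric] b_def[symmetric]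
    by (simp add: field_simps)
  obtain z where z: "0 < z" "z < 1" "lam * (2 * \<delta> / (1 - z) + (1 - \<delta>) / z) < 1"
  proof (cases "b = 0")
    case True
    then have "\<delta> = 1" using b by simp
    then have l: "2 * lam < 1" using lam True a by (simp add: mult.commute)
    \<comment> \<open>For \<delta> = 1 the minimiser degenerates to 0. Here every z strictly between
      0 and \<open>1 - 2 * lam\<close> works, and the midpoint is taken.\<close>
    have "0 < (1 - 2 * lam) / 2" "(1 - 2 * lam) / 2 < 1" using l assms(3) by auto
    moreover have "lam * (2 * \<delta> / (1 - (1 - 2 * lam) / 2) + (1 - \<delta>) / ((1 - 2 * lam) / 2)) < 1"
      using l assms(3) \<open>\<delta> = 1\<close> by (simp add: field_simps)
    ultimately show ?thesis by (rule that)
  next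
    case False
    then have b0: "0 < b" using b by simp
    \<comment> \<open>The minimiser of a^2 / (1 - z) + b^2 / z, where the value is (a +
      b)^2.\<close>
    define z where "z = b / (a + b)"
    have z1: "1 - z = a / (a + b)" using a(1) b0 by (simp add: z_def field_simps)
    have "2 * \<delta> / (1 - z) + (1 - \<delta>) / z = (a + b)\<^sup>2"
      unfolding z1 unfolding z_def a(2)[symmetric] b(2)[symmetric]
      using a(1) b0 by (simp add: power2_eq_square field_simps)
    moreover have "0 < z" "z < 1" using a(1) b0 by (auto simp: z_def)
    ultimately show ?thesis using that lam by simp
  qed
  let ?f = "\<lambda>\<rho>. lam / \<rho> * (2 * \<delta> / (\<rho> - z) + (1 - \<delta>) / z)"
  have "isCont ?f 1" using z by (intro continuous_intros) auto
  then have "(?f \<longlongrightarrow> ?f 1) (at_left 1)" by (simp add: isCont_def filterlim_at_split)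
  moreover have "?f 1 < 1" using z(3) by simp
  ultimately have "eventually (\<lambda>\<rho>. ?f \<rho> < 1) (at_left 1)" by (rule order_tendstoD(2))
  moreover have "eventually (\<lambda>\<rho>. \<rho> \<in> {z<..<1}) (at_left 1)" by (rule eventually_at_leftI[OF _ z(2)])
  ultimately have "eventually (\<lambda>\<rho>. ?f \<rho> < 1 \<and> \<rho> \<in> {z<..<1}) (at_left 1)" by (rule eventually_conj)
  then obtain \<rho> where "?f \<rho> < 1" "\<rho> \<in> {z<..<1}"
    using eventually_happens[of _ "at_left (1::real)"] by fastforce
  then show ?thesis using that[of z \<rho>] z(1) by simp
qed

definition trail_length :: "nat \<Rightarrow> nat" where
  "trail_length n = nat \<lfloor>ln (real n) / 2\<rfloor>"

text \<open>Any power of ln n with exponent strictly between 0 and 1/2 would do: it must be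
  negligible against sqrt (ln n), yet make \<rho> to this power beat ln n.\<close>

definition short_length :: "nat \<Rightarrow> nat" where
  "short_length n = nat \<lceil>ln (real n) powr (1 / 4)\<rceil>"

text \<open>The four summands, each divided by n, bound the darts on long clean stretches, on short
  closed trails, on open trails up to the short length, and on longer open trails.\<close>

definition error_bound :: "real \<Rightarrow> real \<Rightarrow> real \<Rightarrow> real \<Rightarrow> nat \<Rightarrow> real" where
  "error_bound lam z \<rho> C n =
     2 * C * (z powr (- (sqrt (ln (real n)) + 2)) * \<rho> powr (ln (real n) / 2 - 1))
     + ln (real n) / 2 * (lam / z * C / (1 - \<rho>)) / real n
     + 2 * (ln (real n) powr (1 / 4) + 1) / sqrt (ln (real n))
     + ln (real n) * C / (1 - \<rho>) * \<rho> powr (ln (real n) powr (1 / 4))"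

lemma error_bound_tendsto_0:
  assumes "0 < z" "z < 1" "0 < \<rho>" "\<rho> < 1"
  shows "error_bound lam z \<rho> C \<longlonglongrightarrow> 0"
proof -
  define a r where "a = - ln z" and "r = - ln \<rho>"
  have ar: "0 < a" "0 < r" using assms by (auto simp: a_def r_def)
  have eq: "z powr x = exp (- a * x)" "\<rho> powr x = exp (- r * x)" for x
    using assms by (simp_all add: a_def r_def powr_def mult.commute)
  have 1: "(\<lambda>n::nat. 2 * C * (exp (- a * (- (sqrt (ln (real n)) + 2))) * exp (- r * (ln (real n) / 2 - 1)))) \<longlonglongrightarrow> 0"
    using ar by real_asymp
  have 2: "(\<lambda>n::nat. ln (real n) / 2 * (lam / z * C / (1 - \<rho>)) / real n) \<longlonglongrightarrow> 0" by real_asymp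
  have 3: "(\<lambda>n::nat. 2 * (ln (real n) powr (1 / 4) + 1) / sqrt (ln (real n))) \<longlonglongrightarrow> 0" by real_asymp
  have "(\<lambda>n::nat. ln (real n) * exp (- r * (ln (real n) powr (1 / 4)))) \<longlonglongrightarrow> 0"
    using ar by real_asymp
  from tendsto_mult_left[OF this, of "C / (1 - \<rho>)"]
  have 4: "(\<lambda>n::nat. ln (real n) * C / (1 - \<rho>) * exp (- r * (ln (real n) powr (1 / 4)))) \<longlonglongrightarrow> 0"
    by (simp add: mult_ac)
  show ?thesis
    unfolding error_bound_def[abs_def] eq using tendsto_add[OF tendsto_add[OF tendsto_add[OF 1 2] 3] 4] by simp
qed

lemma geometric_sum_le:
  fixes \<rho> :: real
  assumes "0 \<le> \<rho>" "\<rho> < 1"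
  shows "(\<Sum>t\<in>{a..<b}. \<rho> ^ t) \<le> \<rho> ^ a / (1 - \<rho>)"
proof (cases "a \<le> b")
  case True
  then have "(1 - \<rho>) * (\<Sum>t\<in>{a..<b}. \<rho> ^ t) = \<rho> ^ a - \<rho> ^ b"
    by (induction b rule: dec_induct) (simp_all add: distrib_left, simp add: left_diff_distrib)
  then have "(\<Sum>t\<in>{a..<b}. \<rho> ^ t) = (\<rho> ^ a - \<rho> ^ b) / (1 - \<rho>)"
    using assms by (simp add: field_simps)
  also have "\<dots> \<le> \<rho> ^ a / (1 - \<rho>)" using assms by (intro divide_right_mono) auto
  finally show ?thesis .
qed (use assms in simp)

text \<open>The deterministic bound holds on the whole support, so the expectation splits into first
  moments of light trails, and these are summed as geometric series in \<rho>.\<close>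

lemma expected_error_le:
  fixes \<delta> lam :: real
  assumes alg: "greedy_algorithm alg" and h: "h \<in> two_factors V" and V: "V \<subseteq> {1..n}"
    and lam: "0 < lam" "lam \<le> real n" and zr: "0 < z" "z < \<rho>" "\<rho> < 1"
    and growth: "lam / real n / z *
      (real (card V) * (2 * z / (\<rho> * (\<rho> - z))) + real (n - card V) / \<rho>) \<le> 1"
    and n: "6 \<le> ln (real n)"
  shows "measure_pmf.expectation (with_planted n lam h) (\<lambda>(Hs, G). real (card (alg n G \<triangle> Hs)))
    \<le> error_bound lam z \<rho> (alternating_weights.walk_const z \<rho>) n * real n"
proof -
  note hp = two_factors_props[OF h V]
  have fin: "finite h" using hp(1) finite_all_edges_on finite_subset by blast
  define c where "c = lam / real n"
  have n0: "0 < real n" using lam by simp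
  then have cc: "0 \<le> c" "c \<le> 1" using lam by (auto simp: c_def)
  interpret alternating_weights n V h c z \<rho>
    by unfold_locales (use fin hp(2) V cc zr growth in \<open>auto simp: c_def\<close>)
  define L K s where "L = trail_length n" and "K = short_length n" and "s = sqrt (ln (real n)) + 2"
  have L: "3 \<le> L" "real (2 * L) \<le> ln (real n)" "ln (real n) / 2 - 1 \<le> real L" "real L \<le> ln (real n) / 2"
  proof -
    have "real L = of_int \<lfloor>ln (real n) / 2\<rfloor>" using n by (simp add: L_def trail_length_def)
    then show "3 \<le> L" "real (2 * L) \<le> ln (real n)" "ln (real n) / 2 - 1 \<le> real L" "real L \<le> ln (real n) / 2"
      using n by linarith+
  qed
  have K: "ln (real n) powr (1 / 4) \<le> real K" "real K \<le> ln (real n) powr (1 / 4) + 1"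
    unfolding K_def short_length_def using powr_ge_zero[of "ln (real n)" "1 / 4"] by linarith+
  let ?C = walk_const
  let ?E = "\<lambda>f. measure_pmf.expectation (erdos_renyi n c) (f :: graph \<Rightarrow> real)"
  have int: "integrable (measure_pmf (erdos_renyi n c)) f" for f :: "graph \<Rightarrow> real"
    by (rule integrable_measure_pmf_finite[OF finite_set_erdos_renyi])
  let ?T = "\<lambda>k s G0. real (card (light_trails n V h (G0 \<union> h) k s))"
  let ?Z = "\<lambda>k G0. real (card (light_closed_trails n V h (G0 \<union> h) k))"
  let ?B = "\<lambda>G0. 2 * ?T L s G0 + real L * (\<Sum>t\<in>{1..<L}. ?Z t G0) + real K * (2 * real n / sqrt (ln (real n)))
      + 2 * real L * (\<Sum>t\<in>{K..<2 * L}. ?T t 0 G0)"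
  have "measure_pmf.expectation (with_planted n lam h) (\<lambda>(Hs, G). real (card (alg n G \<triangle> Hs)))
      = ?E (\<lambda>G0. real (card (alg n (G0 \<union> h) \<triangle> h)))"
    by (simp add: with_planted_def c_def)
  also have "\<dots> \<le> ?E ?B"
  proof (rule integral_mono_AE[OF int int])
    have "real (card (alg n (G0 \<union> h) \<triangle> h)) \<le> ?B G0" if "G0 \<in> set_pmf (erdos_renyi n c)" for G0
    proof -
      have G: "G0 \<union> h \<subseteq> all_edges_on n" using that set_erdos_renyi hp(1) by blast
      then have "greedy_output n (G0 \<union> h) (alg n (G0 \<union> h))" using alg by (simp add: greedy_algorithm_def)
      from card_recovery_error_le[OF G this _ hp(2) L(1,2), of K] show ?thesis by (simp add: s_def)
    qed
    then show "AE G0 in measure_pmf (erdos_renyi n c). real (card (alg n (G0 \<union> h) \<triangle> h)) \<le> ?B G0"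
      by (simp add: AE_measure_pmf_iff)
  qed
  also have "?E ?B = 2 * ?E (?T L s) + real L * (\<Sum>t\<in>{1..<L}. ?E (?Z t))
      + real K * (2 * real n / sqrt (ln (real n))) + 2 * real L * (\<Sum>t\<in>{K..<2 * L}. ?E (?T t 0))"
    by (simp add: int)
  also have "\<dots> \<le> 2 * (z powr (- s) * (?C * real n * \<rho> ^ L))
      + real L * (\<Sum>t\<in>{1..<L}. c * real n / z * ?C * \<rho> ^ (t - 1))
      + real K * (2 * real n / sqrt (ln (real n)))
      + 2 * real L * (\<Sum>t\<in>{K..<2 * L}. z powr (- 0) * (?C * real n * \<rho> ^ t))"
    by (intro add_mono mult_left_mono sum_mono order_refl expected_light_trails[OF cc(2)]
        expected_light_closed_trails[OF cc(2)]) auto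
  also have "\<dots> = 2 * ?C * (z powr (- s) * \<rho> ^ L) * real n
      + real L * (lam / z * ?C * (\<Sum>t\<in>{1..<L}. \<rho> ^ (t - 1)))
      + 2 * real K / sqrt (ln (real n)) * real n
      + 2 * real L * ?C * (\<Sum>t\<in>{K..<2 * L}. \<rho> ^ t) * real n"
    using n0 zr by (simp add: sum_distrib_left sum_distrib_right mult_ac c_def)
  also have "\<dots> \<le> 2 * ?C * (z powr (- s) * \<rho> powr (ln (real n) / 2 - 1)) * real n
      + ln (real n) / 2 * (lam / z * ?C * (1 / (1 - \<rho>)))
      + 2 * (ln (real n) powr (1 / 4) + 1) / sqrt (ln (real n)) * real n
      + ln (real n) * ?C * (\<rho> powr (ln (real n) powr (1 / 4)) / (1 - \<rho>)) * real n"
  proof -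
    have C: "0 \<le> ?C" by (rule walk_const_nonneg)
    have "\<rho> ^ L = \<rho> powr real L" using pos by (simp add: powr_realpow)
    also have "\<dots> \<le> \<rho> powr (ln (real n) / 2 - 1)" using pos zr L(3) by (intro powr_mono') auto
    finally have 1: "\<rho> ^ L \<le> \<rho> powr (ln (real n) / 2 - 1)" .
    have "\<rho> ^ K = \<rho> powr real K" using pos by (simp add: powr_realpow)
    also have "\<dots> \<le> \<rho> powr (ln (real n) powr (1 / 4))" using pos zr K(1) by (intro powr_mono') auto
    finally have 2: "\<rho> ^ K \<le> \<rho> powr (ln (real n) powr (1 / 4))" .
    have "(\<Sum>t\<in>{1..<L}. \<rho> ^ (t - 1)) = (\<Sum>t\<in>{0..<L - 1}. \<rho> ^ t)"
      using L(1) by (intro sum.reindex_bij_witness[of _ Suc "\<lambda>t. t - 1"]) auto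
    also have "\<dots> \<le> \<rho> ^ 0 / (1 - \<rho>)" using pos zr by (intro geometric_sum_le) auto
    finally have 3: "(\<Sum>t\<in>{1..<L}. \<rho> ^ (t - 1)) \<le> 1 / (1 - \<rho>)" by simp
    have "(\<Sum>t\<in>{K..<2 * L}. \<rho> ^ t) \<le> \<rho> ^ K / (1 - \<rho>)" using pos zr by (intro geometric_sum_le) auto
    also have "\<dots> \<le> \<rho> powr (ln (real n) powr (1 / 4)) / (1 - \<rho>)" using 2 zr by (intro divide_right_mono) auto
    finally have 4: "(\<Sum>t\<in>{K..<2 * L}. \<rho> ^ t) \<le> \<rho> powr (ln (real n) powr (1 / 4)) / (1 - \<rho>)" .
    have 0: "0 \<le> (\<Sum>t\<in>{1..<L}. \<rho> ^ (t - 1))" "0 \<le> (\<Sum>t\<in>{K..<2 * L}. \<rho> ^ t)"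
      using pos by (auto intro!: sum_nonneg)
    have 5: "2 * real L \<le> ln (real n)" using L(4) by simp
    show ?thesis
      by (intro add_mono mult_right_mono mult_mono divide_right_mono mult_nonneg_nonneg 1 3 4 5 K(2) L(4)
          order_refl 0 C) (use C n0 lam zr pos n K in \<open>auto intro!: divide_nonneg_nonneg\<close>)
  qed
  also have "\<dots> = error_bound lam z \<rho> ?C n * real n"
    using n0 by (simp add: error_bound_def s_def distrib_right mult.assoc)
  finally show ?thesis .
qed


section \<open>The timed implementation\<close>

lemma bind_timed_conv: "bind_timed m f = (fst (f (fst m)), snd m + snd (f (fst m)))"
  by (simp add: bind_timed_def case_prod_beta)

lemma fst_for_each: "fst (for_each xs f s) = fold (\<lambda>x s. fst (f x s)) xs s"
  by (induction xs arbitrary: s) (auto simp: bind_timed_conv ret_def charge_def)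

lemma snd_for_each_le:
  assumes "\<And>x s. x \<in> set xs \<Longrightarrow> snd (f x s) \<le> B"
  shows "snd (for_each xs f s) \<le> 1 + length xs * (B + 1)"
  using assms
proof (induction xs arbitrary: s)
  case (Cons x xs)
  have "snd (for_each xs f (fst (f x s))) \<le> 1 + length xs * (B + 1)"
    by (rule Cons.IH) (use Cons.prems in simp)
  moreover have "snd (f x s) \<le> B" using Cons.prems by simp
  ultimately show ?case by (simp add: bind_timed_conv charge_def)
qed (simp add: ret_def)

section \<open>Correctness and cost of the enumeration\<close>

lemma fst_uses_edge: "fst (uses_edge u w p) \<longleftrightarrow> {u, w} \<in> set (walk_edges p)"
  by (induction u w p rule: uses_edge.induct)
    (auto simp: ret_def bind_timed_conv charge_def doubleton_eq_iff)

lemma snd_uses_edge_le: "snd (uses_edge u w p) \<le> length p + 1"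
  by (induction u w p rule: uses_edge.induct) (auto simp: ret_def bind_timed_conv charge_def)

definition extensions :: "nat \<Rightarrow> (nat \<Rightarrow> nat \<Rightarrow> bool) \<Rightarrow> nat list \<Rightarrow> nat list list" where
  "extensions n A p = map (\<lambda>w. w # p)
     (filter (\<lambda>w. A (hd p) w \<and> {hd p, w} \<notin> set (walk_edges p)) [1..<Suc n])"

lemma fst_extend_trail: "fst (extend_trail n A p acc) = rev (extensions n A p) @ acc"
proof -
  have "fold (\<lambda>w acc. fst (if A (hd p) w
            then bind_timed (uses_edge (hd p) w p) (\<lambda>used. ret (if used then acc else (w # p) # acc))
            else ret acc)) ws acc
      = rev (map (\<lambda>w. w # p) (filter (\<lambda>w. A (hd p) w \<and> {hd p, w} \<notin> set (walk_edges p)) ws)) @ acc" for ws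
    by (induction ws arbitrary: acc) (auto simp: bind_timed_conv ret_def fst_uses_edge)
  then show ?thesis by (simp add: extend_trail_def fst_for_each extensions_def del: upt_Suc)
qed

lemma snd_extend_trail_le: "snd (extend_trail n A p acc) \<le> 1 + n * (length p + 3)"
proof -
  have "snd (extend_trail n A p acc) \<le> 1 + length [1..<Suc n] * ((length p + 2) + 1)"
    unfolding extend_trail_def
  proof (rule snd_for_each_le)
    fix w acc
    show "snd (if A (hd p) w
            then bind_timed (uses_edge (hd p) w p) (\<lambda>used. ret (if used then acc else (w # p) # acc))
            else ret acc) \<le> length p + 2"
      using snd_uses_edge_le[of "hd p" w p] by (simp add: bind_timed_conv ret_def)
  qed
  then show ?thesis by (simp add: algebra_simps del: upt_Suc)
qed

lemma fold_rev_append: "fold (\<lambda>p acc. rev (g p) @ acc) ps acc = rev (concat (map g ps)) @ acc"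
  by (induction ps arbitrary: acc) auto

lemma enum_levels_Suc:
  "fst (enum_levels n A (Suc k) ps acc)
    = fst (enum_levels n A k (rev (concat (map (extensions n A) ps)))
        (concat (map (extensions n A) ps) @ acc))"
  by (simp add: bind_timed_conv fst_for_each fst_extend_trail fold_rev_append ret_def fold_Cons_rev)

text \<open>The cost is charged to the trails: R is the number of trails that the call adds, and
  each of them, like each trail in \<open>ps\<close>, is extended at most once, at a cost of about n
  times its length.\<close>

lemma snd_enum_levels_le:
  assumes "\<And>p. p \<in> set ps \<Longrightarrow> length p \<le> J"
  shows "\<exists>R. length (fst (enum_levels n A k ps acc)) = length acc + R \<and>
    snd (enum_levels n A k ps acc) \<le> 2 * k + 1 + (length ps + R) * (2 + n * (J + k + 3)) + 2 * R"
  using assms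
proof (induction k arbitrary: ps acc J)
  case 0
  then show ?case by (simp add: ret_def)
next
  case (Suc k)
  define qs where "qs = rev (concat (map (extensions n A) ps))"
  define acc' where "acc' = rev qs @ acc"
  let ?W = "2 + n * (J + Suc k + 3)"
  have qs: "fst (for_each ps (extend_trail n A) []) = qs"
    by (simp add: fst_for_each fst_extend_trail fold_rev_append qs_def)
  have acc': "fst (for_each qs (\<lambda>q acc. ret (q # acc)) acc) = acc'"
    by (simp add: fst_for_each ret_def fold_Cons_rev acc'_def)
  have "length q \<le> Suc J" if "q \<in> set qs" for q
    using that Suc.prems by (auto simp: qs_def extensions_def)
  from Suc.IH[OF this] obtain R where R:
    "length (fst (enum_levels n A k qs acc')) = length acc' + R"
    "snd (enum_levels n A k qs acc') \<le> 2 * k + 1 + (length qs + R) * (2 + n * (Suc J + k + 3)) + 2 * R"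
    by blast
  have "snd (for_each ps (extend_trail n A) []) \<le> 1 + length ps * ((1 + n * (J + 3)) + 1)"
  proof (rule snd_for_each_le)
    fix p s assume "p \<in> set ps"
    have "snd (extend_trail n A p s) \<le> 1 + n * (length p + 3)" by (rule snd_extend_trail_le)
    also have "\<dots> \<le> 1 + n * (J + 3)" using Suc.prems[OF \<open>p \<in> set ps\<close>] by simp
    finally show "snd (extend_trail n A p s) \<le> 1 + n * (J + 3)" .
  qed
  also have "\<dots> \<le> 1 + length ps * ?W"
  proof (rule add_left_mono[OF mult_le_mono2])
    show "1 + n * (J + 3) + 1 \<le> ?W" using mult_le_mono2[of "J + 3" "J + Suc k + 3" n] by simp
  qed
  finally have 1: "snd (for_each ps (extend_trail n A) []) \<le> 1 + length ps * ?W" .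
  have 2: "snd (for_each qs (\<lambda>q acc. ret (q # acc)) acc) \<le> 1 + length qs * (1 + 1)"
    by (rule snd_for_each_le) (simp add: ret_def)
  have res: "fst (enum_levels n A (Suc k) ps acc) = fst (enum_levels n A k qs acc')"
    "snd (enum_levels n A (Suc k) ps acc) = snd (for_each ps (extend_trail n A) []) +
       (snd (for_each qs (\<lambda>q acc. ret (q # acc)) acc) + snd (enum_levels n A k qs acc'))"
    using qs acc' by (simp_all add: bind_timed_conv)
  have "snd (enum_levels n A (Suc k) ps acc) \<le>
      (1 + length ps * ?W) + ((1 + length qs * 2) + (2 * k + 1 + (length qs + R) * ?W + 2 * R))"
    unfolding res(2) using 1 2 R(2) by (intro add_mono) (simp_all add: algebra_simps)
  also have "\<dots> = 2 * Suc k + 1 + (length ps + (length qs + R)) * ?W + 2 * (length qs + R)"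
    by (simp add: algebra_simps)
  finally have "snd (enum_levels n A (Suc k) ps acc) \<le>
    2 * Suc k + 1 + (length ps + (length qs + R)) * ?W + 2 * (length qs + R)" .
  moreover have "length (fst (enum_levels n A (Suc k) ps acc)) = length acc + (length qs + R)"
    unfolding res(1) R(1) by (simp add: acc'_def)
  ultimately show ?case by blast
qed

definition level :: "nat \<Rightarrow> graph \<Rightarrow> nat \<Rightarrow> nat list set" where
  "level n G k = {p \<in> walks n k. set (walk_edges p) \<subseteq> G}"

lemma level_Suc:
  assumes "set ps = level n G k"
  shows "set (concat (map (extensions n (\<lambda>u v. {u, v} \<in> G)) ps)) = level n G (Suc k)"
proof (intro equalityI subsetI)
  fix p assume "p \<in> set (concat (map (extensions n (\<lambda>u v. {u, v} \<in> G)) ps))"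
  then obtain q w where q: "q \<in> level n G k" "p = w # q" "w \<in> {1..n}" "{hd q, w} \<in> G"
    "{hd q, w} \<notin> set (walk_edges q)" using assms by (auto simp: extensions_def)
  moreover have "q \<noteq> []" using q(1) by (auto simp: level_def walks_def)
  ultimately show "p \<in> level n G (Suc k)"
    by (auto simp: level_def walks_def walk_edges_Cons insert_commute)
next
  fix p assume p: "p \<in> level n G (Suc k)"
  then have "p \<in> walks n (Suc k)" by (simp add: level_def)
  then obtain x q where q: "p = x # q" "x \<in> {1..n}" "q \<in> walks n k" "q \<noteq> []"
    "{x, hd q} \<notin> set (walk_edges q)" by (rule walks_SucE)
  then have "q \<in> set ps" "{x, hd q} \<in> G"
    using p assms by (auto simp: level_def walk_edges_Cons)
  then show "p \<in> set (concat (map (extensions n (\<lambda>u v. {u, v} \<in> G)) ps))"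
    using q by (auto simp: extensions_def insert_commute simp del: upt_Suc intro!: bexI[of _ q])
qed

lemma distinct_concat_extensions:
  assumes "distinct ps"
  shows "distinct (concat (map (extensions n A) ps))"
  using assms
proof (induction ps)
  case (Cons p ps)
  have "distinct (extensions n A p)"
    unfolding extensions_def by (auto simp: distinct_map inj_on_def simp del: upt_Suc)
  moreover have "set (extensions n A p) \<inter> set (concat (map (extensions n A) ps)) = {}"
    using Cons.prems by (auto simp: extensions_def)
  ultimately show ?case using Cons by simp
qed simp

lemma enum_levels_correct:
  assumes "set ps = level n G j" "distinct ps" "set acc = (\<Union>i\<in>{1..j}. level n G i)" "distinct acc"
  shows "set (fst (enum_levels n (\<lambda>u v. {u, v} \<in> G) k ps acc)) = (\<Union>i\<in>{1..j + k}. level n G i) \<and>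
    distinct (fst (enum_levels n (\<lambda>u v. {u, v} \<in> G) k ps acc))"
  using assms
proof (induction k arbitrary: j ps acc)
  case 0
  then show ?case by (simp add: ret_def)
next
  case (Suc k)
  let ?A = "\<lambda>u v. {u, v} \<in> G"
  let ?qs = "concat (map (extensions n ?A) ps)"
  have set_qs: "set ?qs = level n G (Suc j)" by (rule level_Suc) (rule Suc.prems)
  have dist: "distinct ?qs" by (rule distinct_concat_extensions) (rule Suc.prems)
  have "{1..Suc j} = insert (Suc j) {1..j}" by auto
  then have "set (?qs @ acc) = (\<Union>i\<in>{1..Suc j}. level n G i)"
    using set_qs Suc.prems(3) by simp
  \<comment> \<open>Different levels contain trails of different lengths, so nothing is listed
    twice.\<close>
  moreover have "set ?qs \<inter> set acc = {}"
    unfolding set_qs Suc.prems(3) by (auto simp: level_def walks_def)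
  then have "distinct (?qs @ acc)" using dist Suc.prems(4) by simp
  moreover have "set (rev ?qs) = level n G (Suc j)" "distinct (rev ?qs)" using set_qs dist by simp_all
  ultimately show ?case unfolding enum_levels_Suc using Suc.IH[of "rev ?qs" "Suc j" "?qs @ acc"]
    by simp
qed

lemma set_subset_Union_walk_edges: "2 \<le> length p \<Longrightarrow> set p \<subseteq> \<Union> (set (walk_edges p))"
proof (induction p rule: walk_edges.induct)
  case (1 u v p)
  then show ?case by (cases p) auto
qed auto

lemma walk_edges_subset_set: "e \<in> set (walk_edges p) \<Longrightarrow> e \<subseteq> set p"
  by (induction p rule: walk_edges.induct) auto

lemma short_trails_levels:
  assumes "G \<subseteq> all_edges_on n"
  shows "short_trails n G = (\<Union>i\<in>{1..nat \<lceil>ln (real n)\<rceil> - 1}. level n G i)"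
proof -
  have iff: "real i < ln (real n) \<longleftrightarrow> i \<le> nat \<lceil>ln (real n)\<rceil> - 1" if "1 \<le> i" for i :: nat
  proof -
    have "real i < ln (real n) \<longleftrightarrow> int i < \<lceil>ln (real n)\<rceil>" by (simp add: less_ceiling_iff)
    then show ?thesis using that by linarith
  qed
  show ?thesis
  proof (intro equalityI subsetI)
    fix p assume p: "p \<in> short_trails n G"
    note D = short_trailsD[OF p assms]
    have len: "1 \<le> length p - 1" using D(1) by (metis length_walk_edges length_greater_0_conv Suc_leI One_nat_def)
    then have "set p \<subseteq> \<Union> (set (walk_edges p))" by (intro set_subset_Union_walk_edges) simp
    also have "\<dots> \<subseteq> {1..n}" using D(5) by (auto simp: all_edges_on_def)
    finally have "p \<in> level n G (length p - 1)" using D len by (auto simp: level_def walks_def)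
    moreover have "length p - 1 \<le> nat \<lceil>ln (real n)\<rceil> - 1"
      using iff[OF len] p by (simp add: short_trails_def)
    ultimately show "p \<in> (\<Union>i\<in>{1..nat \<lceil>ln (real n)\<rceil> - 1}. level n G i)" using len by auto
  next
    fix p assume "p \<in> (\<Union>i\<in>{1..nat \<lceil>ln (real n)\<rceil> - 1}. level n G i)"
    then obtain i where i: "1 \<le> i" "i \<le> nat \<lceil>ln (real n)\<rceil> - 1" "p \<in> level n G i" by auto
    then have "length (walk_edges p) = i" by (simp add: level_def walks_def)
    moreover from this have "walk_edges p \<noteq> []" using i(1) by (metis list.size(3) not_one_le_zero)
    ultimately show "p \<in> short_trails n G"
      using iff[OF i(1)] i by (auto simp: short_trails_def trails_def level_def walks_def)
  qed
qed

lemma level_0: "level n G 0 = (\<lambda>v. [v]) ` {1..n}"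
  by (auto simp: level_def walks_0)

lemma enum_short_trails_correct:
  assumes "G \<subseteq> all_edges_on n"
  shows "set (fst (enum_short_trails n (\<lambda>u v. {u, v} \<in> G))) = short_trails n G"
    and "distinct (fst (enum_short_trails n (\<lambda>u v. {u, v} \<in> G)))"
    and "snd (enum_short_trails n (\<lambda>u v. {u, v} \<in> G)) \<le>
      2 * n + 2 * nat \<lceil>ln (real n)\<rceil> + 2 +
      (n + card (short_trails n G)) * (2 + n * (nat \<lceil>ln (real n)\<rceil> + 4)) + 2 * card (short_trails n G)"
proof -
  let ?A = "\<lambda>u v. {u, v} \<in> G" and ?K = "nat \<lceil>ln (real n)\<rceil>"
  define ps where "ps = rev (map (\<lambda>v. [v]) [1..<Suc n])"
  have "fold (\<lambda>v acc. [v] # acc) vs acc = rev (map (\<lambda>v. [v]) vs) @ acc" for vs and acc :: "nat list list"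
    by (induction vs arbitrary: acc) auto
  then have ps: "fst (for_each [1..<Suc n] (\<lambda>v acc. ret ([v] # acc)) []) = ps"
    by (simp add: fst_for_each ret_def ps_def del: upt_Suc)
  have res: "fst (enum_short_trails n ?A) = fst (enum_levels n ?A (?K - 1) ps [])"
    "snd (enum_short_trails n ?A) = snd (for_each [1..<Suc n] (\<lambda>v acc. ret ([v] # acc)) [])
       + snd (enum_levels n ?A (?K - 1) ps [])"
    unfolding enum_short_trails_def bind_timed_conv ps by simp_all
  have "set ps = level n G 0" unfolding ps_def level_0 by auto
  moreover have "distinct ps" unfolding ps_def by (simp add: distinct_map inj_on_def del: upt_Suc)
  ultimately have *: "set (fst (enum_levels n ?A (?K - 1) ps [])) = (\<Union>i\<in>{1..0 + (?K - 1)}. level n G i)"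
    "distinct (fst (enum_levels n ?A (?K - 1) ps []))"
    using enum_levels_correct[of ps n G 0 "[]" "?K - 1"] by simp_all
  then show s: "set (fst (enum_short_trails n ?A)) = short_trails n G"
    and d: "distinct (fst (enum_short_trails n ?A))"
    unfolding res short_trails_levels[OF assms] by simp_all
  have len: "length (fst (enum_short_trails n ?A)) = card (short_trails n G)"
    using distinct_card[OF d] s by simp
  have "length p \<le> 1" if "p \<in> set ps" for p using that by (auto simp: ps_def)
  from snd_enum_levels_le[of ps 1 n ?A "?K - 1" "[]", OF this]
  have 1: "snd (enum_levels n ?A (?K - 1) ps []) \<le> 2 * (?K - 1) + 1
     + (length ps + card (short_trails n G)) * (2 + n * (1 + (?K - 1) + 3)) + 2 * card (short_trails n G)"
    using len unfolding res(1) by auto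
  have "1 + (?K - 1) + 3 \<le> ?K + 4" by linarith
  then have "2 + n * (1 + (?K - 1) + 3) \<le> 2 + n * (?K + 4)" by (intro add_left_mono mult_le_mono2)
  then have "(length ps + card (short_trails n G)) * (2 + n * (1 + (?K - 1) + 3))
      \<le> (n + card (short_trails n G)) * (2 + n * (?K + 4))"
    by (rule mult_le_mono[rotated]) (simp add: ps_def)
  with 1 have "snd (enum_levels n ?A (?K - 1) ps []) \<le> 2 * ?K + 1
     + (n + card (short_trails n G)) * (2 + n * (?K + 4)) + 2 * card (short_trails n G)"
    by linarith
  moreover have "snd (for_each [1..<Suc n] (\<lambda>v acc. ret ([v] # acc)) ([] :: nat list list))
      \<le> 1 + length [1..<Suc n] * (1 + 1)" by (rule snd_for_each_le) (simp add: ret_def)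
  ultimately show "snd (enum_short_trails n ?A) \<le>
      2 * n + 2 * ?K + 2 +
      (n + card (short_trails n G)) * (2 + n * (?K + 4)) + 2 * card (short_trails n G)"
    unfolding res(2) by (simp del: upt_Suc)
qed


section \<open>The arrays maintained for the current edge set\<close>

definition ones :: "nat \<Rightarrow> (nat \<Rightarrow> nat) \<Rightarrow> nat" where
  "ones n d = card {x \<in> {1..n}. d x = 1}"

lemma ones_update:
  assumes "u \<in> {1..n}"
  shows "ones n (d(u := k)) = ones n d - (if d u = 1 then 1 else 0) + (if k = 1 then 1 else 0)"
proof -
  let ?S = "{x \<in> {1..n}. d x = 1}"
  have 1: "{x \<in> {1..n}. (d(u := k)) x = 1} = (if k = 1 then insert u (?S - {u}) else ?S - {u})"
    using assms by auto
  have 2: "card (?S - {u}) = card ?S - (if d u = 1 then 1 else 0)" using assms by auto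
  have 3: "card (insert u (?S - {u})) = card (?S - {u}) + 1" by (subst card_insert_disjoint) auto
  show ?thesis unfolding ones_def 1 using 2 3 by (cases "k = 1") (simp_all only: if_True if_False add_0_right simp_thms)
qed

text \<open>The abstraction relation in functional form: every state reached is
  \<open>state_of\<close> of an edge set, so correctness of an operation becomes an equation between
  states.\<close>

definition state_of :: "nat \<Rightarrow> graph \<Rightarrow> hstate" where
  "state_of n H = \<lparr>hmat = (\<lambda>u v. {u, v} \<in> H), hdeg = degree H, hsize = card H, hones = num_deg_1 n H\<rparr>"

lemma state_of_sel [simp]:
  "hmat (state_of n H) = (\<lambda>u v. {u, v} \<in> H)" "hdeg (state_of n H) = degree H"
  "hsize (state_of n H) = card H" "hones (state_of n H) = num_deg_1 n H"
  by (simp_all add: state_of_def)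

lemma empty_hstate_conv: "empty_hstate = state_of n {}"
  by (simp add: empty_hstate_def state_of_def degree_def num_deg_1_def fun_eq_iff)

lemma hedges_state_of:
  assumes "H \<subseteq> all_edges_on n"
  shows "hedges (state_of n H) = H"
proof
  show "H \<subseteq> hedges (state_of n H)"
  proof
    fix e assume "e \<in> H"
    then obtain u v where "e = {u, v}" using assms by (blast elim: all_edges_onE)
    then show "e \<in> hedges (state_of n H)" using \<open>e \<in> H\<close> by (auto simp: hedges_def)
  qed
qed (auto simp: hedges_def)

lemma flip_edge_state_of:
  assumes H: "H \<subseteq> all_edges_on n" and e: "{u, v} \<in> all_edges_on n"
  shows "flip_edge u v (state_of n H) = state_of n (H \<triangle> {{u, v}})"
proof -
  let ?e = "{u, v}" and ?H' = "H \<triangle> {{u, v}}"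
  have fin: "finite H" using H finite_all_edges_on finite_subset by blast
  have uv: "u \<noteq> v" "u \<in> {1..n}" "v \<in> {1..n}" using e by (auto simp: pair_in_all_edges_on)
  define upd where "upd = (\<lambda>k::nat. if ?e \<in> H then k - 1 else k + 1)"
  have deg: "degree ?H' x = (if x \<in> ?e then upd (degree H x) else degree H x)" for x
  proof (cases "?e \<in> H")
    case True
    then have "?H' = H - {?e}" by auto
    moreover have "degree (insert ?e (H - {?e})) x = degree (H - {?e}) x + of_bool (x \<in> ?e)"
      by (rule degree_insert) (use fin in auto)
    ultimately show ?thesis using True by (simp add: upd_def insert_absorb)
  next
    case False
    then have "?H' = insert ?e H" by auto
    then show ?thesis using degree_insert[OF fin False, of x] False by (simp add: upd_def)
  qed
  have card: "card ?H' = upd (card H)"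
  proof (cases "?e \<in> H")
    case True
    then have "?H' = H - {?e}" by auto
    then show ?thesis using True fin by (simp add: upd_def)
  next
    case False
    then have "?H' = insert ?e H" by auto
    then show ?thesis using False fin by (simp add: upd_def)
  qed
  have fu: "degree ?H' = (degree H)(u := upd (degree H u), v := upd (degree H v))"
    using uv(1) by (auto simp: deg fun_eq_iff)
  have "num_deg_1 n ?H' = ones n (degree ?H')" "num_deg_1 n H = ones n (degree H)"
    by (simp_all add: num_deg_1_def ones_def)
  then have nd: "num_deg_1 n ?H' = num_deg_1 n H - (if degree H u = 1 then 1 else 0)
      + (if upd (degree H u) = 1 then 1 else 0) - (if degree H v = 1 then 1 else 0)
      + (if upd (degree H v) = 1 then 1 else 0)"
    unfolding fu using ones_update[OF uv(2)] ones_update[OF uv(3)] uv(1) by simp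
  define M where "M = (\<lambda>x y. if x = u \<and> y = v \<or> x = v \<and> y = u then {u, v} \<notin> H else {x, y} \<in> H)"
  have mat: "M = (\<lambda>x y. {x, y} \<in> ?H')"
  proof (intro ext)
    fix x y
    show "M x y = ({x, y} \<in> ?H')"
      by (cases "{x, y} = ?e") (auto simp: M_def doubleton_eq_iff insert_commute)
  qed
  have set_deg: "set_deg x k \<lparr>hmat = M, hdeg = d, hsize = c, hones = o'\<rparr> =
      \<lparr>hmat = M, hdeg = d(x := k), hsize = c,
        hones = o' - (if d x = 1 then 1 else 0) + (if k = 1 then 1 else 0)\<rparr>" for x k d c o'
    by (simp add: set_deg_def)
  have "flip_edge u v (state_of n H) = set_deg v (upd (degree H v)) (set_deg u (upd (degree H u))
      \<lparr>hmat = M, hdeg = degree H, hsize = upd (card H), hones = num_deg_1 n H\<rparr>)"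
    unfolding flip_edge_def Let_def upd_def M_def state_of_def hstate.simps ..
  also have "\<dots> = state_of n ?H'"
    unfolding set_deg state_of_def card mat[symmetric] fu nd using uv(1) by simp
  finally show ?thesis .
qed

lemma fst_flip_trail:
  assumes "H \<subseteq> all_edges_on n" "distinct (walk_edges p)" "set (walk_edges p) \<subseteq> all_edges_on n"
  shows "fst (flip_trail p (state_of n H)) = state_of n (flip H p)"
  using assms
proof (induction p arbitrary: H rule: walk_edges.induct)
  case (1 u v p)
  let ?e = "{u, v}"
  have "fst (flip_trail (u # v # p) (state_of n H))
      = fst (flip_trail (v # p) (state_of n (H \<triangle> {?e})))"
    using 1 by (simp add: bind_timed_conv flip_edge_state_of)
  also have "\<dots> = state_of n (flip (H \<triangle> {?e}) (v # p))" using 1 by (intro "1.IH") auto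
  also have "flip (H \<triangle> {?e}) (v # p) = flip H (u # v # p)" using 1 by (auto simp: flip_def)
  finally show ?case .
qed (auto simp: flip_def ret_def)

lemma snd_flip_trail_le: "snd (flip_trail p s) \<le> length p + 1"
  by (induction p s rule: flip_trail.induct) (auto simp: bind_timed_conv charge_def ret_def)

lemma fst_degrees_ok: "fst (degrees_ok p s) \<longleftrightarrow> (\<forall>v\<in>set p. hdeg s v \<le> 2)"
  by (induction p s rule: degrees_ok.induct) (auto simp: bind_timed_conv charge_def ret_def)

lemma snd_degrees_ok_le: "snd (degrees_ok p s) \<le> length p + 1"
  by (induction p s rule: degrees_ok.induct) (auto simp: bind_timed_conv charge_def ret_def)

lemma flip_flip: "flip (flip H p) p = H"
  by (auto simp: flip_def)

lemma flip_subset: "H \<subseteq> A \<Longrightarrow> set (walk_edges p) \<subseteq> A \<Longrightarrow> flip H p \<subseteq> A"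
  by (auto simp: flip_def)

lemma deg_le_2_flip_iff:
  assumes "deg_le_2 n H" "walk_edges p \<noteq> []" "set (walk_edges p) \<subseteq> all_edges_on n"
  shows "deg_le_2 n (flip H p) \<longleftrightarrow> (\<forall>v\<in>set p. degree (flip H p) v \<le> 2)"
proof -
  have "2 \<le> length p" using assms(2) by (cases p rule: walk_edges.cases) auto
  then have "set p \<subseteq> \<Union> (set (walk_edges p))" by (rule set_subset_Union_walk_edges)
  also have "\<dots> \<subseteq> {1..n}" using assms(3) by (auto simp: all_edges_on_def)
  finally have sub: "set p \<subseteq> {1..n}" .
  have "degree (flip H p) v = degree H v" if "v \<notin> set p" for v
  proof -
    have "{e \<in> flip H p. v \<in> e} = {e \<in> H. v \<in> e}"
      using that walk_edges_subset_set[of _ p] unfolding flip_def by blast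
    then show ?thesis by (simp add: degree_def)
  qed
  then have "degree (flip H p) v \<le> 2" if "v \<notin> set p" "v \<in> {1..n}" for v
    using that assms(1) by (simp add: deg_le_2_def)
  then show ?thesis using sub unfolding deg_le_2_def by blast
qed

section \<open>Simulation of the algorithm on the arrays\<close>

context
  fixes n :: nat and G :: graph
  assumes G: "G \<subseteq> all_edges_on n"
begin

lemma inv_edges: "greedy_inv n G H \<Longrightarrow> H \<subseteq> all_edges_on n \<and> deg_le_2 n H"
  using G by (auto simp: greedy_inv_def)

lemma flip_trail_short:
  assumes "p \<in> short_trails n G" "H \<subseteq> all_edges_on n"
  shows "fst (flip_trail p (state_of n H)) = state_of n (flip H p)"
    and "fst (flip_trail p (state_of n (flip H p))) = state_of n H"
proof -
  note D = short_trailsD[OF assms(1) G]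
  show "fst (flip_trail p (state_of n H)) = state_of n (flip H p)"
    by (rule fst_flip_trail[OF assms(2) D(3,5)])
  show "fst (flip_trail p (state_of n (flip H p))) = state_of n H"
    using fst_flip_trail[OF flip_subset[OF assms(2) D(5)] D(3,5)] by (simp add: flip_flip)
qed

lemma degrees_ok_short:
  assumes "p \<in> short_trails n G" "deg_le_2 n H"
  shows "fst (degrees_ok p (state_of n (flip H p))) \<longleftrightarrow> deg_le_2 n (flip H p)"
  using deg_le_2_flip_iff[OF assms(2) short_trailsD(1,5)[OF assms(1) G]] by (simp add: fst_degrees_ok)

lemma fst_try_A:
  assumes "p \<in> short_trails n G" "greedy_inv n G H"
  shows "fst (try_A p (state_of n H)) = state_of n (step_A n p H)"
proof -
  note I = inv_edges[OF assms(2)]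
  show ?thesis
    using flip_trail_short[OF assms(1)] degrees_ok_short[OF assms(1)] I
    by (simp add: try_A_def bind_timed_conv ret_def step_A_def)
qed

lemma snd_try_A_le: "snd (try_A p s) \<le> 3 * length p + 3"
proof -
  define s1 where "s1 = fst (flip_trail p s)"
  define ok where "ok = fst (degrees_ok p s1)"
  let ?r = "if ok \<and> hsize s1 > hsize s \<and> hones s \<ge> hones s1 then ret s1 else flip_trail p s1"
  have "snd ?r \<le> length p + 1" using snd_flip_trail_le[of p s1] by (auto simp: ret_def)
  moreover have "snd (try_A p s) = snd (flip_trail p s) + (snd (degrees_ok p s1) + snd ?r)"
    by (simp add: try_A_def bind_timed_conv s1_def ok_def)
  ultimately show ?thesis using snd_flip_trail_le[of p s] snd_degrees_ok_le[of p s1] by linarith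
qed

definition best_step ::
  "('a \<Rightarrow> bool) \<Rightarrow> ('a \<Rightarrow> nat) \<Rightarrow> 'a \<Rightarrow> ('a \<times> nat) option \<Rightarrow> ('a \<times> nat) option" where
  "best_step adm val p best =
     (if adm p \<and> (case best of None \<Rightarrow> True | Some (q, m) \<Rightarrow> m < val p) then Some (p, val p) else best)"

text \<open>\<open>None\<close> survives only if no trail is admissible, and otherwise the running
  record is a maximizer with its value: exactly the two cases of \<open>step_B\<close>.\<close>

lemma fold_best_step:
  "case fold (best_step adm val) ps None of
     None \<Rightarrow> \<forall>p\<in>set ps. \<not> adm p
   | Some (q, m) \<Rightarrow> q \<in> set ps \<and> adm q \<and> m = val q \<and> (\<forall>p\<in>set ps. adm p \<longrightarrow> val p \<le> m)"
proof (induction ps rule: rev_induct)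
  case (snoc p ps)
  obtain b where b: "fold (best_step adm val) ps None = b" by blast
  have step: "fold (best_step adm val) (ps @ [p]) None = best_step adm val p b" by (simp add: b)
  show ?case unfolding step using snoc[unfolded b] by (cases b) (auto simp: best_step_def)
qed simp

lemma fst_try_B:
  assumes "p \<in> short_trails n G" "greedy_inv n G H"
  shows "fst (try_B p (state_of n H, best)) = (state_of n H,
    best_step (\<lambda>p. deg_le_2 n (flip H p)) (\<lambda>p. card (flip H p)) p best)"
proof -
  note I = inv_edges[OF assms(2)]
  show ?thesis
    using flip_trail_short[OF assms(1)] degrees_ok_short[OF assms(1)] I
    by (cases best) (simp_all add: try_B_def bind_timed_conv ret_def best_step_def)
qed

lemma snd_try_B_le: "snd (try_B p sb) \<le> 3 * length p + 4"
proof (cases sb)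
  case (Pair s best)
  let ?s1 = "fst (flip_trail p s)"
  have "snd (try_B p sb) = snd (flip_trail p s) + (snd (degrees_ok p ?s1) + (snd (flip_trail p ?s1) + 1))"
    by (simp add: Pair try_B_def bind_timed_conv ret_def)
  then show ?thesis
    using snd_flip_trail_le[of p s] snd_flip_trail_le[of p ?s1] snd_degrees_ok_le[of p ?s1] by linarith
qed

lemma fold_try_A:
  assumes "set ps \<subseteq> short_trails n G" "greedy_inv n G H"
  shows "fold (\<lambda>p s. fst (try_A p s)) ps (state_of n H) = state_of n (fold (step_A n) ps H)"
  using assms
  by (induction ps arbitrary: H) (simp_all add: fst_try_A greedy_inv_step_A[OF _ _ G])

lemma fold_try_B:
  assumes "set ps \<subseteq> short_trails n G" "greedy_inv n G H"
  shows "fold (\<lambda>p sb. fst (try_B p sb)) ps (state_of n H, best) = (state_of n H,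
    fold (best_step (\<lambda>p. deg_le_2 n (flip H p)) (\<lambda>p. card (flip H p))) ps best)"
  using assms by (induction ps arbitrary: best) (simp_all add: fst_try_B)

text \<open>The enumeration order is one of the orders open to (A), and the recorded trail is one of
  the maximizers open to (B).\<close>

lemma timed_iteration_correct:
  assumes "distinct ps" "set ps = short_trails n G" "greedy_inv n G H"
  obtains H' where "fst (timed_iteration n ps (state_of n H)) = state_of n H'"
    "iteration n (short_trails n G) H H'"
proof -
  define H1 where "H1 = fold (step_A n) ps H"
  let ?adm = "\<lambda>p. deg_le_2 n (flip H1 p)" and ?val = "\<lambda>p. card (flip H1 p)"
  define best where "best = fold (best_step ?adm ?val) ps None"
  have inv: "greedy_inv n G H1"
    unfolding H1_def by (rule greedy_inv_fold_step_A[OF assms(3) _ G]) (simp add: assms(2))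
  have A: "fst (for_each ps try_A (state_of n H)) = state_of n H1"
    unfolding fst_for_each H1_def by (rule fold_try_A[OF _ assms(3)]) (simp add: assms(2))
  have B: "fst (for_each ps try_B (state_of n H1, None)) = (state_of n H1, best)"
    unfolding fst_for_each best_def by (rule fold_try_B[OF _ inv]) (simp add: assms(2))
  have res: "fst (timed_iteration n ps (state_of n H)) = fst (case best of
        None \<Rightarrow> ret (state_of n H1)
      | Some (p, m) \<Rightarrow>
          if real m \<ge> real (card H1) + sqrt (ln (real n)) then flip_trail p (state_of n H1)
          else ret (state_of n H1))"
    unfolding timed_iteration_def bind_timed_conv A B by simp
  have it: "iteration n (short_trails n G) H H'" if "step_B n (short_trails n G) H1 H'" for H'
    unfolding iteration_def using that assms(1,2) H1_def by blast
  note best = fold_best_step[where adm = ?adm and val = ?val and ps = ps, folded best_def, unfolded assms(2)]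
  show ?thesis
  proof (cases best)
    case None
    then have "step_B n (short_trails n G) H1 H1" using best by (auto simp: step_B_def)
    then show ?thesis using that[of H1] it res None by (simp add: ret_def)
  next
    case (Some qm)
    obtain q m where qm: "best = Some (q, m)" using Some by (cases qm) auto
    then have q: "q \<in> short_trails n G" "?adm q" "m = ?val q"
      "\<And>p. p \<in> short_trails n G \<Longrightarrow> ?adm p \<Longrightarrow> ?val p \<le> m"
      using best by auto
    define H' where "H' = (if real m \<ge> real (card H1) + sqrt (ln (real n)) then flip H1 q else H1)"
    have "is_arg_max ?val (\<lambda>p. p \<in> short_trails n G \<and> ?adm p) q"
      unfolding is_arg_max_def using q by (auto simp: not_less)
    then have "step_B n (short_trails n G) H1 H'"
      unfolding step_B_def Let_def H'_def q(3) by blast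
    moreover have "fst (timed_iteration n ps (state_of n H)) = state_of n H'"
      unfolding res qm H'_def using flip_trail_short(1)[OF q(1)] inv_edges[OF inv] by (simp add: ret_def)
    ultimately show ?thesis using that it by blast
  qed
qed

lemma snd_timed_iteration_le:
  assumes "\<And>p. p \<in> set ps \<Longrightarrow> length p \<le> M"
  shows "snd (timed_iteration n ps s) \<le> length ps * (6 * M + 9) + M + 3"
proof -
  define s1 where "s1 = fst (for_each ps try_A s)"
  obtain s2 best where rb: "fst (for_each ps try_B (s1, None)) = (s2, best)"
    by (cases "fst (for_each ps try_B (s1, None))")
  let ?last = "case best of
        None \<Rightarrow> ret s2
      | Some (p, m) \<Rightarrow>
          if real m \<ge> real (hsize s2) + sqrt (ln (real n)) then flip_trail p s2 else ret s2"
  have res: "snd (timed_iteration n ps s)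
      = snd (for_each ps try_A s) + (snd (for_each ps try_B (s1, None)) + snd ?last)"
    by (simp add: timed_iteration_def bind_timed_conv s1_def[symmetric] rb)
  have "snd (for_each ps try_A s) \<le> 1 + length ps * ((3 * M + 3) + 1)"
    by (rule snd_for_each_le) (meson snd_try_A_le assms add_le_mono1 le_trans mult_le_mono2)
  moreover have "snd (for_each ps try_B (s1, None)) \<le> 1 + length ps * ((3 * M + 4) + 1)"
    by (rule snd_for_each_le) (meson snd_try_B_le assms add_le_mono1 le_trans mult_le_mono2)
  moreover have "snd ?last \<le> M + 1"
  proof -
    have r: "fold (\<lambda>p sb. fst (try_B p sb)) ps (s1, None) = (s2, best)" using rb by (simp add: fst_for_each)
    \<comment> \<open>The recorded trail comes from the list, which bounds the cost of the final
      flip.\<close>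
    have "(case snd (fold (\<lambda>p sb. fst (try_B p sb)) ps' (s1, None)) of None \<Rightarrow> True | Some (p, m) \<Rightarrow> p \<in> set ps')" for ps'
    proof (induction ps' rule: rev_induct)
      case (snoc p ps')
      show ?case
      proof (cases "fold (\<lambda>p sb. fst (try_B p sb)) ps' (s1, None)")
        case (Pair s' best)
        then show ?thesis using snoc
          by (cases best) (auto simp: try_B_def bind_timed_conv ret_def split: option.splits)
      qed
    qed simp
    from this[of ps] have mem: "case best of None \<Rightarrow> True | Some (p, m) \<Rightarrow> p \<in> set ps"
      unfolding r by simp
    show ?thesis
    proof (cases best)
      case (Some pm)
      obtain p m where pm: "pm = (p, m)" by (cases pm)
      then have "p \<in> set ps" using mem Some by simp
      then have "length p \<le> M" by (rule assms)
      then show ?thesis using snd_flip_trail_le[of p s2] by (auto simp: Some pm ret_def)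
    qed (simp add: ret_def)
  qed
  ultimately show ?thesis unfolding res by (simp add: algebra_simps)
qed

text \<open>This justifies that the implementation compares sizes only: (A) gains at least one edge,
  and (B) at least sqrt (ln n), which is positive whenever a short trail exists.\<close>

lemma iteration_card:
  assumes "iteration n (short_trails n G) H H'"
  shows "card H \<le> card H'" "card H' = card H \<Longrightarrow> H' = H"
proof -
  obtain ps where ps: "step_B n (short_trails n G) (fold (step_A n) ps H) H'"
    using assms unfolding iteration_def by blast
  note A = card_fold_step_A[of H n ps] and B = card_step_B_le[OF ps]
  show "card H \<le> card H'" using A B by linarith
  assume eq: "card H' = card H"
  then have F: "fold (step_A n) ps H = H" using A B by (metis le_antisym)
  show "H' = H"
  proof (rule ccontr)
    assume "H' \<noteq> H"
    then obtain p where p: "p \<in> short_trails n G"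
      "real (card H) + sqrt (ln (real n)) \<le> real (card H')"
      using step_B_cases[OF ps] unfolding F by blast
    have "0 < sqrt (ln (real n))" using short_trailsD(6)[OF p(1) G] by simp
    then show False using p(2) eq by simp
  qed
qed

text \<open>Each iteration but the last adds an edge and at most n edges are possible, so at most n
  + 1 iterations take place, each costing the same bound \<open>T + 1\<close>.\<close>

lemma timed_greedy_correct:
  defines "N \<equiv> card (short_trails n G)" and "K \<equiv> nat \<lceil>ln (real n)\<rceil>"
  shows "\<exists>H t. timed_greedy n G = Some (H, t) \<and> greedy_output n G H \<and>
    t \<le> 2 * n * n + 3 * n + 2 * K + 2 + (n + N) * (2 + n * (K + 4)) + 2 * N
      + (n + 1) * (N * (6 * (K + 1) + 9) + K + 5)"
proof -
  obtain ps t0 where enum: "enum_short_trails n (\<lambda>u v. {u, v} \<in> G) = (ps, t0)" by (cases "enum_short_trails n (\<lambda>u v. {u, v} \<in> G)")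
  have ps: "set ps = short_trails n G" "distinct ps"
    and t0: "t0 \<le> 2 * n + 2 * K + 2 + (n + N) * (2 + n * (K + 4)) + 2 * N"
    using enum_short_trails_correct[OF G] unfolding enum N_def K_def by simp_all
  have lps: "length ps = N" using distinct_card[OF ps(2)] ps(1) by (simp add: N_def)
  have len: "length p \<le> K + 1" if "p \<in> set ps" for p
  proof -
    have "p \<in> (\<Union>i\<in>{1..K - 1}. level n G i)" using that ps(1) short_trails_levels[OF G] by (simp add: K_def)
    then show ?thesis by (auto simp: level_def walks_def)
  qed
  define T where "T = N * (6 * (K + 1) + 9) + K + 4"
  have T: "snd (timed_iteration n ps s) \<le> T" for s
    using snd_timed_iteration_le[where ps = ps and s = s, OF len] by (simp add: T_def lps)
  define b :: "hstate \<times> bool \<times> nat \<Rightarrow> bool" where "b = (\<lambda>(s, updated, t). updated)"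
  define c :: "hstate \<times> bool \<times> nat \<Rightarrow> hstate \<times> bool \<times> nat" where
    "c = (\<lambda>(s, updated, t). let (s', t') = timed_iteration n ps s in (s', hsize s' \<noteq> hsize s, t + t' + 1))"
  define i where "i = n * n + n + t0"
  \<comment> \<open>While the flag is set, H is intermediate: every output reachable from it is an
    output for the empty start. Once the flag is cleared, H is such an output itself. The time is
    paid for by the edges of H, plus one final iteration.\<close>
  define P where "P = (\<lambda>(s, updated, t). \<exists>H. s = state_of n H \<and> greedy_inv n G H \<and>
    (updated \<longrightarrow> (\<forall>H'. greedy_loop n (short_trails n G) H H' \<longrightarrow> greedy_loop n (short_trails n G) {} H')) \<and>
    (\<not> updated \<longrightarrow> greedy_loop n (short_trails n G) {} H) \<and>
    t \<le> i + (card H + (if updated then 0 else 1)) * (T + 1))"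
  \<comment> \<open>An update decreases the room left for edges; the last iteration clears the
    flag.\<close>
  define f :: "hstate \<times> bool \<times> nat \<Rightarrow> nat" where "f = (\<lambda>(s, updated, t). 2 * (n - hsize s) + (if updated then 1 else 0 :: nat))"
  have card_n: "card H \<le> n" if "greedy_inv n G H" for H
    using inv_edges[OF that] card_le_of_deg_le_2 by blast
  have step: "P (c x) \<and> f (c x) < f x" if Px: "P x" and bx: "b x" for x
  proof -
    obtain s t where x: "x = (s, True, t)" using bx by (cases x) (auto simp: b_def)
    obtain H where H: "s = state_of n H" "greedy_inv n G H"
      "\<And>H'. greedy_loop n (short_trails n G) H H' \<Longrightarrow> greedy_loop n (short_trails n G) {} H'"
      "t \<le> i + card H * (T + 1)"
      using Px unfolding P_def x prod.case by auto
    obtain H' where H': "fst (timed_iteration n ps (state_of n H)) = state_of n H'"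
      "iteration n (short_trails n G) H H'" using timed_iteration_correct[OF ps(2,1) H(2)] by blast
    define t' where "t' = snd (timed_iteration n ps (state_of n H))"
    have cx: "c x = (state_of n H', card H' \<noteq> card H, t + t' + 1)"
      unfolding c_def x H(1) using H'(1) by (simp add: case_prod_beta t'_def)
    have t': "t' \<le> T" using T by (simp add: t'_def)
    have inv': "greedy_inv n G H'" by (rule greedy_inv_iteration[OF H(2) H'(2) G])
    note card' = iteration_card[OF H'(2)]
    show ?thesis
    proof (cases "card H' = card H")
      case True
      then have eq: "H' = H" by (rule card')
      then have "greedy_loop n (short_trails n G) {} H" using H(3) greedy_loop.stop H'(2) by blast
      moreover have "t + t' + 1 \<le> i + (card H + 1) * (T + 1)" using H(4) t' by simp
      then have "P (c x)" unfolding cx P_def prod.case using True H inv' eq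
        by (intro exI[of _ H']) (simp add: calculation)
      moreover have "f (c x) < f x" unfolding cx unfolding x H(1) using eq by (simp add: f_def)
      ultimately show ?thesis by simp
    next
      case False
      then have less: "card H + 1 \<le> card H'" using card'(1) by simp
      have "H' \<noteq> H" using False by auto
      then have "greedy_loop n (short_trails n G) {} H''" if "greedy_loop n (short_trails n G) H' H''" for H''
        using greedy_loop.continue[OF H'(2) _ that] H(3) by blast
      moreover have "t + t' + 1 \<le> i + card H' * (T + 1)"
      proof -
        have "t + t' + 1 \<le> i + (card H + 1) * (T + 1)" using H(4) t' by simp
        also have "\<dots> \<le> i + card H' * (T + 1)" using less by (intro add_left_mono mult_le_mono1)
        finally show ?thesis .
      qed
      ultimately have "P (c x)" unfolding cx P_def prod.case using False inv'
        by (intro exI[of _ H']) simp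
      moreover have "f (c x) < f x"
        unfolding cx unfolding x H(1) using less card_n[OF inv'] by (simp add: f_def)
      ultimately show ?thesis by simp
    qed
  qed
  have P0: "P (empty_hstate, True, i)"
  proof -
    have "greedy_inv n G {}" by (auto simp: greedy_inv_def deg_le_2_def degree_def num_deg_1_def)
    then show ?thesis unfolding P_def prod.case
      by (intro exI[of _ "{}"]) (simp add: empty_hstate_conv)
  qed
  obtain x where w: "while_option b c (empty_hstate, True, i) = Some x"
    using measure_while_option_Some[of P b c f, OF step P0] by blast
  have "P x" using while_option_rule[of P b c, OF _ w P0] step by blast
  moreover have "\<not> b x" using while_option_stop[OF w] .
  ultimately obtain s t H where x: "x = (s, False, t)" "s = state_of n H" "greedy_inv n G H"
    "greedy_loop n (short_trails n G) {} H" "t \<le> i + (card H + 1) * (T + 1)"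
    by (cases x) (auto simp: P_def b_def)
  have "timed_greedy n G = Some (H, t + n * n)"
    unfolding timed_greedy_def enum Let_def prod.case using w x hedges_state_of inv_edges[OF x(3)]
    by (simp add: b_def c_def i_def Let_def)
  moreover have "greedy_output n G H" using x(4) by (simp add: greedy_output_def)
  moreover have "(card H + 1) * (T + 1) \<le> (n + 1) * (T + 1)" using card_n[OF x(3)] by (intro mult_le_mono1) simp
  then have "t + n * n \<le> 2 * n * n + 3 * n + 2 * K + 2 + (n + N) * (2 + n * (K + 4)) + 2 * N
      + (n + 1) * (T + 1)" using x(5) t0 unfolding i_def by linarith
  moreover have "T + 1 = N * (6 * (K + 1) + 9) + K + 5" by (simp add: T_def)
  ultimately show ?thesis by metis
qed

end


section \<open>Asymptotics\<close>

lemma planted_fraction_tendsto: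
  fixes \<delta> :: real
  assumes "0 < \<delta>"
  shows "(\<lambda>n. real (nat \<lfloor>\<delta> * real n\<rfloor>) / real n) \<longlonglongrightarrow> \<delta>"
proof (rule tendsto_sandwich)
  have fl: "\<delta> * real n - 1 \<le> real (nat \<lfloor>\<delta> * real n\<rfloor>)" "real (nat \<lfloor>\<delta> * real n\<rfloor>) \<le> \<delta> * real n" for n
  proof -
    have "0 \<le> \<delta> * real n" using assms by simp
    then show "\<delta> * real n - 1 \<le> real (nat \<lfloor>\<delta> * real n\<rfloor>)" "real (nat \<lfloor>\<delta> * real n\<rfloor>) \<le> \<delta> * real n"
      by linarith+
  qed
  show "eventually (\<lambda>n. \<delta> - 1 / real n \<le> real (nat \<lfloor>\<delta> * real n\<rfloor>) / real n) sequentially"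
    using eventually_gt_at_top[of 0]
  proof eventually_elim
    case (elim n)
    then have "\<delta> - 1 / real n = (\<delta> * real n - 1) / real n" by (simp add: field_simps)
    then show ?case using divide_right_mono[OF fl(1), of "real n" n] by simp
  qed
  show "eventually (\<lambda>n. real (nat \<lfloor>\<delta> * real n\<rfloor>) / real n \<le> \<delta>) sequentially"
    using eventually_gt_at_top[of 0] by eventually_elim (use fl in \<open>simp add: field_simps\<close>)
  show "(\<lambda>n. \<delta> - 1 / real n) \<longlonglongrightarrow> \<delta>" by real_asymp
qed simp

text \<open>The condition of the weight locale involves the rounded number of planted vertices; its
  left-hand side converges to the strict inequality for \<delta>.\<close>

lemma eventually_growth:
  fixes \<delta> lam z \<rho> :: real
  assumes "0 < \<delta>" "\<delta> \<le> 1" "0 < z" "z < \<rho>" "lam / \<rho> * (2 * \<delta> / (\<rho> - z) + (1 - \<delta>) / z) < 1"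
  shows "eventually (\<lambda>n. lam / real n / z * (real (nat \<lfloor>\<delta> * real n\<rfloor>) * (2 * z / (\<rho> * (\<rho> - z)))
    + real (n - nat \<lfloor>\<delta> * real n\<rfloor>) / \<rho>) \<le> 1) sequentially"
proof -
  let ?q = "\<lambda>n. real (nat \<lfloor>\<delta> * real n\<rfloor>) / real n"
  let ?f = "\<lambda>q. lam / z * (q * (2 * z / (\<rho> * (\<rho> - z))) + (1 - q) / \<rho>)"
  have "?f \<delta> = lam / \<rho> * (2 * \<delta> / (\<rho> - z) + (1 - \<delta>) / z)"
    using assms by (simp add: divide_simps)
  then have "?f \<delta> < 1" using assms(5) by simp
  moreover have "(\<lambda>n. ?f (?q n)) \<longlonglongrightarrow> ?f \<delta>"
    by (intro tendsto_intros planted_fraction_tendsto) (use assms in auto)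
  ultimately have "eventually (\<lambda>n. ?f (?q n) < 1) sequentially" by (intro order_tendstoD(2))
  then show ?thesis using eventually_gt_at_top[of 0]
  proof eventually_elim
    case (elim n)
    have "\<delta> * real n \<le> real n" using assms by (simp add: mult_left_le_one_le)
    then have le: "nat \<lfloor>\<delta> * real n\<rfloor> \<le> n" by linarith
    have "lam / real n / z * (real (nat \<lfloor>\<delta> * real n\<rfloor>) * (2 * z / (\<rho> * (\<rho> - z)))
      + real (n - nat \<lfloor>\<delta> * real n\<rfloor>) / \<rho>) = ?f (?q n)"
      using elim(2) assms le by (simp add: of_nat_diff divide_simps)
    then show ?case using elim(1) by simp
  qed
qed

lemma eventually_ln_ge: "eventually (\<lambda>n. c \<le> ln (real n)) sequentially"
proof -
  have "filterlim (\<lambda>n::nat. ln (real n)) at_top sequentially" by real_asymp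
  then show ?thesis by (simp add: filterlim_at_top)
qed

lemma eventually_planted_card_ge:
  fixes \<delta> :: real
  assumes "0 < \<delta>"
  shows "eventually (\<lambda>n. 3 \<le> nat \<lfloor>\<delta> * real n\<rfloor> \<and> \<delta> * real n / 2 \<le> real (nat \<lfloor>\<delta> * real n\<rfloor>)) sequentially"
proof -
  have "filterlim (\<lambda>n::nat. \<delta> * real n) at_top sequentially" using assms by real_asymp
  then have "eventually (\<lambda>n. 4 \<le> \<delta> * real n) sequentially" by (simp add: filterlim_at_top)
  then show ?thesis by eventually_elim linarith
qed

definition recovery_error :: "(nat \<Rightarrow> graph \<Rightarrow> graph) \<Rightarrow> nat \<Rightarrow> real \<Rightarrow> graph \<Rightarrow> real" where
  "recovery_error alg n lam h = measure_pmf.expectation (with_planted n lam h)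
     (\<lambda>(Hs, G). real (card (alg n G \<triangle> Hs)))"

lemma recovery_error_nonneg: "0 \<le> recovery_error alg n lam h"
  unfolding recovery_error_def by (intro integral_nonneg_AE) (auto simp: case_prod_beta)

text \<open>The rate \<epsilon> is the same for all planted 2-factors, so it serves every choice of
  conditioning and also the average over them.\<close>

lemma recovery_error_uniform:
  fixes \<delta> lam :: real
  assumes "0 < \<delta>" "\<delta> \<le> 1" "0 < lam" "lam < 1 / (sqrt (2 * \<delta>) + sqrt (1 - \<delta>))\<^sup>2"
  obtains \<epsilon> where "\<epsilon> \<longlonglongrightarrow> (0::real)"
    "\<And>alg. greedy_algorithm alg \<Longrightarrow> eventually (\<lambda>n. \<forall>h\<in>planted_two_factors n \<delta>.
       recovery_error alg n lam h \<le> \<epsilon> n * real n) sequentially"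
proof -
  obtain z \<rho> where z: "0 < z" "z < \<rho>" "\<rho> < 1" "lam / \<rho> * (2 * \<delta> / (\<rho> - z) + (1 - \<delta>) / z) < 1"
    using ex_weight_parameters[OF assms] by blast
  let ?e = "error_bound lam z \<rho> (alternating_weights.walk_const z \<rho>)"
  have "?e \<longlonglongrightarrow> 0" by (rule error_bound_tendsto_0) (use z in auto)
  moreover have "eventually (\<lambda>n. \<forall>h\<in>planted_two_factors n \<delta>. recovery_error alg n lam h \<le> ?e n * real n) sequentially"
    if alg: "greedy_algorithm alg" for alg
  proof -
    have "eventually (\<lambda>n. nat \<lceil>lam\<rceil> \<le> n) sequentially" by (rule eventually_ge_at_top)
    then show ?thesis using eventually_growth[OF assms(1,2) z(1,2,4)] eventually_ln_ge[of 6]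
    proof eventually_elim
      case (elim n)
      show ?case
      proof
        fix h assume "h \<in> planted_two_factors n \<delta>"
        then obtain V where V: "V \<subseteq> {1..n}" "card V = nat \<lfloor>\<delta> * real n\<rfloor>" "h \<in> two_factors V"
          by (rule planted_two_factorsE)
        have "lam \<le> real n" using elim(1) by linarith
        then show "recovery_error alg n lam h \<le> ?e n * real n"
          unfolding recovery_error_def
          by (intro expected_error_le[OF alg V(3,1) assms(3) _ z(1-3) _ elim(3)])
            (use elim(2) V(2) in simp_all)
      qed
    qed
  qed
  ultimately show ?thesis using that by blast
qed

lemma card_planted:
  assumes "h \<in> planted_two_factors n \<delta>"
  shows "card h = nat \<lfloor>\<delta> * real n\<rfloor>"
  using assms two_factors_props(3) by (metis planted_two_factorsE)

lemma expected_relative_error: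
  "measure_pmf.expectation (with_planted n lam h) (\<lambda>(Hs, G). real (card (alg n G \<triangle> Hs)) / real (card Hs))
    = recovery_error alg n lam h / real (card h)"
  by (simp add: recovery_error_def with_planted_def)

text \<open>\<open>pmf_of_set\<close> is meaningful for nonempty sets only; at least three planted
  vertices ensure that a 2-factor exists.\<close>

lemma set_planted_law_subset:
  assumes "3 \<le> nat \<lfloor>\<delta> * real n\<rfloor>" "nat \<lfloor>\<delta> * real n\<rfloor> \<le> n"
  shows "set_pmf (planted_law n \<delta>) \<subseteq> planted_two_factors n \<delta>"
proof -
  have "nat \<lfloor>\<delta> * real n\<rfloor> \<le> card {1..n}" using assms(2) by simp
  then obtain V0 where "V0 \<subseteq> {1..n}" "card V0 = nat \<lfloor>\<delta> * real n\<rfloor>"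
    by (rule obtain_subset_with_card_n)
  then have ne: "planted_vertex_sets n \<delta> \<noteq> {}" unfolding planted_vertex_sets_def by blast
  have "set_pmf (pmf_of_set (two_factors V)) = two_factors V" if "V \<in> planted_vertex_sets n \<delta>" for V
  proof (rule set_pmf_of_set)
    have "V \<subseteq> {1..n}" "3 \<le> card V" using that assms(1) by (simp_all add: planted_vertex_sets_def)
    from finite_subset[OF this(1)] this(2) have "finite V" "3 \<le> card V" by simp_all
    then show "two_factors V \<noteq> {}" "finite (two_factors V)"
      by (rule two_factors_nonempty, intro finite_two_factors)
  qed
  then show ?thesis
    unfolding planted_law_def set_bind_pmf set_pmf_of_set[OF ne finite_planted_vertex_sets]
      planted_two_factors_def by (intro UN_mono order_refl) simp
qed

lemma finite_planted_two_factors: "finite (planted_two_factors n \<delta>)"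
  unfolding planted_two_factors_def
  by (intro finite_UN_I finite_planted_vertex_sets finite_two_factors)
    (auto simp: planted_vertex_sets_def intro: finite_subset)

lemma expectation_mixture_le:
  fixes f :: "graph \<times> graph \<Rightarrow> real"
  assumes "3 \<le> nat \<lfloor>\<delta> * real n\<rfloor>" "nat \<lfloor>\<delta> * real n\<rfloor> \<le> n"
    and "\<And>h. h \<in> planted_two_factors n \<delta> \<Longrightarrow> measure_pmf.expectation (with_planted n lam h) f \<le> b"
  shows "measure_pmf.expectation (planted_cycles n lam \<delta>) f \<le> b"
proof -
  note sub = set_planted_law_subset[OF assms(1,2)]
  let ?A = "planted_two_factors n \<delta>"
  have "measure_pmf.expectation (planted_cycles n lam \<delta>) f
      = (\<Sum>h\<in>?A. pmf (planted_law n \<delta>) h *\<^sub>R measure_pmf.expectation (with_planted n lam h) f)"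
    unfolding planted_cycles_conv
    by (rule pmf_expectation_bind[OF finite_planted_two_factors _ sub])
      (simp add: with_planted_def finite_set_erdos_renyi)
  also have "\<dots> \<le> (\<Sum>h\<in>?A. pmf (planted_law n \<delta>) h * b)"
    by (intro sum_mono) (auto intro!: mult_left_mono assms(3))
  also have "\<dots> = b"
    using sum_pmf_eq_1[OF finite_planted_two_factors sub] by (simp add: sum_distrib_right[symmetric])
  finally show ?thesis .
qed

section \<open>Running time with high probability\<close>

lemma expected_short_trails_le:
  assumes h: "finite h" "\<And>v. degree h v \<le> 2" "h \<subseteq> all_edges_on n"
    and lam: "0 < lam" "lam \<le> real n"
  shows "measure_pmf.expectation (erdos_renyi n (lam / real n))
      (\<lambda>G0. real (card (short_trails n (G0 \<union> h)))) \<le> ln (real n) * real n powr (1 + ln (2 + lam))"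
proof -
  let ?K = "nat \<lceil>ln (real n)\<rceil>" and ?p = "erdos_renyi n (lam / real n)"
  have n: "0 < real n" using lam by simp
  have c: "0 \<le> lam / real n" "lam / real n \<le> 1" using lam n by auto
  have int: "integrable (measure_pmf ?p) f" for f :: "graph \<Rightarrow> real"
    by (rule integrable_measure_pmf_finite[OF finite_set_erdos_renyi])
  have "measure_pmf.expectation ?p (\<lambda>G0. real (card (short_trails n (G0 \<union> h))))
      \<le> measure_pmf.expectation ?p (\<lambda>G0. \<Sum>k\<in>{1..?K - 1}. real (card (level n (G0 \<union> h) k)))"
  proof (rule integral_mono_AE[OF int int])
    have "real (card (short_trails n (G0 \<union> h))) \<le> (\<Sum>k\<in>{1..?K - 1}. real (card (level n (G0 \<union> h) k)))"
      if "G0 \<in> set_pmf ?p" for G0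
    proof -
      have "G0 \<union> h \<subseteq> all_edges_on n" using that set_erdos_renyi h(3) by blast
      from short_trails_levels[OF this]
      have "card (short_trails n (G0 \<union> h)) \<le> (\<Sum>k\<in>{1..?K - 1}. card (level n (G0 \<union> h) k))"
        by (simp add: card_UN_le)
      then show ?thesis by (simp flip: of_nat_sum)
    qed
    then show "AE G0 in measure_pmf ?p. real (card (short_trails n (G0 \<union> h)))
        \<le> (\<Sum>k\<in>{1..?K - 1}. real (card (level n (G0 \<union> h) k)))" by (simp add: AE_measure_pmf_iff)
  qed
  also have "\<dots> = (\<Sum>k\<in>{1..?K - 1}. measure_pmf.expectation ?p (\<lambda>G0. real (card (level n (G0 \<union> h) k))))"
    by (rule Bochner_Integration.integral_sum) (rule int)
  also have "\<dots> \<le> (\<Sum>k\<in>{1..?K - 1}. real n powr (1 + ln (2 + lam)))"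
  proof (rule sum_mono)
    fix k assume k: "k \<in> {1..?K - 1}"
    then have kl: "real k \<le> ln (real n)" by (auto simp: nat_le_iff) linarith
    have "measure_pmf.expectation ?p (\<lambda>G0. real (card (level n (G0 \<union> h) k)))
        \<le> (\<Sum>p\<in>walks n k. (lam / real n) ^ blue h p)"
      unfolding level_def by (rule expected_card_walks_le[OF c finite_walks])
    also have "\<dots> \<le> real n * (2 + real n * (lam / real n)) ^ k"
      by (rule sum_walks_weight_le[OF h(1,2) c(1)])
    also have "(2 + real n * (lam / real n)) ^ k = (2 + lam) powr real k"
      using n lam by (simp add: powr_realpow)
    also have "\<dots> \<le> (2 + lam) powr ln (real n)" using kl lam by (intro powr_mono) auto
    \<comment> \<open>Both sides are exp (ln n * ln (2 + lam)). This is the origin of the logarithm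
      in the exponent of the running time.\<close>
    also have "\<dots> = real n powr ln (2 + lam)" using n lam by (simp add: powr_def mult.commute)
    finally have "measure_pmf.expectation ?p (\<lambda>G0. real (card (level n (G0 \<union> h) k)))
        \<le> real n * real n powr ln (2 + lam)" using n by (simp add: mult_left_mono)
    then show "measure_pmf.expectation ?p (\<lambda>G0. real (card (level n (G0 \<union> h) k)))
        \<le> real n powr (1 + ln (2 + lam))" using n by (simp add: powr_add)
  qed
  also have "\<dots> = real (?K - 1) * real n powr (1 + ln (2 + lam))" by simp
  also have "\<dots> \<le> ln (real n) * real n powr (1 + ln (2 + lam))"
  proof (rule mult_right_mono)
    show "real (?K - 1) \<le> ln (real n)" using ln_real_nat_ge_0[of n] by linarith
  qed simp
  finally show ?thesis .
qed

text \<open>With N short trails the dominant costs are n N ln n, both for enumerating and for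
  iterating, and n^2 ln n for extending the single vertices; the hypothesis bounds N ln n by
  \<open>Y\<close>.\<close>

lemma runs_within_if_few_trails:
  assumes G: "G \<subseteq> all_edges_on n" and n: "6 \<le> ln (real n)" and lam: "0 < lam"
    and N: "real (card (short_trails n G)) * ln (real n) \<le> real n powr (2 + ln (2 + lam))"
  shows "runs_within n G (50 * real n powr (3 + ln (2 + lam)))"
proof -
  define N where "N = card (short_trails n G)"
  define K where "K = nat \<lceil>ln (real n)\<rceil>"
  define x l k Y where "x = real n" and "l = ln x" and "k = real K" and "Y = x powr (2 + ln (2 + lam))"
  obtain H t where t: "timed_greedy n G = Some (H, t)"
    "t \<le> 2 * n * n + 3 * n + 2 * K + 2 + (n + N) * (2 + n * (K + 4)) + 2 * N
      + (n + 1) * (N * (6 * (K + 1) + 9) + K + 5)"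
    using timed_greedy_correct[OF G] unfolding N_def K_def by blast
  have l: "6 \<le> l" using n by (simp add: l_def x_def)
  have x1: "1 \<le> x" using l unfolding l_def x_def by (cases n) auto
  have lx: "l \<le> x" unfolding l_def using ln_le_minus_one[of x] x1 by simp
  have k: "k \<le> l + 1" "0 \<le> k" using l by (auto simp: k_def K_def l_def x_def)
  define y where "y = real N"
  have y: "0 \<le> y" "y * l \<le> Y" using N by (auto simp: y_def N_def l_def x_def Y_def)
  have Y: "0 \<le> Y" by (simp add: Y_def)
  have Yx: "x * x \<le> Y"
  proof -
    have "x * x = x powr 2" using x1 by (simp add: powr_numeral power2_eq_square)
    also have "\<dots> \<le> Y" unfolding Y_def using x1 lam by (intro powr_mono) auto
    finally show ?thesis .
  qed
  have "real t \<le> real (2 * n * n + 3 * n + 2 * K + 2 + (n + N) * (2 + n * (K + 4)) + 2 * N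
      + (n + 1) * (N * (6 * (K + 1) + 9) + K + 5))" using t(2) by (rule of_nat_mono)
  also have "\<dots> = 2 * (x * x) + 3 * x + 2 * k + 2 + (x + y) * (2 + x * (k + 4)) + 2 * y
      + (x + 1) * (y * (6 * (k + 1) + 9) + k + 5)"
    by (simp add: x_def y_def k_def algebra_simps)
  also have "\<dots> \<le> 2 * (x * x) + 3 * x + 4 * l + (x + y) * (x * (3 * l)) + 2 * y
      + (2 * x) * (y * (10 * l) + 2 * l)"
  proof -
    have "2 + x * (k + 4) \<le> x * 2 + x * (k + 4)" using x1 by simp
    also have "\<dots> = x * (k + 6)" by (simp add: algebra_simps)
    also have "\<dots> \<le> x * (3 * l)" using k l x1 by (intro mult_left_mono) auto
    finally have 1: "(x + y) * (2 + x * (k + 4)) \<le> (x + y) * (x * (3 * l))"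
      using x1 y by (intro mult_left_mono) auto
    have "y * (6 * (k + 1) + 9) \<le> y * (10 * l)" using y k l by (intro mult_left_mono) auto
    then have "(x + 1) * (y * (6 * (k + 1) + 9) + k + 5) \<le> (2 * x) * (y * (10 * l) + 2 * l)"
      using x1 y k l by (intro mult_mono) auto
    with 1 show ?thesis using k l by linarith
  qed
  also have "\<dots> = 2 * (x * x) + 3 * x + 4 * l + 3 * (x * (x * l)) + 23 * (x * (y * l)) + 2 * y + 4 * (x * l)"
    by (simp add: algebra_simps)
  \<comment> \<open>Every summand is at most its coefficient times \<open>x * Y\<close>, and the
    coefficients add up to 41.\<close>
  also have "\<dots> \<le> 50 * (x * Y)"
  proof -
    have xx: "x \<le> x * x" using x1 by simp
    have YY: "Y \<le> x * Y" using mult_right_mono[OF x1 Y] by simp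
    have "x * l \<le> x * x" using lx x1 by (intro mult_left_mono) auto
    then have 1: "x * l \<le> Y" using Yx by simp
    then have 2: "x * (x * l) \<le> x * Y" using x1 by (intro mult_left_mono) auto
    have 3: "x * (y * l) \<le> x * Y" using y x1 by (intro mult_left_mono) auto
    have "y * 1 \<le> y * l" using y l by (intro mult_left_mono) auto
    then have 4: "y \<le> Y" using y by simp
    have 5: "0 \<le> x * Y" using x1 by (simp add: Y_def)
    show ?thesis using xx YY 1 2 3 4 5 Yx lx by linarith
  qed
  also have "x * Y = real n powr (3 + ln (2 + lam))"
  proof -
    have "real n powr (3 + ln (2 + lam)) = x powr (1 + (2 + ln (2 + lam)))" by (simp add: x_def)
    also have "\<dots> = x * Y" unfolding powr_add using x1 by (simp add: Y_def powr_add)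
    finally show ?thesis ..
  qed
  finally show ?thesis unfolding runs_within_def using t(1) by blast
qed

text \<open>Markov's inequality at the threshold T, which exceeds the expected number of short
  trails by a factor n / (ln n)^2.\<close>

lemma prob_runs_within_ge:
  assumes h: "h \<in> planted_two_factors n \<delta>" and lam: "0 < lam" "lam \<le> real n" and n: "6 \<le> ln (real n)"
  shows "1 - (ln (real n))\<^sup>2 / real n \<le> measure_pmf.prob (with_planted n lam h)
    {(Hs, G). runs_within n G (50 * real n powr (3 + ln (2 + lam)))}"
proof -
  let ?p = "erdos_renyi n (lam / real n)" and ?a = "ln (2 + lam)"
  obtain V where V: "V \<subseteq> {1..n}" "h \<in> two_factors V" using h by (rule planted_two_factorsE)
  note hp = two_factors_props[OF V(2,1)]
  have fin: "finite h" using hp(1) finite_all_edges_on finite_subset by blast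
  have n0: "0 < real n" "0 < ln (real n)" using lam n by linarith+
  define X where "X = (\<lambda>G0. real (card (short_trails n (G0 \<union> h))))"
  define T where "T = real n powr (2 + ?a) / ln (real n)"
  have T: "0 < T" using n0 by (simp add: T_def)
  have "measure_pmf.prob ?p {G0. T \<le> X G0} \<le> measure_pmf.expectation ?p X / T"
    using integral_Markov_inequality_measure[of "measure_pmf ?p" X "{}" T] T
    by (simp add: integrable_measure_pmf_finite[OF finite_set_erdos_renyi] X_def)
  also have "\<dots> \<le> (ln (real n) * real n powr (1 + ?a)) / T"
    unfolding X_def
    by (intro divide_right_mono expected_short_trails_le fin hp(1) lam) (use hp(2) T in auto)
  also have "\<dots> = (ln (real n))\<^sup>2 / real n"
  proof -
    have "real n powr (2 + ?a) = real n powr (1 + (1 + ?a))" by simp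
    also have "\<dots> = real n * real n powr (1 + ?a)" unfolding powr_add[of _ 1 "1 + ?a"] using n0 by simp
    finally show ?thesis unfolding T_def using n0 by (simp add: power2_eq_square field_simps)
  qed
  finally have "1 - (ln (real n))\<^sup>2 / real n \<le> 1 - measure_pmf.prob ?p {G0. T \<le> X G0}" by simp
  also have "\<dots> = measure_pmf.prob ?p (UNIV - {G0. T \<le> X G0})"
    using measure_pmf.prob_compl[of "{G0. T \<le> X G0}" ?p] by simp
  also have "\<dots> \<le> measure_pmf.prob ?p
      {G0. runs_within n (G0 \<union> h) (50 * real n powr (3 + ?a))}"
  proof (rule measure_pmf.finite_measure_mono_AE)
    have "runs_within n (G0 \<union> h) (50 * real n powr (3 + ?a))"
      if "G0 \<in> set_pmf ?p" "\<not> T \<le> X G0" for G0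
    proof (rule runs_within_if_few_trails[OF _ n lam(1)])
      show "G0 \<union> h \<subseteq> all_edges_on n" using that set_erdos_renyi hp(1) by blast
      show "real (card (short_trails n (G0 \<union> h))) * ln (real n) \<le> real n powr (2 + ?a)"
        using that(2) n0 by (simp add: T_def X_def field_simps)
    qed
    then show "AE G0 in measure_pmf ?p. G0 \<in> UNIV - {G0. T \<le> X G0} \<longrightarrow>
        G0 \<in> {G0. runs_within n (G0 \<union> h) (50 * real n powr (3 + ?a))}"
      by (simp add: AE_measure_pmf_iff)
  qed simp
  also have "\<dots> = measure_pmf.prob (with_planted n lam h)
      {(Hs, G). runs_within n G (50 * real n powr (3 + ?a))}"
    by (simp add: with_planted_def vimage_def)
  finally show ?thesis .
qed

theorem theorem4:
  fixes \<delta> lam :: real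
  assumes "0 < \<delta>" "\<delta> \<le> 1" "0 < lam"
    and "lam < 1 / (sqrt (2 * \<delta>) + sqrt (1 - \<delta>))\<^sup>2"
  shows
    "(\<forall>alg. greedy_algorithm alg \<longrightarrow>
        (\<forall>h. (\<forall>\<^sub>F n in sequentially. h n \<in> planted_two_factors n \<delta>) \<longrightarrow>
           (\<lambda>n. measure_pmf.expectation (planted_cycles_given n lam \<delta> (h n))
                  (\<lambda>(Hs, G). real (card (alg n G \<triangle> Hs)))) \<in> o(\<lambda>n. real n) \<and>
           (\<lambda>n. measure_pmf.expectation (planted_cycles_given n lam \<delta> (h n))
                  (\<lambda>(Hs, G). real (card (alg n G \<triangle> Hs)) / real (card Hs))) \<longlonglongrightarrow> 0) \<and>
        (\<lambda>n. measure_pmf.expectation (planted_cycles n lam \<delta>)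
               (\<lambda>(Hs, G). real (card (alg n G \<triangle> Hs)) / real (card Hs))) \<longlonglongrightarrow> 0) \<and>
     (\<forall>n. \<forall>G \<subseteq> all_edges_on n. \<exists>H t. timed_greedy n G = Some (H, t) \<and> greedy_output n G H) \<and>
     (\<exists>C. \<forall>h. (\<forall>\<^sub>F n in sequentially. h n \<in> planted_two_factors n \<delta>) \<longrightarrow>
        (\<lambda>n. measure_pmf.prob (planted_cycles_given n lam \<delta> (h n))
               {(Hs, G). runs_within n G (C * real n powr (3 + ln (2 + lam)))}) \<longlonglongrightarrow> 1)"
proof -
  obtain \<epsilon> where \<epsilon>: "\<epsilon> \<longlonglongrightarrow> (0::real)"
    "\<And>alg. greedy_algorithm alg \<Longrightarrow> eventually (\<lambda>n. \<forall>h\<in>planted_two_factors n \<delta>.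
       recovery_error alg n lam h \<le> \<epsilon> n * real n) sequentially"
    using recovery_error_uniform[OF assms] by blast
  \<comment> \<open>The factor 2 / \<delta> turns an error relative to n into one relative to
    \<open>card h\<close>, which is eventually at least \<delta> n / 2.\<close>
  have \<epsilon>': "(\<lambda>n. 2 / \<delta> * \<epsilon> n) \<longlonglongrightarrow> 0" using tendsto_mult_left[OF \<epsilon>(1), of "2 / \<delta>"] by simp
  have rel: "eventually (\<lambda>n. \<forall>h\<in>planted_two_factors n \<delta>.
      recovery_error alg n lam h / real (card h) \<le> 2 / \<delta> * \<epsilon> n) sequentially"
    if "greedy_algorithm alg" for alg
    using \<epsilon>(2)[OF that] eventually_planted_card_ge[OF assms(1)]
  proof eventually_elim
    case (elim n)
    show ?case
    proof
      fix h assume h: "h \<in> planted_two_factors n \<delta>"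
      then have c: "\<delta> * real n / 2 \<le> real (card h)" "0 < real (card h)"
        unfolding card_planted[OF h] using elim(2) by linarith+
      have e: "recovery_error alg n lam h \<le> \<epsilon> n * real n" using elim(1) h by blast
      have n: "0 < real n" using elim(2) by (cases n) auto
      \<comment> \<open>The rate bounds a nonnegative error from above. Its sign is needed to
        replace n by a multiple of \<open>card h\<close>.\<close>
      have "0 \<le> \<epsilon> n" using e recovery_error_nonneg[of alg n lam h] n
        by (metis linorder_not_le mult_neg_pos order_trans)
      then have "\<epsilon> n * real n \<le> 2 / \<delta> * \<epsilon> n * real (card h)"
        using mult_left_mono[OF c(1), of "2 / \<delta> * \<epsilon> n"] assms(1) by simp
      then show "recovery_error alg n lam h / real (card h) \<le> 2 / \<delta> * \<epsilon> n"
        using e c(2) by (simp add: pos_divide_le_eq)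
    qed
  qed
  have given: "eventually (\<lambda>n. planted_cycles_given n lam \<delta> (h n) = with_planted n lam (h n)) sequentially"
    if "eventually (\<lambda>n. h n \<in> planted_two_factors n \<delta>) sequentially" for h
    using that by eventually_elim (rule planted_cycles_given_conv)
  have 1: "(\<lambda>n. measure_pmf.expectation (planted_cycles_given n lam \<delta> (h n))
              (\<lambda>(Hs, G). real (card (alg n G \<triangle> Hs)))) \<in> o(\<lambda>n. real n)"
    if alg: "greedy_algorithm alg"
      and h: "eventually (\<lambda>n. h n \<in> planted_two_factors n \<delta>) sequentially" for alg h
  proof (rule smalloI_tendsto)
    let ?E = "\<lambda>n. measure_pmf.expectation (planted_cycles_given n lam \<delta> (h n))
              (\<lambda>(Hs, G). real (card (alg n G \<triangle> Hs)))"
    have E: "eventually (\<lambda>n. ?E n = recovery_error alg n lam (h n)) sequentially"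
      using given[OF h] by eventually_elim (simp add: recovery_error_def)
    show "(\<lambda>n. ?E n / real n) \<longlonglongrightarrow> 0"
    proof (rule tendsto_sandwich[OF _ _ tendsto_const \<epsilon>(1)])
      show "eventually (\<lambda>n. 0 \<le> ?E n / real n) sequentially"
        using E by eventually_elim (simp add: recovery_error_nonneg)
      show "eventually (\<lambda>n. ?E n / real n \<le> \<epsilon> n) sequentially"
        using E \<epsilon>(2)[OF alg] h eventually_gt_at_top[of 0]
        by eventually_elim (simp add: pos_divide_le_eq)
    qed
    show "eventually (\<lambda>n. real n \<noteq> 0) sequentially"
      using eventually_gt_at_top[of 0] by eventually_elim simp
  qed
  have 2: "(\<lambda>n. measure_pmf.expectation (planted_cycles_given n lam \<delta> (h n))
              (\<lambda>(Hs, G). real (card (alg n G \<triangle> Hs)) / real (card Hs))) \<longlonglongrightarrow> 0"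
    if alg: "greedy_algorithm alg"
      and h: "eventually (\<lambda>n. h n \<in> planted_two_factors n \<delta>) sequentially" for alg h
  proof (rule tendsto_sandwich[OF _ _ tendsto_const \<epsilon>'])
    let ?E = "\<lambda>n. measure_pmf.expectation (planted_cycles_given n lam \<delta> (h n))
              (\<lambda>(Hs, G). real (card (alg n G \<triangle> Hs)) / real (card Hs))"
    have E: "eventually (\<lambda>n. ?E n = recovery_error alg n lam (h n) / real (card (h n))) sequentially"
      using given[OF h] by eventually_elim (simp add: expected_relative_error)
    show "eventually (\<lambda>n. 0 \<le> ?E n) sequentially"
      using E by eventually_elim (simp add: recovery_error_nonneg)
    show "eventually (\<lambda>n. ?E n \<le> 2 / \<delta> * \<epsilon> n) sequentially"
      using E rel[OF alg] h by eventually_elim simp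
  qed
  have 3: "(\<lambda>n. measure_pmf.expectation (planted_cycles n lam \<delta>)
              (\<lambda>(Hs, G). real (card (alg n G \<triangle> Hs)) / real (card Hs))) \<longlonglongrightarrow> 0"
    if alg: "greedy_algorithm alg" for alg
  proof (rule tendsto_sandwich[OF _ _ tendsto_const \<epsilon>'])
    show "eventually (\<lambda>n. measure_pmf.expectation (planted_cycles n lam \<delta>)
        (\<lambda>(Hs, G). real (card (alg n G \<triangle> Hs)) / real (card Hs)) \<le> 2 / \<delta> * \<epsilon> n) sequentially"
      using rel[OF alg] eventually_planted_card_ge[OF assms(1)]
    proof eventually_elim
      case (elim n)
      have "\<delta> * real n \<le> real n" using assms by (simp add: mult_left_le_one_le)
      then have "nat \<lfloor>\<delta> * real n\<rfloor> \<le> n" by linarith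
      \<comment> \<open>The bound holds for all planted 2-factors of this n simultaneously, hence
        for their mixture.\<close>
      then show ?case
        by (intro expectation_mixture_le) (use elim in \<open>simp_all add: expected_relative_error\<close>)
    qed
  qed (auto intro!: always_eventually integral_nonneg_AE simp: case_prod_beta)
  have 4: "(\<lambda>n. measure_pmf.prob (planted_cycles_given n lam \<delta> (h n))
      {(Hs, G). runs_within n G (50 * real n powr (3 + ln (2 + lam)))}) \<longlonglongrightarrow> 1"
    if h: "eventually (\<lambda>n. h n \<in> planted_two_factors n \<delta>) sequentially" for h
  proof (rule tendsto_sandwich[OF _ _ _ tendsto_const])
    show "(\<lambda>n::nat. 1 - (ln (real n))\<^sup>2 / real n) \<longlonglongrightarrow> 1" by real_asymp
    show "eventually (\<lambda>n. 1 - (ln (real n))\<^sup>2 / real n \<le> measure_pmf.prob (planted_cycles_given n lam \<delta> (h n))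
      {(Hs, G). runs_within n G (50 * real n powr (3 + ln (2 + lam)))}) sequentially"
      using h given[OF h] eventually_ge_at_top[of "nat \<lceil>lam\<rceil>"] eventually_ln_ge[of 6]
    proof eventually_elim
      case (elim n)
      have "lam \<le> real n" using elim(3) by linarith
      then show ?case unfolding elim(2) by (rule prob_runs_within_ge[OF elim(1) assms(3) _ elim(4)])
    qed
  qed simp
  have 5: "\<exists>H t. timed_greedy n G = Some (H, t) \<and> greedy_output n G H"
    if "G \<subseteq> all_edges_on n" for n G
    using timed_greedy_correct[OF that] by blast
  show ?thesis using 1 2 3 4 5 by blast
qed

end
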